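(* Let $P\subset\mathbb{R}^3$ be a polyhedron (not necessarily convex) with an exposed vertex $H$, and let $\theta_H$ be the inradius of the Gauss image $g(H)$. If $$\deg(H)>\frac{2\pi}{\tan(\theta_H)},$$ then $P$ can be perturbed to have lower Melzak ratio and one more face: there is a perturbation $\{P_t\}_{t\in[0,\epsilon]}$ of $P$ such that, for all sufficiently small $t>0$, $m(P_t)<m(P)$ and $P_t$ has exactly one more face than $P$.
   Context: A polyhedron is a compact solid region in $\mathbb{R}^3$ with nonempty interior bounded by finitely many planar polygonal faces. $e(P)$ is the total edge length of $P$, $v(P)$ its volume, and the Melzak ratio is $m(P)=e(P)^3/v(P)$. $\deg(H)$ is the number of edges of $P$ meeting at the vertex $H$. A vertex $H$ of $P$ is exposed if it is contained in an open neighborhood $U_H$ such that $U_H\cap P$ is convex. The Gauss image $g(H)$ at the vertex $H$ is obtained by sending each face of $P$ at $H$ to its outward unit normal in $S^2$ and joining by geodesics the points corresponding to adjacent faces; when $H$ is exposed, $g(H)$ is (the boundary of, and is identified with) a convex spherical polygon. Its inscribed circle is the boundary of the largest spherical disc contained in it; the inradius $\theta_H$ is the spherical (angular) radius of this disc. A perturbation of $P$ is a one-parameter family $\{P_t\}_{t\in[0,\epsilon]}$ ($\epsilon>0$) of polyhedra with $P_0=P$ and $P_t\to P$ (in Hausdorff distance) as $t\to 0^+$. *)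

theory Defs
  imports "HOL-Analysis.Analysis"
begin

text \<open>
  Faces, edges and vertices are read off from the solid \<open>P\<close> itself, through the local shape of \<open>P\<close>
  at its boundary points: a half-space at points inside a face, a wedge, possibly non-convex (or
  several wedges touching along a line), at points inside an edge, anything else at vertices.
  Thus a flat piece of the boundary is never subdivided into several faces.
\<close>

definition outward_normal_at :: "(real^3) set \<Rightarrow> real^3 \<Rightarrow> real^3 \<Rightarrow> bool" where
  "outward_normal_at P x n \<longleftrightarrow>
     norm n = 1 \<and> (\<exists>r>0. P \<inter> ball x r = {y \<in> ball x r. n \<bullet> (y - x) \<le> 0})"

definition face_points :: "(real^3) set \<Rightarrow> (real^3) set" where
  "face_points P = {x. \<exists>n. outward_normal_at P x n}"

text \<open>The normal is locally constant on \<open>face_points P\<close>, so each component lies in a plane.\<close>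

definition faces :: "(real^3) set \<Rightarrow> (real^3) set set" where
  "faces P = closure ` components (face_points P)"

text \<open>Near a point inside an edge, \<open>P\<close> is invariant under translation along the edge.\<close>

definition edge_points :: "(real^3) set \<Rightarrow> (real^3) set" where
  "edge_points P = {x \<in> frontier P - face_points P.
     \<exists>d r. d \<noteq> 0 \<and> r > 0 \<and>
       (\<forall>y\<in>ball x r. \<forall>s. y + s *\<^sub>R d \<in> ball x r \<longrightarrow> (y + s *\<^sub>R d \<in> P \<longleftrightarrow> y \<in> P))}"

definition vertices :: "(real^3) set \<Rightarrow> (real^3) set" where
  "vertices P = frontier P - face_points P - edge_points P"

definition edges :: "(real^3) set \<Rightarrow> (real^3) set set" where
  "edges P = {closed_segment a b | a b.
     a \<in> vertices P \<and> b \<in> vertices P \<and> a \<noteq> b \<and> open_segment a b \<subseteq> edge_points P}"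

text \<open>
  Polygons may be non-convex and may have holes. The regularity condition
  \<open>closure (rel_interior F) = F\<close> excludes one-dimensional whiskers and isolated points.
\<close>

definition planar_polygon :: "(real^3) set \<Rightarrow> bool" where
  "planar_polygon F \<longleftrightarrow> aff_dim F = 2 \<and> closure (rel_interior F) = F \<and>
     (\<exists>T. finite T \<and> (\<forall>C\<in>T. polytope C) \<and> F = \<Union>T)"

text \<open>
  Not to be confused with the library's \<^const>\<open>polyhedron\<close>, a finite intersection of half-spaces.
\<close>

definition solid_polyhedron :: "(real^3) set \<Rightarrow> bool" where
  "solid_polyhedron P \<longleftrightarrow>
     compact P \<and> connected P \<and> interior P \<noteq> {} \<and> closure (interior P) = P \<and>
     finite (faces P) \<and> (\<forall>F\<in>faces P. planar_polygon F) \<and> frontier P = \<Union>(faces P)"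

text \<open>The length of a segment is its diameter.\<close>

definition total_edge_length :: "(real^3) set \<Rightarrow> real" where
  "total_edge_length P = (\<Sum>E\<in>edges P. diameter E)"

definition melzak_ratio :: "(real^3) set \<Rightarrow> real" where
  "melzak_ratio P = total_edge_length P ^ 3 / measure lebesgue P"

definition vertex_degree :: "(real^3) set \<Rightarrow> real^3 \<Rightarrow> nat" where
  "vertex_degree P H = card {E \<in> edges P. H \<in> E}"

definition exposed_vertex :: "(real^3) set \<Rightarrow> real^3 \<Rightarrow> bool" where
  "exposed_vertex P H \<longleftrightarrow> H \<in> vertices P \<and> (\<exists>U. open U \<and> H \<in> U \<and> convex (U \<inter> P))"

definition face_normal :: "(real^3) set \<Rightarrow> (real^3) set \<Rightarrow> real^3" where
  "face_normal P F = (THE n. \<forall>x \<in> F \<inter> face_points P. outward_normal_at P x n)"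

definition adjacent_faces_at :: "(real^3) set \<Rightarrow> real^3 \<Rightarrow> (real^3) set \<Rightarrow> (real^3) set \<Rightarrow> bool" where
  "adjacent_faces_at P H F G \<longleftrightarrow> F \<in> faces P \<and> G \<in> faces P \<and> F \<noteq> G \<and>
     (\<exists>E\<in>edges P. H \<in> E \<and> E \<subseteq> F \<inter> G)"

text \<open>The shorter great-circle arc between two non-antipodal unit vectors.\<close>

definition geodesic_arc :: "real^3 \<Rightarrow> real^3 \<Rightarrow> (real^3) set" where
  "geodesic_arc a b = sgn ` closed_segment a b"

definition gauss_curve :: "(real^3) set \<Rightarrow> real^3 \<Rightarrow> (real^3) set" where
  "gauss_curve P H = \<Union>{geodesic_arc (face_normal P F) (face_normal P G) | F G.
     adjacent_faces_at P H F G}"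

text \<open>
  At an exposed vertex the normals lie in an open hemisphere and \<open>gauss_curve P H\<close> is the boundary
  of a convex spherical polygon. That polygon is the spherical convex hull of its boundary, i.e. the
  trace on the sphere of the convex cone spanned by the curve.
\<close>

definition gauss_image :: "(real^3) set \<Rightarrow> real^3 \<Rightarrow> (real^3) set" where
  "gauss_image P H = sphere 0 1 \<inter> convex_cone hull (gauss_curve P H)"

definition spherical_disc :: "real^3 \<Rightarrow> real \<Rightarrow> (real^3) set" where
  "spherical_disc c \<rho> = {x \<in> sphere 0 1. arccos (c \<bullet> x) \<le> \<rho>}"

definition spherical_inradius :: "(real^3) set \<Rightarrow> real" where
  "spherical_inradius S = Sup {\<rho>. \<rho> \<ge> 0 \<and> (\<exists>c \<in> sphere 0 1. spherical_disc c \<rho> \<subseteq> S)}"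

definition hausdorff_distance :: "(real^3) set \<Rightarrow> (real^3) set \<Rightarrow> real" where
  "hausdorff_distance S T = max (SUP x\<in>S. infdist x T) (SUP y\<in>T. infdist y S)"

definition perturbation :: "(real^3) set \<Rightarrow> real \<Rightarrow> (real \<Rightarrow> (real^3) set) \<Rightarrow> bool" where
  "perturbation P \<epsilon> Q \<longleftrightarrow>
     \<epsilon> > 0 \<and> (\<forall>t\<in>{0..\<epsilon>}. solid_polyhedron (Q t)) \<and> Q 0 = P \<and>
     ((\<lambda>t. hausdorff_distance (Q t) P) \<longlongrightarrow> 0) (at_right 0)"

end

theory Submission
  imports Defs
begin

text \<open>
  Let \<open>c\<close> be the centre of a spherical disc of radius \<open>\<rho>\<close> inside the Gauss image at \<open>H\<close>. Every point of
  the disc is an outer normal of the tangent cone \<open>K\<close> at \<open>H\<close>, and it follows that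
  \<open>c \<bullet> k \<le> - sin \<rho> * norm k\<close> for all \<open>k \<in> K\<close>. Cut \<open>P\<close> near \<open>H\<close> by the plane orthogonal to \<open>c\<close> at depth \<open>t\<close>
  below \<open>H\<close>. The cut shortens each of the \<open>deg H\<close> edges at \<open>H\<close> by at least \<open>t\<close>. The new edges bound the cross
  section, a convex polygon that lies in a disc of radius \<open>t * cot \<rho>\<close> because of the slope of \<open>K\<close>, so
  their total length is at most \<open>2 * pi * t * cot \<rho>\<close>. If \<open>\<rho>\<close> is close enough to the inradius, the
  assumption on the degree makes the total edge length drop by a fixed positive multiple of \<open>t\<close>. The
  volume drops only by a multiple of \<open>t ^ 3\<close>, so the Melzak ratio decreases for small \<open>t\<close>. The cut adds
  one face and destroys none.

  Since faces, edges and vertices are defined through germs of the solid, most of the work is to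
  control germs. The solids in question are, up to connectedness, the compact regular closed sets
  whose boundary lies in finitely many planes (\<open>plane_bounded\<close>), a condition to which the cut adds
  just one plane. Such a solid is a cone near each point. If a cone around \<open>x\<close> is also a cone around a
  nearby point \<open>y\<close>, it is invariant near \<open>y\<close> under translation along the line through \<open>x\<close> and \<open>y\<close>
  (\<open>translation_invariant_near_if_conical\<close>); and a boundary point with two independent directions of
  invariance is a face point (\<open>face_point_if_invariant_in_two_directions\<close>). From this it follows that
  vertices are isolated, that edges do not overlap, that edge points along a ray from \<open>H\<close> continue up to
  a vertex, and which edges the truncated solid can have (\<open>edges_truncated_subset\<close>).

  The inradius is positive because the normals of the faces at \<open>H\<close> span the space
  (\<open>span_gauss_curve\<close>): each of two different extreme rays of the tangent cone carries an edge and provides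
  two normals. The perimeter bound is Crofton's (\<open>boundary_segments_length\<close>): a line through the interior
  of a convex polygon meets its boundary only twice, so the projections of its sides to any direction have total length at
  most \<open>4 * R\<close>, and averaging over the directions gives \<open>2 * pi * R\<close>.
\<close>

section \<open>Local symmetries of a solid\<close>

definition translation_invariant_near :: "(real^3) set \<Rightarrow> real^3 \<Rightarrow> real^3 \<Rightarrow> bool" where
  "translation_invariant_near P x d \<longleftrightarrow>
     (\<exists>r>0. \<forall>y\<in>ball x r. \<forall>s. y + s *\<^sub>R d \<in> ball x r \<longrightarrow> (y + s *\<^sub>R d \<in> P \<longleftrightarrow> y \<in> P))"

text \<open>
  The same ball bounds a point and its image, so that a homothety and its inverse are treated alike.
\<close>

definition conical_near :: "(real^3) set \<Rightarrow> real^3 \<Rightarrow> real \<Rightarrow> bool" where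
  "conical_near P x r \<longleftrightarrow>
     (\<forall>y \<mu>. 0 < \<mu> \<longrightarrow> y \<in> ball x r \<longrightarrow> x + \<mu> *\<^sub>R (y - x) \<in> ball x r \<longrightarrow> y \<in> P \<longrightarrow>
        x + \<mu> *\<^sub>R (y - x) \<in> P)"

lemma edge_points_iff:
  "x \<in> edge_points P \<longleftrightarrow>
     x \<in> frontier P \<and> x \<notin> face_points P \<and> (\<exists>d. d \<noteq> 0 \<and> translation_invariant_near P x d)"
  unfolding edge_points_def translation_invariant_near_def by blast

lemma translation_invariant_nearI:
  assumes "r > 0"
    and "\<And>y s. y \<in> ball x r \<Longrightarrow> y + s *\<^sub>R d \<in> ball x r \<Longrightarrow> y \<in> P \<Longrightarrow> y + s *\<^sub>R d \<in> P"
  shows "translation_invariant_near P x d"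
  unfolding translation_invariant_near_def
proof (intro exI conjI ballI allI impI)
  fix y s assume y: "y \<in> ball x r" and ys: "y + s *\<^sub>R d \<in> ball x r"
  have "(y + s *\<^sub>R d) + (- s) *\<^sub>R d = y" by simp
  with assms(2)[of "y + s *\<^sub>R d" "- s"] y ys
  have "y + s *\<^sub>R d \<in> P \<Longrightarrow> y \<in> P" by simp
  then show "y + s *\<^sub>R d \<in> P \<longleftrightarrow> y \<in> P" using assms(2)[OF y ys] by blast
qed (use assms in auto)

lemma translation_invariant_nearE:
  assumes "translation_invariant_near P x d"
  obtains r where "r > 0" "\<And>y s. y \<in> ball x r \<Longrightarrow> y + s *\<^sub>R d \<in> ball x r \<Longrightarrow>
      (y + s *\<^sub>R d \<in> P \<longleftrightarrow> y \<in> P)"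
  using assms unfolding translation_invariant_near_def by blast

text \<open>
  A translation along the combination is done in two steps; the ball is shrunk so that the
  intermediate point stays where both invariances are available.
\<close>

lemma translation_invariant_near_combination:
  assumes "translation_invariant_near P x d1" "translation_invariant_near P x d2"
  shows "translation_invariant_near P x (\<alpha> *\<^sub>R d1 + \<beta> *\<^sub>R d2)"
proof (cases "\<alpha> *\<^sub>R d1 + \<beta> *\<^sub>R d2 = 0")
  case True
  then show ?thesis unfolding translation_invariant_near_def by (intro exI[of _ 1]) auto
next
  case False
  define d where "d = \<alpha> *\<^sub>R d1 + \<beta> *\<^sub>R d2"
  have dpos: "norm d > 0" using False d_def by simp
  obtain r1 where r1: "r1 > 0" "\<And>y s. y \<in> ball x r1 \<Longrightarrow> y + s *\<^sub>R d1 \<in> ball x r1 \<Longrightarrow>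
      (y + s *\<^sub>R d1 \<in> P \<longleftrightarrow> y \<in> P)"
    using assms(1) by (rule translation_invariant_nearE) (rule that)
  obtain r2 where r2: "r2 > 0" "\<And>y s. y \<in> ball x r2 \<Longrightarrow> y + s *\<^sub>R d2 \<in> ball x r2 \<Longrightarrow>
      (y + s *\<^sub>R d2 \<in> P \<longleftrightarrow> y \<in> P)"
    using assms(2) by (rule translation_invariant_nearE) (rule that)
  define r where "r = min r1 r2"
  define q where "q = norm (\<alpha> *\<^sub>R d1) / norm d"
  define \<delta> where "\<delta> = r / (1 + 2 * q)"
  have rpos: "r > 0" using r1 r2 r_def by simp
  have q0: "q \<ge> 0" unfolding q_def by simp
  have dl: "\<delta> > 0" unfolding \<delta>_def using rpos q0 by simp
  have del: "\<delta> + 2 * \<delta> * q = r"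
  proof -
    have "\<delta> * (1 + 2 * q) = r" unfolding \<delta>_def using q0 by simp
    then show ?thesis by (simp add: algebra_simps)
  qed
  have dr: "\<delta> \<le> r" using del dl q0 by (smt (verit) mult_nonneg_nonneg)
  show ?thesis
    unfolding d_def[symmetric]
  proof (rule translation_invariant_nearI[OF dl])
    fix y s assume y: "y \<in> ball x \<delta>" and ys: "y + s *\<^sub>R d \<in> ball x \<delta>" and yP: "y \<in> P"
    have "norm (s *\<^sub>R d) < 2 * \<delta>"
    proof -
      have "norm (s *\<^sub>R d) \<le> dist x y + dist x (y + s *\<^sub>R d)"
        using dist_triangle[of "y + s *\<^sub>R d" y x] by (simp add: dist_norm norm_minus_commute)
      then show ?thesis using y ys by simp
    qed
    then have s: "\<bar>s\<bar> * norm d < 2 * \<delta>" by simp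
    have "norm ((s * \<alpha>) *\<^sub>R d1) = (\<bar>s\<bar> * norm d) * q"
      unfolding q_def using dpos by (simp add: abs_mult)
    also have "\<dots> \<le> 2 * \<delta> * q" using s q0 by (intro mult_right_mono) auto
    finally have n1: "norm ((s * \<alpha>) *\<^sub>R d1) \<le> 2 * \<delta> * q" .
    have mid: "y + (s * \<alpha>) *\<^sub>R d1 \<in> ball x r"
    proof -
      have "dist x (y + (s * \<alpha>) *\<^sub>R d1) \<le> dist x y + norm ((s * \<alpha>) *\<^sub>R d1)"
        using dist_triangle[of x "y + (s * \<alpha>) *\<^sub>R d1" y] by (simp add: dist_norm)
      then show ?thesis using n1 y del by simp
    qed
    have "y + (s * \<alpha>) *\<^sub>R d1 \<in> P"
      using r1(2)[of y "s * \<alpha>"] y mid yP dr unfolding r_def by auto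
    moreover have e: "(y + (s * \<alpha>) *\<^sub>R d1) + (s * \<beta>) *\<^sub>R d2 = y + s *\<^sub>R d"
      unfolding d_def by (simp add: algebra_simps)
    ultimately show "y + s *\<^sub>R d \<in> P"
      using r2(2)[of "y + (s * \<alpha>) *\<^sub>R d1" "s * \<beta>"] mid ys dr unfolding e r_def by auto
  qed
qed

lemma translation_invariant_near_nearby:
  assumes "translation_invariant_near P x d"
  shows "\<exists>r>0. \<forall>y\<in>ball x r. translation_invariant_near P y d"
proof -
  obtain r where r: "r > 0" "\<And>y s. y \<in> ball x r \<Longrightarrow> y + s *\<^sub>R d \<in> ball x r \<Longrightarrow>
      (y + s *\<^sub>R d \<in> P \<longleftrightarrow> y \<in> P)"
    using assms by (rule translation_invariant_nearE) (rule that)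
  have "translation_invariant_near P y d" if y: "y \<in> ball x r" for y
  proof (rule translation_invariant_nearI)
    show "r - dist x y > 0" using y by simp
    have sub: "ball y (r - dist x y) \<subseteq> ball x r"
      by (simp add: ball_subset_ball_iff dist_commute)
    show "z + s *\<^sub>R d \<in> P" if "z \<in> ball y (r - dist x y)" "z + s *\<^sub>R d \<in> ball y (r - dist x y)"
       "z \<in> P" for z s
      using r(2)[of z s] that sub by blast
  qed
  then show ?thesis using r(1) by blast
qed

text \<open>
  A homothety with centre \<open>y\<close> followed by the one with centre \<open>x\<close> and reciprocal ratio is a
  translation along \<open>y - x\<close>.
\<close>

lemma translation_invariant_near_if_conical:
  assumes x: "conical_near P x r" and y: "conical_near P y r'" "r' > 0" "y \<in> ball x r" "y \<noteq> x"
  shows "translation_invariant_near P y (y - x)"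
proof -
  define v where "v = y - x"
  have v: "norm v > 0" "norm v < r"
    using y by (auto simp: v_def dist_norm norm_minus_commute)
  define \<delta> where "\<delta> = min (norm v / 4) (min (r' / 3) ((r - norm v) / 3))"
  have d: "\<delta> > 0" "4 * \<delta> \<le> norm v" "3 * \<delta> \<le> r'" "3 * \<delta> \<le> r - norm v"
    unfolding \<delta>_def using v y by (auto simp: min_def)
  show ?thesis
    unfolding v_def[symmetric]
  proof (rule translation_invariant_nearI[OF d(1)])
    fix z s assume z: "z \<in> ball y \<delta>" "z + s *\<^sub>R v \<in> ball y \<delta>" "z \<in> P"
    have "norm (s *\<^sub>R v) \<le> dist y z + dist y (z + s *\<^sub>R v)"
      using dist_triangle[of "z + s *\<^sub>R v" z y] by (simp add: dist_norm norm_minus_commute)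
    then have "\<bar>s\<bar> * norm v < 2 * \<delta>" using z by simp
    also have "2 * \<delta> \<le> (1/2) * norm v" using d by simp
    finally have s: "\<bar>s\<bar> < 1/2" using v(1) by (simp only: mult_less_cancel_right)
    define w where "w = y + (1 / (1 + s)) *\<^sub>R (z - y)"
    have lam: "1 / (1 + s) > 0" "1 / (1 + s) \<le> 2" "1 + s > 0" using s by (auto simp: field_simps)
    have "norm (w - y) = (1 / (1 + s)) * norm (z - y)"
      using lam unfolding w_def by simp
    also have "\<dots> \<le> 2 * norm (z - y)"
      using lam by (intro mult_right_mono) auto
    also have "\<dots> < 2 * \<delta>" using z(1) by (simp add: dist_norm norm_minus_commute)
    finally have wn: "norm (w - y) < 2 * \<delta>" .
    have wb: "w \<in> ball y r'" using wn d by (simp add: dist_norm norm_minus_commute)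
    have zb: "z \<in> ball y r'" using z(1) d by simp
    have wP: "w \<in> P"
      using y(1) lam(1) zb wb z(3) unfolding conical_near_def w_def by blast
    have wx: "w \<in> ball x r"
    proof -
      have "dist x w \<le> norm v + norm (w - y)"
        using dist_triangle[of x w y] by (simp add: v_def dist_norm norm_minus_commute)
      then show ?thesis using wn d by simp
    qed
    have e: "x + (1 + s) *\<^sub>R (w - x) = z + s *\<^sub>R v"
    proof -
      have "(1 + s) *\<^sub>R (w - x) = (1 + s) *\<^sub>R v + (1 + s) *\<^sub>R ((1 / (1 + s)) *\<^sub>R (z - y))"
        unfolding w_def v_def by (simp add: algebra_simps)
      also have "(1 + s) *\<^sub>R ((1 / (1 + s)) *\<^sub>R (z - y)) = z - y" using lam by simp
      finally show ?thesis unfolding v_def by (simp add: algebra_simps)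
    qed
    have "z + s *\<^sub>R v \<in> ball x r"
    proof -
      have "dist x (z + s *\<^sub>R v) \<le> norm v + dist y (z + s *\<^sub>R v)"
        using dist_triangle[of x "z + s *\<^sub>R v" y] by (simp add: v_def dist_norm norm_minus_commute)
      then show ?thesis using z d by simp
    qed
    then show "z + s *\<^sub>R v \<in> P"
      using x lam(3) wx wP unfolding conical_near_def e[symmetric] by blast
  qed
qed

text \<open>Faces, edges and vertices are determined by the germ of the solid at the point.\<close>

lemma germ_mono:
  assumes "P \<inter> ball x r = Q \<inter> ball x r" "r' \<le> r"
  shows "P \<inter> ball x r' = Q \<inter> ball x r'"
proof -
  have "ball x r' \<subseteq> ball x r" using assms(2) by auto
  then show ?thesis using assms(1) by blast
qed

lemma outward_normal_at_germ_imp: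
  assumes "P \<inter> ball x r = Q \<inter> ball x r" "r > 0" "outward_normal_at P x n"
  shows "outward_normal_at Q x n"
proof -
  obtain s where s: "norm n = 1" "s > 0" "P \<inter> ball x s = {y \<in> ball x s. n \<bullet> (y - x) \<le> 0}"
    using assms(3) unfolding outward_normal_at_def by blast
  have "Q \<inter> ball x (min r s) = P \<inter> ball x (min r s)"
    using germ_mono[OF assms(1), of "min r s"] by simp
  also have "\<dots> = (P \<inter> ball x s) \<inter> ball x (min r s)" by auto
  also have "\<dots> = {y \<in> ball x (min r s). n \<bullet> (y - x) \<le> 0}" unfolding s(3) by auto
  finally show ?thesis
    unfolding outward_normal_at_def using s assms(2) by (intro conjI exI[of _ "min r s"]) auto
qed

lemma outward_normal_at_germ:
  assumes "P \<inter> ball x r = Q \<inter> ball x r" "r > 0"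
  shows "outward_normal_at P x n \<longleftrightarrow> outward_normal_at Q x n"
  using outward_normal_at_germ_imp[OF assms] outward_normal_at_germ_imp[OF assms(1)[symmetric] assms(2)]
  by blast

lemma face_points_germ:
  assumes "P \<inter> ball x r = Q \<inter> ball x r" "r > 0"
  shows "x \<in> face_points P \<longleftrightarrow> x \<in> face_points Q"
  using outward_normal_at_germ[OF assms] unfolding face_points_def by blast

lemma interior_germ:
  assumes "P \<inter> ball x r = Q \<inter> ball x r" "r > 0"
  shows "x \<in> interior P \<longleftrightarrow> x \<in> interior Q"
proof -
  have *: "x \<in> interior (S \<inter> ball x r) \<longleftrightarrow> x \<in> interior S" for S using assms(2) by simp
  show ?thesis using *[of P] *[of Q] unfolding assms(1) by blast
qed

lemma frontier_germ:
  assumes "P \<inter> ball x r = Q \<inter> ball x r" "r > 0"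
  shows "x \<in> frontier P \<longleftrightarrow> x \<in> frontier Q"
proof -
  have "(-P) \<inter> ball x r = (-Q) \<inter> ball x r" using assms(1) by blast
  from interior_germ[OF this assms(2)] interior_germ[OF assms]
  show ?thesis unfolding frontier_def by (simp add: closure_interior)
qed

lemma translation_invariant_near_germ_imp:
  assumes "P \<inter> ball x r = Q \<inter> ball x r" "r > 0" "translation_invariant_near P x d"
  shows "translation_invariant_near Q x d"
proof -
  obtain s where s: "s > 0" "\<And>y l. y \<in> ball x s \<Longrightarrow> y + l *\<^sub>R d \<in> ball x s \<Longrightarrow>
      (y + l *\<^sub>R d \<in> P \<longleftrightarrow> y \<in> P)"
    using assms(3) by (rule translation_invariant_nearE) (rule that)
  show ?thesis
  proof (rule translation_invariant_nearI[of "min r s"])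
    fix y l assume y: "y \<in> ball x (min r s)" "y + l *\<^sub>R d \<in> ball x (min r s)" "y \<in> Q"
    have "y \<in> P" using y(1,3) assms(1) by (simp add: set_eq_iff) blast
    then have "y + l *\<^sub>R d \<in> P" using s(2)[of y l] y by simp
    then show "y + l *\<^sub>R d \<in> Q" using y(2) assms(1) by (simp add: set_eq_iff) blast
  qed (use assms(2) s(1) in auto)
qed

lemma edge_points_germ:
  assumes "P \<inter> ball x r = Q \<inter> ball x r" "r > 0"
  shows "x \<in> edge_points P \<longleftrightarrow> x \<in> edge_points Q"
proof -
  have "translation_invariant_near P x d \<longleftrightarrow> translation_invariant_near Q x d" for d
    using translation_invariant_near_germ_imp[OF assms]
      translation_invariant_near_germ_imp[OF assms(1)[symmetric] assms(2)] by blast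
  then show ?thesis
    unfolding edge_points_iff using frontier_germ[OF assms] face_points_germ[OF assms] by simp
qed

lemma vertices_germ:
  assumes "P \<inter> ball x r = Q \<inter> ball x r" "r > 0"
  shows "x \<in> vertices P \<longleftrightarrow> x \<in> vertices Q"
  unfolding vertices_def
  using frontier_germ[OF assms] face_points_germ[OF assms] edge_points_germ[OF assms] by simp

lemma conical_near_iff:
  assumes "conical_near P x r" "0 < \<mu>" "y \<in> ball x r" "x + \<mu> *\<^sub>R (y - x) \<in> ball x r"
  shows "x + \<mu> *\<^sub>R (y - x) \<in> P \<longleftrightarrow> y \<in> P"
proof
  assume a: "x + \<mu> *\<^sub>R (y - x) \<in> P"
  have e: "x + (1 / \<mu>) *\<^sub>R ((x + \<mu> *\<^sub>R (y - x)) - x) = y" using assms(2) by simp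
  have "0 < 1 / \<mu>" using assms(2) by simp
  moreover have "x + (1 / \<mu>) *\<^sub>R ((x + \<mu> *\<^sub>R (y - x)) - x) \<in> ball x r"
    unfolding e by (rule assms(3))
  ultimately have "x + (1 / \<mu>) *\<^sub>R ((x + \<mu> *\<^sub>R (y - x)) - x) \<in> P"
    using assms(1,4) a unfolding conical_near_def by blast
  then show "y \<in> P" unfolding e .
qed (use assms in \<open>auto simp: conical_near_def\<close>)

lemma conical_near_mono: "conical_near P x r \<Longrightarrow> r' \<le> r \<Longrightarrow> conical_near P x r'"
  unfolding conical_near_def by (simp add: dual_order.strict_trans2)

text \<open>Near the apex of a cone, a point and its image under a homothety have homothetic germs.\<close>

lemma conical_near_homothetic_germ:
  assumes H: "conical_near P H r" "0 < \<mu>" "x \<in> ball H r" "H + \<mu> *\<^sub>R (x - H) \<in> ball H r" "\<delta>0 > 0"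
  obtains \<delta> where "0 < \<delta>" "\<delta> \<le> \<delta>0"
    "\<And>z. norm z < \<delta> \<Longrightarrow> (H + \<mu> *\<^sub>R (x - H) + \<mu> *\<^sub>R z \<in> P \<longleftrightarrow> x + z \<in> P)"
proof -
  define x' where "x' = H + \<mu> *\<^sub>R (x - H)"
  define \<delta> where "\<delta> = min \<delta>0 (min (r - dist H x) ((r - dist H x') / \<mu>))"
  have d: "\<delta> > 0" "\<delta> \<le> \<delta>0" "\<delta> \<le> r - dist H x" "\<delta> \<le> (r - dist H x') / \<mu>"
    unfolding \<delta>_def using assms by (auto simp: x'_def)
  have "(x' + \<mu> *\<^sub>R z \<in> P \<longleftrightarrow> x + z \<in> P)" if z: "norm z < \<delta>" for z
  proof -
    have "dist H (x + z) \<le> dist H x + norm z"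
      using dist_triangle[of H "x + z" x] by (simp add: dist_norm)
    then have 1: "x + z \<in> ball H r" using z d by simp
    have "\<mu> * norm z < \<mu> * ((r - dist H x') / \<mu>)"
      using z d assms(2) by (intro mult_strict_left_mono) auto
    then have "\<mu> * norm z < r - dist H x'" using assms(2) by simp
    moreover have "dist H (x' + \<mu> *\<^sub>R z) \<le> dist H x' + \<mu> * norm z"
      using dist_triangle[of H "x' + \<mu> *\<^sub>R z" x'] assms(2) by (simp add: dist_norm)
    ultimately have 2: "x' + \<mu> *\<^sub>R z \<in> ball H r" by simp
    have e: "x' + \<mu> *\<^sub>R z = H + \<mu> *\<^sub>R (x + z - H)" unfolding x'_def by (simp add: algebra_simps)
    show ?thesis using conical_near_iff[OF H(1,2) 1] 2 unfolding e by simp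
  qed
  then show ?thesis using that[of \<delta>] d unfolding x'_def by blast
qed

lemma outward_normal_at_homothety:
  assumes "conical_near P H r" "0 < \<mu>" "x \<in> ball H r" "H + \<mu> *\<^sub>R (x - H) \<in> ball H r"
    "outward_normal_at P x n"
  shows "outward_normal_at P (H + \<mu> *\<^sub>R (x - H)) n"
proof -
  define x' where "x' = H + \<mu> *\<^sub>R (x - H)"
  obtain s where s: "norm n = 1" "s > 0" "P \<inter> ball x s = {y \<in> ball x s. n \<bullet> (y - x) \<le> 0}"
    using assms(5) unfolding outward_normal_at_def by blast
  obtain \<delta> where d: "0 < \<delta>" "\<delta> \<le> s" "\<And>z. norm z < \<delta> \<Longrightarrow> (x' + \<mu> *\<^sub>R z \<in> P \<longleftrightarrow> x + z \<in> P)"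
    using conical_near_homothetic_germ[OF assms(1-4) s(2)] unfolding x'_def by blast
  have "y \<in> P \<longleftrightarrow> n \<bullet> (y - x') \<le> 0" if y: "y \<in> ball x' (\<mu> * \<delta>)" for y
  proof -
    define z where "z = (1 / \<mu>) *\<^sub>R (y - x')"
    have yz: "y = x' + \<mu> *\<^sub>R z" using assms(2) by (simp add: z_def)
    have zn: "norm z < \<delta>"
      using y assms(2) by (simp add: z_def dist_norm norm_minus_commute pos_divide_less_eq mult.commute)
    have "x + z \<in> P \<longleftrightarrow> x + z \<in> P \<inter> ball x s" using zn d by (simp add: dist_norm)
    also have "\<dots> \<longleftrightarrow> n \<bullet> z \<le> 0" unfolding s(3) using zn d by (simp add: dist_norm)
    also have "\<dots> \<longleftrightarrow> n \<bullet> (y - x') \<le> 0"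
      using assms(2) by (simp add: yz mult_le_0_iff)
    finally show ?thesis using d(3)[OF zn] yz by simp
  qed
  then have "P \<inter> ball x' (\<mu> * \<delta>) = {y \<in> ball x' (\<mu> * \<delta>). n \<bullet> (y - x') \<le> 0}" by blast
  then show ?thesis
    unfolding outward_normal_at_def x'_def[symmetric] using s(1) d(1) assms(2)
    by (intro conjI exI[of _ "\<mu> * \<delta>"]) simp_all
qed

lemma interior_homothety:
  assumes "conical_near P H r" "0 < \<mu>" "x \<in> ball H r" "H + \<mu> *\<^sub>R (x - H) \<in> ball H r"
    "x \<in> interior P"
  shows "H + \<mu> *\<^sub>R (x - H) \<in> interior P"
proof -
  define x' where "x' = H + \<mu> *\<^sub>R (x - H)"
  obtain s where s: "s > 0" "ball x s \<subseteq> P" using assms(5) mem_interior by blast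
  obtain \<delta> where d: "0 < \<delta>" "\<delta> \<le> s" "\<And>z. norm z < \<delta> \<Longrightarrow> (x' + \<mu> *\<^sub>R z \<in> P \<longleftrightarrow> x + z \<in> P)"
    using conical_near_homothetic_germ[OF assms(1-4) s(1)] unfolding x'_def by blast
  have "y \<in> P" if y: "y \<in> ball x' (\<mu> * \<delta>)" for y
  proof -
    define z where "z = (1 / \<mu>) *\<^sub>R (y - x')"
    have yz: "y = x' + \<mu> *\<^sub>R z" using assms(2) by (simp add: z_def)
    have zn: "norm z < \<delta>"
      using y assms(2) by (simp add: z_def dist_norm norm_minus_commute pos_divide_less_eq mult.commute)
    have "x + z \<in> P" using s(2) zn d by (auto simp: dist_norm)
    then show ?thesis using d(3)[OF zn] yz by simp
  qed
  then show ?thesis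
    unfolding mem_interior x'_def[symmetric] using d(1) assms(2) by (intro exI[of _ "\<mu> * \<delta>"]) auto
qed

lemma homothety_inverse:
  fixes x H :: "real^3"
  assumes "0 < \<mu>" shows "H + (1 / \<mu>) *\<^sub>R ((H + \<mu> *\<^sub>R (x - H)) - H) = x"
  using assms by simp

lemma frontier_homothety:
  assumes "conical_near P H r" "0 < \<mu>" "x \<in> ball H r" "H + \<mu> *\<^sub>R (x - H) \<in> ball H r"
    "x \<in> frontier P" "closed P"
  shows "H + \<mu> *\<^sub>R (x - H) \<in> frontier P"
proof -
  have xP: "x \<in> P" "x \<notin> interior P" using assms(5,6) by (auto simp: frontier_def)
  have "H + \<mu> *\<^sub>R (x - H) \<in> P" using conical_near_iff[OF assms(1-4)] xP by simp
  moreover have "H + \<mu> *\<^sub>R (x - H) \<notin> interior P"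
  proof
    assume a: "H + \<mu> *\<^sub>R (x - H) \<in> interior P"
    have "H + (1 / \<mu>) *\<^sub>R ((H + \<mu> *\<^sub>R (x - H)) - H) \<in> interior P"
      by (rule interior_homothety[OF assms(1) _ assms(4)])
        (use a assms(2,3) homothety_inverse[OF assms(2), of H x] in auto)
    then show False using xP(2) unfolding homothety_inverse[OF assms(2)] by blast
  qed
  ultimately show ?thesis using assms(6) by (simp add: frontier_def)
qed

lemma face_points_homothety:
  assumes "conical_near P H r" "0 < \<mu>" "x \<in> ball H r" "H + \<mu> *\<^sub>R (x - H) \<in> ball H r"
  shows "H + \<mu> *\<^sub>R (x - H) \<in> face_points P \<longleftrightarrow> x \<in> face_points P"
proof
  show "H + \<mu> *\<^sub>R (x - H) \<in> face_points P" if "x \<in> face_points P"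
    using that outward_normal_at_homothety[OF assms] unfolding face_points_def by blast
next
  assume a: "H + \<mu> *\<^sub>R (x - H) \<in> face_points P"
  then obtain n where "outward_normal_at P (H + \<mu> *\<^sub>R (x - H)) n" unfolding face_points_def by blast
  from outward_normal_at_homothety[OF assms(1) _ assms(4) _ this, of "1 / \<mu>"]
  have "outward_normal_at P x n" using homothety_inverse[OF assms(2)] assms(2,3) by simp
  then show "x \<in> face_points P" unfolding face_points_def by blast
qed

section \<open>Solids bounded by finitely many planes\<close>

definition is_plane :: "(real^3) set \<Rightarrow> bool" where
  "is_plane h \<longleftrightarrow> (\<exists>a b. a \<noteq> 0 \<and> h = {x. a \<bullet> x = b})"

lemma add_in_ball_iff: "x + v \<in> ball x r \<longleftrightarrow> norm v < r" for x v :: "real^3"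
  unfolding mem_ball dist_commute[of x] dist_norm by simp

lemma is_plane_closed: "is_plane h \<Longrightarrow> closed h"
  unfolding is_plane_def using closed_hyperplane by auto

lemma is_plane_affine: "is_plane h \<Longrightarrow> affine h"
  unfolding is_plane_def using affine_hyperplane by auto

lemma is_plane_aff_dim: "is_plane h \<Longrightarrow> aff_dim h = 2"
  unfolding is_plane_def by (auto simp: aff_dim_hyperplane)

lemma is_plane_eq_if_subset: "is_plane h \<Longrightarrow> is_plane h' \<Longrightarrow> h \<subseteq> h' \<Longrightarrow> h = h'"
  using affine_dim_equal[of h h'] is_plane_affine[of h] is_plane_affine[of h']
    is_plane_aff_dim[of h] is_plane_aff_dim[of h'] by (cases "h = {}") auto

text \<open>
  The sets are avoided one after the other: a small step towards a point off the next set leaves that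
  set and stays clear of the previous ones, which are closed.
\<close>

lemma affine_generic_point:
  fixes S :: "(real^3) set"
  assumes "finite \<A>" "\<And>T. T \<in> \<A> \<Longrightarrow> closed T \<and> affine T \<and> \<not> S \<subseteq> T" "affine S"
    "x \<in> S" "open U" "x \<in> U"
  shows "\<exists>y. y \<in> S \<and> y \<in> U \<and> (\<forall>T\<in>\<A>. y \<notin> T)"
  using assms(1,2)
proof (induction \<A> rule: finite_induct)
  case empty
  then show ?case using assms by blast
next
  case (insert T \<A>)
  then obtain y where y: "y \<in> S" "y \<in> U" "\<forall>T\<in>\<A>. y \<notin> T" by blast
  show ?case
  proof (cases "y \<in> T")
    case False
    then show ?thesis using y by blast
  next
    case True
    have "affine T" "\<not> S \<subseteq> T" using insert.prems by auto
    then obtain z where z: "z \<in> S" "z \<notin> T" by blast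
    have "closed (\<Union>\<A>)" using insert by (intro closed_Union) auto
    then have "open (U - \<Union>\<A>)" using assms(5) by (rule open_Diff[rotated])
    then obtain e where e: "e > 0" "ball y e \<subseteq> U - \<Union>\<A>"
      using y by (meson DiffI UnionE openE)
    define k where "k = e / (2 * (1 + norm (z - y)))"
    have k: "k > 0" unfolding k_def using e by (simp add: add_pos_nonneg)
    define w where "w = y + k *\<^sub>R (z - y)"
    have "norm (k *\<^sub>R (z - y)) < e"
    proof -
      have "k * norm (z - y) \<le> k * (1 + norm (z - y))" using k by simp
      also have "\<dots> = e / 2" unfolding k_def by (simp add: field_simps add_nonneg_eq_0_iff)
      finally show ?thesis using e k by simp
    qed
    then have "w \<in> ball y e" unfolding w_def by (simp add: dist_norm)
    then have "w \<in> U" "\<forall>T\<in>\<A>. w \<notin> T" using e by blast+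
    moreover have "w \<in> S"
      using mem_affine[OF assms(3) y(1) z(1), of "1 - k" k] unfolding w_def by (simp add: algebra_simps)
    moreover have "w \<notin> T"
    proof
      assume "w \<in> T"
      from mem_affine[OF \<open>affine T\<close> True this, of "1 - 1 / k" "1 / k"]
      have "(1 - 1 / k) *\<^sub>R y + (1 / k) *\<^sub>R w \<in> T" by simp
      moreover have "(1 - 1 / k) *\<^sub>R y + (1 / k) *\<^sub>R w = z"
        unfolding w_def using k by (simp add: algebra_simps)
      ultimately show False using z by simp
    qed
    ultimately show ?thesis by blast
  qed
qed

text \<open>
  For connected sets with interior points this is equivalent to being a \<open>solid_polyhedron\<close>, as shown
  below, but it says nothing about faces: it can be checked for a truncated solid before its faces are
  known.
\<close>

definition plane_bounded :: "(real^3) set \<Rightarrow> bool" where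
  "plane_bounded P \<longleftrightarrow> compact P \<and> closure (interior P) = P \<and>
     (\<exists>\<H>. finite \<H> \<and> (\<forall>h\<in>\<H>. is_plane h) \<and> frontier P \<subseteq> \<Union>\<H>)"

lemma plane_boundedD:
  assumes "plane_bounded P"
  shows "compact P" "closed P" "closure (interior P) = P"
  using assms compact_imp_closed unfolding plane_bounded_def by auto

lemma closure_interior_off_planes:
  assumes "finite \<H>" "\<And>h. h \<in> \<H> \<Longrightarrow> is_plane h" "closure (interior P) = P"
  shows "closure (interior P - \<Union>\<H>) = P"
proof
  show "closure (interior P - \<Union>\<H>) \<subseteq> P"
    using assms(3) closure_mono[of "interior P - \<Union>\<H>" "interior P"] by auto
  have "interior P \<subseteq> closure (interior P - \<Union>\<H>)"
  proof
    fix x assume x: "x \<in> interior P"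
    show "x \<in> closure (interior P - \<Union>\<H>)"
      unfolding closure_iff_nhds_not_empty
    proof (intro allI impI)
      fix A V assume V: "V \<subseteq> A" "open V" "x \<in> V"
      have nU: "\<not> UNIV \<subseteq> h" if "h \<in> \<H>" for h
        using is_plane_aff_dim[OF assms(2)[OF that]] by (auto simp: top.extremum_unique)
      have "\<exists>y. y \<in> UNIV \<and> y \<in> V \<inter> interior P \<and> (\<forall>T\<in>\<H>. y \<notin> T)"
        using assms(1,2) nU V x
        by (intro affine_generic_point[where x = x]) (auto intro: is_plane_closed is_plane_affine)
      then show "(interior P - \<Union>\<H>) \<inter> A \<noteq> {}" using V by blast
    qed
  qed
  then show "P \<subseteq> closure (interior P - \<Union>\<H>)"
    using assms(3) closure_minimal[of "interior P" "closure (interior P - \<Union>\<H>)"] by simp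
qed

text \<open>
  A small ball around \<open>x\<close> meets only those planes that pass through \<open>x\<close>. Off these planes, a point
  and its homothetic image are joined by a segment that does not meet the boundary; the remaining
  points follow by density.
\<close>

lemma conical_near_if_planes:
  assumes "finite \<H>" "\<And>h. h \<in> \<H> \<Longrightarrow> is_plane h" "frontier P \<subseteq> \<Union>\<H>" "closure (interior P) = P"
  shows "\<exists>r>0. conical_near P x r"
proof -
  define U where "U = - \<Union>{h \<in> \<H>. x \<notin> h}"
  have "open U" unfolding U_def
    by (intro open_Compl closed_Union) (use assms(1,2) is_plane_closed in auto)
  moreover have "x \<in> U" unfolding U_def by blast
  ultimately obtain r where r: "r > 0" "ball x r \<subseteq> U" by (meson openE)
  define G where "G = interior P - \<Union>\<H>"
  have clG: "closure G = P" unfolding G_def by (rule closure_interior_off_planes[OF assms(1,2,4)])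
  have gen: "x + \<mu> *\<^sub>R (y - x) \<in> P"
    if "0 < \<mu>" "y \<in> ball x r" "x + \<mu> *\<^sub>R (y - x) \<in> ball x r" "y \<in> G" for y \<mu>
  proof (rule ccontr)
    assume nP: "x + \<mu> *\<^sub>R (y - x) \<notin> P"
    define S where "S = closed_segment y (x + \<mu> *\<^sub>R (y - x))"
    have "S \<inter> frontier P \<noteq> {}"
    proof (rule connected_Int_frontier)
      show "connected S" unfolding S_def by simp
      show "S \<inter> P \<noteq> {}" using that(4) interior_subset unfolding S_def G_def by auto
      show "S - P \<noteq> {}" using nP unfolding S_def by auto
    qed
    then obtain z h where z: "z \<in> S" "h \<in> \<H>" "z \<in> h" using assms(3) by blast
    obtain u where u: "0 \<le> u" "u \<le> 1" "z = (1 - u) *\<^sub>R y + u *\<^sub>R (x + \<mu> *\<^sub>R (y - x))"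
      using z(1) unfolding S_def in_segment by blast
    define \<nu> where "\<nu> = (1 - u) + u * \<mu>"
    have zx: "z = x + \<nu> *\<^sub>R (y - x)" unfolding u(3) \<nu>_def by (simp add: algebra_simps)
    have \<nu>: "\<nu> > 0"
    proof (cases "u = 1")
      case False
      then have "1 - u > 0" using u by simp
      then show ?thesis unfolding \<nu>_def using u that(1) by (simp add: add_pos_nonneg)
    qed (use that(1) in \<open>simp add: \<nu>_def\<close>)
    have "S \<subseteq> ball x r" unfolding S_def using that by (intro closed_segment_subset) auto
    then have "x \<in> h" using r(2) z unfolding U_def by blast
    obtain a b where ab: "a \<noteq> 0" "h = {x. a \<bullet> x = b}" using assms(2)[OF z(2)] unfolding is_plane_def by blast
    have "\<nu> * (a \<bullet> (y - x)) = 0"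
      using z(3) \<open>x \<in> h\<close> unfolding zx ab by (simp add: inner_add_right)
    then have "a \<bullet> y = b" using \<nu> \<open>x \<in> h\<close> unfolding ab by (simp add: inner_diff_right)
    then show False using that(4) z(2) unfolding G_def ab by blast
  qed
  have "conical_near P x r"
    unfolding conical_near_def
  proof (intro allI impI)
    fix y \<mu> assume a: "0 < \<mu>" "y \<in> ball x r" "x + \<mu> *\<^sub>R (y - x) \<in> ball x r" "y \<in> P"
    define f where "f = (\<lambda>y. x + \<mu> *\<^sub>R (y - x))"
    define A where "A = ball x r \<inter> f -` ball x r"
    have cf: "continuous_on UNIV f" unfolding f_def by (intro continuous_intros)
    have "open A" unfolding A_def by (intro open_Int open_vimage cf) auto
    moreover have "y \<in> A" using a unfolding A_def f_def by auto
    ultimately have "y \<in> closure (A \<inter> G)"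
      using a(4) clG by (metis IntI open_Int_closure_subset subsetD)
    then have "f y \<in> f ` closure (A \<inter> G)" by blast
    moreover have "f ` closure (A \<inter> G) \<subseteq> P"
    proof (rule image_closure_subset)
      show "continuous_on (closure (A \<inter> G)) f" by (rule continuous_on_subset[OF cf]) simp
      show "closed P" using closed_closure[of "interior P"] unfolding assms(4) .
      show "f ` (A \<inter> G) \<subseteq> P" using gen a(1) unfolding A_def f_def by auto
    qed
    ultimately show "x + \<mu> *\<^sub>R (y - x) \<in> P" unfolding f_def by blast
  qed
  then show ?thesis using r(1) by blast
qed

lemma plane_bounded_conical:
  assumes "plane_bounded P"
  obtains r where "r > 0" "conical_near P x r"
  using assms conical_near_if_planes unfolding plane_bounded_def by metis

subsection \<open>Face points\<close>

lemma outward_normal_atE: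
  assumes "outward_normal_at P x n"
  obtains r where "norm n = 1" "r > 0" "\<And>y. y \<in> ball x r \<Longrightarrow> y \<in> P \<longleftrightarrow> n \<bullet> (y - x) \<le> 0"
proof -
  obtain r where "norm n = 1" "r > 0" "P \<inter> ball x r = {y \<in> ball x r. n \<bullet> (y - x) \<le> 0}"
    using assms unfolding outward_normal_at_def by blast
  then show ?thesis by (intro that[of r]) blast+
qed

lemma outward_normal_atI:
  assumes "norm n = 1" "r > 0" "\<And>y. y \<in> ball x r \<Longrightarrow> y \<in> P \<longleftrightarrow> n \<bullet> (y - x) \<le> 0"
  shows "outward_normal_at P x n"
proof -
  have "P \<inter> ball x r = {y \<in> ball x r. n \<bullet> (y - x) \<le> 0}" using assms(3) by blast
  then show ?thesis unfolding outward_normal_at_def using assms(1,2) by blast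
qed

text \<open>
  Test the inclusion of the half balls at the component of \<open>n\<close> orthogonal to \<open>m\<close>, and at \<open>- m\<close>.
\<close>

lemma half_ball_normal_unique:
  fixes m n x :: "real^3"
  assumes "norm m = 1" "norm n = 1" "r > 0"
    and "\<And>y. y \<in> ball x r \<Longrightarrow> m \<bullet> (y - x) \<le> 0 \<Longrightarrow> n \<bullet> (y - x) \<le> 0"
  shows "m = n"
proof -
  define y where "y = x + (r/4) *\<^sub>R (n - (m \<bullet> n) *\<^sub>R m)"
  have nm: "norm (n - (m \<bullet> n) *\<^sub>R m) \<le> 2"
  proof -
    have "\<bar>m \<bullet> n\<bar> \<le> 1" using Cauchy_Schwarz_ineq2[of m n] assms by simp
    then have "norm ((m \<bullet> n) *\<^sub>R m) \<le> 1" using assms by simp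
    then show ?thesis using norm_triangle_ineq4[of n "(m \<bullet> n) *\<^sub>R m"] assms by linarith
  qed
  have yb: "y \<in> ball x r"
  proof -
    have "dist x y = (r/4) * norm (n - (m \<bullet> n) *\<^sub>R m)" unfolding y_def using assms(3) by (simp add: dist_norm)
    also have "\<dots> \<le> (r/4) * 2" using nm assms(3) by (intro mult_left_mono) auto
    finally show ?thesis using assms(3) by simp
  qed
  have "m \<bullet> m = 1" "n \<bullet> n = 1" using assms by (auto simp: norm_eq_1)
  have "m \<bullet> (y - x) = 0" unfolding y_def using \<open>m \<bullet> m = 1\<close> by (simp add: inner_diff_right)
  then have "n \<bullet> (y - x) \<le> 0" using assms(4) yb by simp
  then have "n \<bullet> (n - (m \<bullet> n) *\<^sub>R m) \<le> 0" unfolding y_def using assms(3) by (simp add: mult_le_0_iff)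
  then have "(m \<bullet> n)^2 \<ge> 1"
    using \<open>n \<bullet> n = 1\<close> by (simp add: inner_diff_right power2_eq_square inner_commute)
  moreover have "m \<bullet> n \<ge> 0"
  proof (rule ccontr)
    assume neg: "\<not> m \<bullet> n \<ge> 0"
    have "m \<bullet> ((x - (r/2) *\<^sub>R m) - x) \<le> 0" using assms(3) \<open>m \<bullet> m = 1\<close> by simp
    moreover have "x - (r/2) *\<^sub>R m \<in> ball x r" using assms by (simp add: dist_norm)
    ultimately have "n \<bullet> ((x - (r/2) *\<^sub>R m) - x) \<le> 0" using assms(4) by blast
    then show False using neg assms(3) by (simp add: inner_commute zero_le_mult_iff)
  qed
  moreover have "m \<bullet> n \<le> 1" using Cauchy_Schwarz_ineq2[of m n] assms by simp
  ultimately have "m \<bullet> n = 1"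
    by (smt (verit) power2_eq_square mult_left_le_one_le mult_le_one one_le_power power_le_one_iff)
  then have "(m - n) \<bullet> (m - n) = 0"
    using \<open>m \<bullet> m = 1\<close> \<open>n \<bullet> n = 1\<close> by (simp add: inner_diff_left inner_diff_right inner_commute)
  then show ?thesis by simp
qed

lemma outward_normal_at_unique:
  assumes "outward_normal_at P x m" "outward_normal_at P x n"
  shows "m = n"
proof -
  obtain r where r: "norm m = 1" "r > 0" "\<And>y. y \<in> ball x r \<Longrightarrow> y \<in> P \<longleftrightarrow> m \<bullet> (y - x) \<le> 0"
    using assms(1) by (rule outward_normal_atE) blast
  obtain s where s: "norm n = 1" "s > 0" "\<And>y. y \<in> ball x s \<Longrightarrow> y \<in> P \<longleftrightarrow> n \<bullet> (y - x) \<le> 0"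
    using assms(2) by (rule outward_normal_atE) blast
  show ?thesis
    by (rule half_ball_normal_unique[of m n "min r s" x]) (use r s in auto)
qed

lemma outward_normal_at_nearby:
  assumes "outward_normal_at P x n"
  obtains r where "r > 0"
    "\<And>y. y \<in> ball x r \<Longrightarrow> n \<bullet> (y - x) = 0 \<Longrightarrow> outward_normal_at P y n"
    "\<And>y. y \<in> ball x r \<Longrightarrow> y \<in> frontier P \<longleftrightarrow> n \<bullet> (y - x) = 0"
proof -
  obtain r where r: "norm n = 1" "r > 0" "\<And>y. y \<in> ball x r \<Longrightarrow> y \<in> P \<longleftrightarrow> n \<bullet> (y - x) \<le> 0"
    using assms(1) by (rule outward_normal_atE) blast
  have 1: "outward_normal_at P y n" if y: "y \<in> ball x r" "n \<bullet> (y - x) = 0" for y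
  proof (rule outward_normal_atI[OF r(1), of "r - dist x y"])
    fix z assume "z \<in> ball y (r - dist x y)"
    then have "z \<in> ball x r" using dist_triangle[of x z y] by simp
    from r(3)[OF this] show "z \<in> P \<longleftrightarrow> n \<bullet> (z - y) \<le> 0"
      using y by (simp add: inner_diff_right)
  qed (use y in auto)
  have 2: "y \<in> frontier P \<longleftrightarrow> n \<bullet> (y - x) = 0" if y: "y \<in> ball x r" for y
  proof -
    have n0: "n \<noteq> 0" using r(1) by auto
    have "P \<inter> ball x r = {y. n \<bullet> y \<le> n \<bullet> x} \<inter> ball x r"
      using r(3) by (auto simp: inner_diff_right)
    then have "P \<inter> ball y (r - dist x y) = {y. n \<bullet> y \<le> n \<bullet> x} \<inter> ball y (r - dist x y)"
      using ball_subset_ball_iff[of y "r - dist x y" x r] by (auto simp: dist_commute)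
    from frontier_germ[OF this] y have "y \<in> frontier P \<longleftrightarrow> y \<in> frontier {y. n \<bullet> y \<le> n \<bullet> x}" by simp
    also have "\<dots> \<longleftrightarrow> n \<bullet> (y - x) = 0"
      using n0 by (simp add: frontier_halfspace_le inner_diff_right)
    finally show ?thesis .
  qed
  show ?thesis using that[OF r(2)] 1 2 by blast
qed

lemma outward_normal_at_frontier: "outward_normal_at P x n \<Longrightarrow> x \<in> frontier P"
  by (erule outward_normal_at_nearby) auto

lemma face_points_subset_frontier: "face_points P \<subseteq> frontier P"
  unfolding face_points_def using outward_normal_at_frontier by blast

lemma frontier_near_face_point:
  assumes "x \<in> face_points P"
  shows "\<exists>r>0. \<forall>y\<in>ball x r. y \<in> frontier P \<longrightarrow> y \<in> face_points P"
proof -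
  obtain n where "outward_normal_at P x n" using assms unfolding face_points_def by blast
  then show ?thesis
  proof (rule outward_normal_at_nearby)
    fix r assume "r > 0" "\<And>y. y \<in> ball x r \<Longrightarrow> n \<bullet> (y - x) = 0 \<Longrightarrow> outward_normal_at P y n"
      "\<And>y. y \<in> ball x r \<Longrightarrow> y \<in> frontier P \<longleftrightarrow> n \<bullet> (y - x) = 0"
    then show ?thesis unfolding face_points_def by blast
  qed
qed

text \<open>
  If both open half balls belonged to \<open>P\<close>, then \<open>x\<close> would be an interior point; if neither did, \<open>P\<close> would
  be flat near \<open>x\<close>, which regularity excludes.
\<close>

lemma face_point_if_half_balls:
  assumes P: "closed P" "closure (interior P) = P" "x \<in> frontier P" and n: "norm n = 1" and r: "r > 0"
    and up: "{y \<in> ball x r. n \<bullet> (y - x) > 0} \<subseteq> P \<or> {y \<in> ball x r. n \<bullet> (y - x) > 0} \<inter> P = {}"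
    and dn: "{y \<in> ball x r. n \<bullet> (y - x) < 0} \<subseteq> P \<or> {y \<in> ball x r. n \<bullet> (y - x) < 0} \<inter> P = {}"
  shows "outward_normal_at P x n \<or> outward_normal_at P x (-n)"
proof -
  have nn: "n \<bullet> n = 1" using n by (simp add: norm_eq_1)
  have cl: "y \<in> P"
    if m: "m = n \<or> m = -n" "{y \<in> ball x r. m \<bullet> (y - x) > 0} \<subseteq> P" "y \<in> ball x r" "m \<bullet> (y - x) \<ge> 0" for y m
  proof -
    have mm: "m \<bullet> m = 1" "norm m = 1" using m(1) nn n by auto
    have "y \<in> closure P" unfolding closure_approachable
    proof (intro allI impI)
      fix e :: real assume e: "e > 0"
      define k where "k = min e (r - dist x y) / 2"
      have k: "k > 0" "k < e" "k < r - dist x y" unfolding k_def using e m(3) by auto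
      have "dist x (y + k *\<^sub>R m) \<le> dist x y + k"
        using dist_triangle[of x "y + k *\<^sub>R m" y] mm k by (simp add: dist_norm)
      then have "y + k *\<^sub>R m \<in> P" using m(2,4) k mm by (auto simp: inner_diff_right inner_add_right)
      moreover have "dist (y + k *\<^sub>R m) y < e" using k mm by (simp add: dist_norm)
      ultimately show "\<exists>z\<in>P. dist z y < e" by blast
    qed
    then show ?thesis using P(1) by simp
  qed
  have xP: "x \<in> P" "x \<notin> interior P" using P by (auto simp: frontier_def)
  have notboth: False
    if both: "{y \<in> ball x r. n \<bullet> (y - x) > 0} \<subseteq> P" "{y \<in> ball x r. n \<bullet> (y - x) < 0} \<subseteq> P"
  proof -
    have "y \<in> P" if "y \<in> ball x r" for y
      using cl[of n y] cl[of "-n" y] both that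
      by (cases "n \<bullet> (y - x) \<ge> 0") simp_all
    then have "ball x r \<subseteq> P" by blast
    then show False using xP(2) r mem_interior by blast
  qed
  have notnone: False
    if e: "{y \<in> ball x r. n \<bullet> (y - x) > 0} \<inter> P = {}" "{y \<in> ball x r. n \<bullet> (y - x) < 0} \<inter> P = {}"
  proof -
    have "x \<in> closure (interior P)" using P(2) xP by simp
    then obtain z where z: "z \<in> interior P" "dist z x < r" using r closure_approachable by blast
    have "open (interior P \<inter> ball x r)" by auto
    moreover have "z \<in> interior P \<inter> ball x r" using z by (simp add: dist_commute)
    ultimately obtain s where s: "s > 0" "ball z s \<subseteq> interior P \<inter> ball x r" by (meson openE)
    have "z \<in> P" "z \<in> ball x r" using s centre_in_ball[of z s] interior_subset by blast+
    then have z0: "n \<bullet> (z - x) = 0" using e by (cases "n \<bullet> (z - x) > 0"; cases "n \<bullet> (z - x) < 0") auto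
    have "z + (s/2) *\<^sub>R n \<in> ball z s" using s(1) n by (simp add: dist_norm)
    then have "z + (s/2) *\<^sub>R n \<in> P" "z + (s/2) *\<^sub>R n \<in> ball x r" using s(2) interior_subset by blast+
    moreover have "n \<bullet> (z + (s/2) *\<^sub>R n - x) > 0"
      using z0 nn s(1) by (simp add: inner_diff_right inner_add_right)
    ultimately show False using e(1) by blast
  qed
  consider "{y \<in> ball x r. n \<bullet> (y - x) > 0} \<inter> P = {}" "{y \<in> ball x r. n \<bullet> (y - x) < 0} \<subseteq> P"
    | "{y \<in> ball x r. n \<bullet> (y - x) > 0} \<subseteq> P" "{y \<in> ball x r. n \<bullet> (y - x) < 0} \<inter> P = {}"
    using up dn notboth notnone by blast
  then show ?thesis
  proof cases
    case 1
    have "outward_normal_at P x n"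
    proof (rule outward_normal_atI[OF n r])
      show "y \<in> P \<longleftrightarrow> n \<bullet> (y - x) \<le> 0" if "y \<in> ball x r" for y
      proof (cases "n \<bullet> (y - x) \<le> 0")
        case True
        then show ?thesis using cl[of "-n" y] 1(2) that by simp
      next
        case False
        then have "y \<in> {y \<in> ball x r. n \<bullet> (y - x) > 0}" using that by simp
        then show ?thesis using 1(1) False by blast
      qed
    qed
    then show ?thesis ..
  next
    case 2
    have "outward_normal_at P x (-n)"
    proof (rule outward_normal_atI[OF _ r])
      show "y \<in> P \<longleftrightarrow> (-n) \<bullet> (y - x) \<le> 0" if "y \<in> ball x r" for y
      proof (cases "n \<bullet> (y - x) \<ge> 0")
        case True
        then show ?thesis using cl[of n y] 2(1) that by simp
      next
        case False
        then have "y \<in> {y \<in> ball x r. n \<bullet> (y - x) < 0}" using that by simp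
        then show ?thesis using 2(2) False by auto
      qed
    qed (use n in simp)
    then show ?thesis ..
  qed
qed

lemma face_point_if_frontier_in_plane:
  assumes P: "closed P" "closure (interior P) = P" "x \<in> frontier P" and n: "norm n = 1" and r: "r > 0"
    and pl: "\<And>y. y \<in> frontier P \<Longrightarrow> y \<in> ball x r \<Longrightarrow> n \<bullet> (y - x) = 0"
  shows "outward_normal_at P x n \<or> outward_normal_at P x (-n)"
proof (rule face_point_if_half_balls[OF P n r])
  have dich: "S \<subseteq> P \<or> S \<inter> P = {}" if "convex S" "S \<inter> frontier P = {}" for S
    using connected_Int_frontier[OF convex_connected[OF that(1)], of P] that(2) by blast
  have e: "{y \<in> ball x r. n \<bullet> (y - x) > 0} = ball x r \<inter> {y. n \<bullet> y > n \<bullet> x}"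
    "{y \<in> ball x r. n \<bullet> (y - x) < 0} = ball x r \<inter> {y. n \<bullet> y < n \<bullet> x}"
    by (auto simp: inner_diff_right)
  show "{y \<in> ball x r. n \<bullet> (y - x) > 0} \<subseteq> P \<or> {y \<in> ball x r. n \<bullet> (y - x) > 0} \<inter> P = {}"
  proof (rule dich)
    show "convex {y \<in> ball x r. n \<bullet> (y - x) > 0}"
      unfolding e by (intro convex_Int convex_ball convex_halfspace_gt)
  qed (use pl in force)
  show "{y \<in> ball x r. n \<bullet> (y - x) < 0} \<subseteq> P \<or> {y \<in> ball x r. n \<bullet> (y - x) < 0} \<inter> P = {}"
  proof (rule dich)
    show "convex {y \<in> ball x r. n \<bullet> (y - x) < 0}"
      unfolding e by (intro convex_Int convex_ball convex_halfspace_lt)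
  qed (use pl in force)
qed

lemma orthonormal_expansion:
  fixes e1 e2 n v :: "real^3"
  assumes "norm e1 = 1" "norm e2 = 1" "norm n = 1" "e1 \<bullet> e2 = 0" "e1 \<bullet> n = 0" "e2 \<bullet> n = 0"
  shows "v = (v \<bullet> e1) *\<^sub>R e1 + (v \<bullet> e2) *\<^sub>R e2 + (v \<bullet> n) *\<^sub>R n"
proof -
  have s: "e1 \<bullet> e1 = 1" "e2 \<bullet> e2 = 1" "n \<bullet> n = 1" using assms by (auto simp: norm_eq_1)
  have c: "e2 \<bullet> e1 = 0" "n \<bullet> e1 = 0" "n \<bullet> e2 = 0" using assms by (auto simp: inner_commute)
  define B where "B = {e1, e2, n}"
  have d: "e1 \<noteq> e2" "e1 \<noteq> n" "e2 \<noteq> n" using s assms by auto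
  have "independent B"
    by (rule pairwise_orthogonal_independent)
      (use assms c s in \<open>auto simp: B_def pairwise_def orthogonal_def\<close>)
  moreover have "card B = 3" using d unfolding B_def by simp
  ultimately have sp: "span B = UNIV"
    using card_ge_dim_independent[of B UNIV] by (auto simp: dim_UNIV)
  define u where "u = v - ((v \<bullet> e1) *\<^sub>R e1 + (v \<bullet> e2) *\<^sub>R e2 + (v \<bullet> n) *\<^sub>R n)"
  have "orthogonal u b" if "b \<in> B" for b
    using that assms c s unfolding B_def u_def orthogonal_def
    by (auto simp: inner_diff_left inner_add_left)
  then have "orthogonal u u" using orthogonal_to_span[of u B u] sp by auto
  then have "u = 0" by (simp add: orthogonal_def)
  then show ?thesis unfolding u_def by simp
qed

lemma orthonormal_norm:
  fixes e1 e2 n :: "real^3"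
  assumes "norm e1 = 1" "norm e2 = 1" "norm n = 1" "e1 \<bullet> e2 = 0" "e1 \<bullet> n = 0" "e2 \<bullet> n = 0"
  shows "norm (a *\<^sub>R e1 + b *\<^sub>R e2 + g *\<^sub>R n) = sqrt (a\<^sup>2 + b\<^sup>2 + g\<^sup>2)"
proof -
  have s: "e1 \<bullet> e1 = 1" "e2 \<bullet> e2 = 1" "n \<bullet> n = 1" using assms by (auto simp: norm_eq_1)
  have c: "e2 \<bullet> e1 = 0" "n \<bullet> e1 = 0" "n \<bullet> e2 = 0" using assms by (auto simp: inner_commute)
  show ?thesis unfolding norm_eq_sqrt_inner
    using assms c s by (simp add: inner_add_left inner_add_right power2_eq_square)
qed

lemma orthonormal_frame_of_independent:
  fixes d1 d2 :: "real^3"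
  assumes "d1 \<noteq> 0" "\<And>k. d2 \<noteq> k *\<^sub>R d1"
  obtains e1 e2 n \<alpha> \<beta> \<gamma> where "norm e1 = 1" "norm e2 = 1" "norm n = 1" "e1 \<bullet> e2 = 0" "e1 \<bullet> n = 0"
    "e2 \<bullet> n = 0" "e1 = \<alpha> *\<^sub>R d1" "e2 = \<beta> *\<^sub>R d1 + \<gamma> *\<^sub>R d2"
proof -
  define e1 where "e1 = (1 / norm d1) *\<^sub>R d1"
  have "norm e1 = 1" using assms(1) unfolding e1_def by simp
  then have e1: "norm e1 = 1" "e1 \<bullet> e1 = 1" by (auto simp: norm_eq_1)
  define w where "w = d2 - (d2 \<bullet> e1) *\<^sub>R e1"
  have w: "w \<noteq> 0" using assms(2)[of "(d2 \<bullet> e1) / norm d1"] unfolding w_def e1_def by simp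
  define e2 where "e2 = (1 / norm w) *\<^sub>R w"
  have e2: "norm e2 = 1" using w unfolding e2_def by simp
  have "e1 \<bullet> w = 0" unfolding w_def using e1 by (simp add: inner_diff_right inner_commute)
  then have e12: "e1 \<bullet> e2 = 0" unfolding e2_def by simp
  define n where "n = cross3 e1 e2"
  have "(norm n)\<^sup>2 = 1" unfolding n_def using norm_cross[of e1 e2] e1 e2 e12 by simp
  then have n: "norm n = 1" by (simp add: power2_eq_1_iff) (smt (verit) norm_ge_zero)
  have en: "e1 \<bullet> n = 0" "e2 \<bullet> n = 0" unfolding n_def by (simp_all add: dot_cross_self)
  define k l where "k = 1 / norm w" and "l = (d2 \<bullet> e1) / norm d1"
  have "w = d2 - l *\<^sub>R d1" unfolding w_def l_def by (subst (2) e1_def) simp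
  then have "e2 = (- (k * l)) *\<^sub>R d1 + k *\<^sub>R d2"
    unfolding e2_def k_def[symmetric] by (simp add: scaleR_diff_right)
  then show ?thesis using that[OF e1(1) e2 n e12 en e1_def] by blast
qed

text \<open>Near a boundary point that is invariant in two directions, the solid depends on one coordinate.\<close>

lemma face_point_if_invariant_in_two_directions:
  assumes P: "plane_bounded P" "x \<in> frontier P"
    and t: "translation_invariant_near P x d1" "translation_invariant_near P x d2"
    and ind: "d1 \<noteq> 0" "\<And>k. d2 \<noteq> k *\<^sub>R d1"
  shows "x \<in> face_points P"
proof -
  obtain e1 e2 n \<alpha> \<beta> \<gamma> where e: "norm e1 = 1" "norm e2 = 1" "norm n = 1" "e1 \<bullet> e2 = 0" "e1 \<bullet> n = 0"
    "e2 \<bullet> n = 0" "e1 = \<alpha> *\<^sub>R d1" "e2 = \<beta> *\<^sub>R d1 + \<gamma> *\<^sub>R d2"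
    by (rule orthonormal_frame_of_independent[OF ind]) blast
  have "translation_invariant_near P x e1" "translation_invariant_near P x e2"
    using translation_invariant_near_combination[OF t, of \<alpha> 0]
      translation_invariant_near_combination[OF t, of \<beta> \<gamma>] e by auto
  then obtain r1 r2 where r1: "r1 > 0" "\<And>y s. y \<in> ball x r1 \<Longrightarrow> y + s *\<^sub>R e1 \<in> ball x r1 \<Longrightarrow>
      (y + s *\<^sub>R e1 \<in> P \<longleftrightarrow> y \<in> P)"
    and r2: "r2 > 0" "\<And>y s. y \<in> ball x r2 \<Longrightarrow> y + s *\<^sub>R e2 \<in> ball x r2 \<Longrightarrow>
      (y + s *\<^sub>R e2 \<in> P \<longleftrightarrow> y \<in> P)"
    using translation_invariant_nearE by metis
  obtain r3 where r3: "r3 > 0" "conical_near P x r3" using plane_bounded_conical[OF P(1)] by blast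
  define r where "r = min r1 (min r2 r3)"
  have r: "r > 0" "r \<le> r1" "r \<le> r2" "r \<le> r3" unfolding r_def using r1 r2 r3 by auto
  have coord: "y \<in> P \<longleftrightarrow> x + (n \<bullet> (y - x)) *\<^sub>R n \<in> P" "\<bar>n \<bullet> (y - x)\<bar> < r" if y: "y \<in> ball x r" for y
  proof -
    define a b g where "a = (y - x) \<bullet> e1" and "b = (y - x) \<bullet> e2" and "g = (y - x) \<bullet> n"
    have ex: "y = x + (a *\<^sub>R e1 + b *\<^sub>R e2 + g *\<^sub>R n)"
      using orthonormal_expansion[OF e(1-6), of "y - x"] unfolding a_def b_def g_def
      by (simp add: algebra_simps)
    have no: "norm (a' *\<^sub>R e1 + b' *\<^sub>R e2 + g *\<^sub>R n) = sqrt (a'\<^sup>2 + b'\<^sup>2 + g\<^sup>2)" for a' b'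
      by (rule orthonormal_norm[OF e(1-6)])
    have "norm (y - x) < r" using y by (simp add: dist_norm norm_minus_commute)
    then have "sqrt (a\<^sup>2 + b\<^sup>2 + g\<^sup>2) < r" using no[of a b] ex by simp
    moreover have "0\<^sup>2 + b\<^sup>2 + g\<^sup>2 \<le> a\<^sup>2 + b\<^sup>2 + g\<^sup>2" "0\<^sup>2 + 0\<^sup>2 + g\<^sup>2 \<le> a\<^sup>2 + b\<^sup>2 + g\<^sup>2"
      by (simp_all add: zero_power2)
    ultimately have lt: "sqrt (0\<^sup>2 + b\<^sup>2 + g\<^sup>2) < r" "sqrt (0\<^sup>2 + 0\<^sup>2 + g\<^sup>2) < r"
      using real_sqrt_le_mono le_less_trans by blast+
    have b1: "x + (b *\<^sub>R e2 + g *\<^sub>R n) \<in> ball x r" "x + g *\<^sub>R n \<in> ball x r"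
      using lt no[of 0 b] no[of 0 0] e(3) unfolding add_in_ball_iff by simp_all
    have "y \<in> P \<longleftrightarrow> x + (b *\<^sub>R e2 + g *\<^sub>R n) \<in> P"
      using r1(2)[of "x + (b *\<^sub>R e2 + g *\<^sub>R n)" a] b1 y r unfolding ex by (auto simp: algebra_simps)
    also have "\<dots> \<longleftrightarrow> x + g *\<^sub>R n \<in> P"
      using r2(2)[of "x + g *\<^sub>R n" b] b1 r by (auto simp: algebra_simps)
    finally show "y \<in> P \<longleftrightarrow> x + (n \<bullet> (y - x)) *\<^sub>R n \<in> P" unfolding g_def by (simp add: inner_commute)
    show "\<bar>n \<bullet> (y - x)\<bar> < r" using lt(2) by (simp add: g_def inner_commute)
  qed
  have ray: "x + g *\<^sub>R m \<in> P \<longleftrightarrow> x + (r/2) *\<^sub>R m \<in> P" if "0 < g" "g < r" "norm m = 1" for g m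
  proof -
    have b: "x + (r/2) *\<^sub>R m \<in> ball x r3" "x + g *\<^sub>R m \<in> ball x r3" using that r by (auto simp: dist_norm)
    have q: "x + (g / (r/2)) *\<^sub>R (x + (r/2) *\<^sub>R m - x) = x + g *\<^sub>R m" using r by simp
    have "x + (g / (r/2)) *\<^sub>R (x + (r/2) *\<^sub>R m - x) \<in> P \<longleftrightarrow> x + (r/2) *\<^sub>R m \<in> P"
      by (rule conical_near_iff[OF r3(2) _ b(1)]) (use that r b(2) q in simp_all)
    then show ?thesis unfolding q .
  qed
  have "outward_normal_at P x n \<or> outward_normal_at P x (-n)"
  proof (rule face_point_if_half_balls[OF plane_boundedD(2,3)[OF P(1)] P(2) e(3) r(1)])
    have "y \<in> P \<longleftrightarrow> x + (r/2) *\<^sub>R n \<in> P" if "y \<in> ball x r" "n \<bullet> (y - x) > 0" for y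
      using coord[OF that(1)] ray[of "n \<bullet> (y - x)" n] that(2) e(3) by simp
    then show "{y \<in> ball x r. n \<bullet> (y - x) > 0} \<subseteq> P \<or> {y \<in> ball x r. n \<bullet> (y - x) > 0} \<inter> P = {}" by blast
    have "y \<in> P \<longleftrightarrow> x + (r/2) *\<^sub>R (-n) \<in> P" if "y \<in> ball x r" "n \<bullet> (y - x) < 0" for y
      using coord[OF that(1)] ray[of "- (n \<bullet> (y - x))" "-n"] that(2) e(3) by simp
    then show "{y \<in> ball x r. n \<bullet> (y - x) < 0} \<subseteq> P \<or> {y \<in> ball x r. n \<bullet> (y - x) < 0} \<inter> P = {}" by blast
  qed
  then show ?thesis unfolding face_points_def by blast
qed

text \<open>
  Near \<open>x\<close> no other plane is present, so the boundary lies in \<open>h\<close>.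
\<close>

lemma face_point_if_unique_plane:
  assumes "finite \<H>" "\<And>h. h \<in> \<H> \<Longrightarrow> is_plane h" "frontier P \<subseteq> \<Union>\<H>" "closure (interior P) = P"
    and x: "x \<in> frontier P" "h \<in> \<H>" "x \<in> h" "\<And>h'. h' \<in> \<H> \<Longrightarrow> x \<in> h' \<Longrightarrow> h' = h"
  shows "\<exists>n. outward_normal_at P x n \<and> h = {y. n \<bullet> (y - x) = 0}"
proof -
  obtain a b where ab: "a \<noteq> 0" "h = {x. a \<bullet> x = b}" using assms(2)[OF x(2)] unfolding is_plane_def by blast
  define n where "n = (1 / norm a) *\<^sub>R a"
  have n: "norm n = 1" unfolding n_def using ab by simp
  have hn: "h = {y. n \<bullet> (y - x) = 0}" using ab x(3) unfolding n_def by (auto simp: inner_diff_right)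
  define U where "U = - \<Union>{h \<in> \<H>. x \<notin> h}"
  have "open U" unfolding U_def
    by (intro open_Compl closed_Union) (use assms(1,2) is_plane_closed in auto)
  moreover have "x \<in> U" unfolding U_def by blast
  ultimately obtain r where r: "r > 0" "ball x r \<subseteq> U" by (meson openE)
  have cl: "closed P" using closed_closure[of "interior P"] unfolding assms(4) .
  have "outward_normal_at P x n \<or> outward_normal_at P x (-n)"
  proof (rule face_point_if_frontier_in_plane[OF cl assms(4) x(1) n r(1)])
    fix y assume "y \<in> frontier P" "y \<in> ball x r"
    then obtain h' where "h' \<in> \<H>" "y \<in> h'" "y \<in> U" using assms(3) r by blast
    then have "h' = h" using x(4)[of h'] unfolding U_def by blast
    then show "n \<bullet> (y - x) = 0" using \<open>y \<in> h'\<close> hn by blast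
  qed
  moreover have "h = {y. (-n) \<bullet> (y - x) = 0}" using hn by simp
  ultimately show ?thesis using hn by blast
qed

text \<open>
  Join an interior point to an exterior one by a segment that avoids the finitely many lines in which
  two of the planes meet. Where this segment crosses the boundary, only one plane is present.
\<close>

lemma frontier_subset_closure_face_points:
  assumes "plane_bounded P"
  shows "frontier P \<subseteq> closure (face_points P)"
proof
  fix x assume x: "x \<in> frontier P"
  note P = plane_boundedD[OF assms]
  obtain \<H> where H: "finite \<H>" "\<And>h. h \<in> \<H> \<Longrightarrow> is_plane h" "frontier P \<subseteq> \<Union>\<H>"
    using assms unfolding plane_bounded_def by blast
  show "x \<in> closure (face_points P)" unfolding closure_approachable
  proof (intro allI impI)
    fix e :: real assume e: "e > 0"
    have "x \<in> closure (interior P)" using x P by (simp add: frontier_def)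
    then obtain p where p: "p \<in> interior P" "dist p x < e" using e closure_approachable by blast
    have "x \<in> closure (- P)" using x by (simp add: frontier_closures)
    then obtain q where q: "q \<notin> P" "dist q x < e" using e closure_approachable by (metis ComplD)
    define L where "L = (\<lambda>(h, h'). affine hull (insert p (h \<inter> h'))) ` {(h, h'). h \<in> \<H> \<and> h' \<in> \<H> \<and> h \<noteq> h'}"
    have finL: "finite L"
    proof -
      have "finite {(h, h'). h \<in> \<H> \<and> h' \<in> \<H> \<and> h \<noteq> h'}"
        by (rule finite_subset[of _ "\<H> \<times> \<H>"]) (use H(1) in auto)
      then show ?thesis unfolding L_def by simp
    qed
    have L: "closed T \<and> affine T \<and> \<not> UNIV \<subseteq> T" if T: "T \<in> L" for T
    proof -
      obtain h h' where h: "h \<in> \<H>" "h' \<in> \<H>" "h \<noteq> h'" "T = affine hull (insert p (h \<inter> h'))"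
        using T unfolding L_def by auto
      obtain a b where ab: "a \<noteq> 0" "h' = {x. a \<bullet> x = b}" using H(2)[OF h(2)] unfolding is_plane_def by blast
      have "\<not> h \<subseteq> h'" using is_plane_eq_if_subset[OF H(2)[OF h(1)] H(2)[OF h(2)]] h(3) by blast
      then have "aff_dim (h \<inter> h') \<le> 1"
        using aff_dim_affine_Int_hyperplane[OF is_plane_affine[OF H(2)[OF h(1)]], of a b]
          is_plane_aff_dim[OF H(2)[OF h(1)]] unfolding ab(2) by (auto split: if_splits)
      then have "aff_dim T \<le> 2" unfolding h(4) by (simp add: aff_dim_insert)
      then have "T \<noteq> UNIV" by auto
      then show ?thesis unfolding h(4) by auto
    qed
    have "open (ball x e - P)" using P by (intro open_Diff) auto
    moreover have "q \<in> ball x e - P" using q by (simp add: dist_commute)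
    ultimately obtain q' where q': "q' \<in> ball x e" "q' \<notin> P" "\<forall>T\<in>L. q' \<notin> T"
      using affine_generic_point[OF finL L, of q "ball x e - P"] by auto
    define S where "S = closed_segment p q'"
    have "S \<inter> frontier P \<noteq> {}"
      by (rule connected_Int_frontier)
        (use p q' interior_subset in \<open>auto simp: S_def\<close>)
    then obtain z where z: "z \<in> S" "z \<in> frontier P" by blast
    have zp: "z \<noteq> p" using z(2) p(1) by (auto simp: frontier_def)
    obtain u where u: "z = (1 - u) *\<^sub>R p + u *\<^sub>R q'" using z(1) unfolding S_def in_segment by blast
    have u0: "u \<noteq> 0" using u zp by auto
    have q'eq: "q' = (1 - 1/u) *\<^sub>R p + (1/u) *\<^sub>R z" unfolding u using u0 by (simp add: algebra_simps)
    obtain h where h: "h \<in> \<H>" "z \<in> h" using z(2) H(3) by blast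
    have uniq: "h' = h" if "h' \<in> \<H>" "z \<in> h'" for h'
    proof (rule ccontr)
      assume ne: "h' \<noteq> h"
      have "(1 - 1/u) *\<^sub>R p + (1/u) *\<^sub>R z \<in> affine hull (insert p (h' \<inter> h))"
        by (rule mem_affine[OF affine_affine_hull]) (use that h in \<open>auto intro: hull_inc\<close>)
      moreover have "affine hull (insert p (h' \<inter> h)) \<in> L"
        unfolding L_def using that h ne by auto
      ultimately show False using q'(3) q'eq by metis
    qed
    have "z \<in> face_points P"
      using face_point_if_unique_plane[OF H P(3) z(2) h uniq] unfolding face_points_def by blast
    moreover have "z \<in> ball x e"
    proof -
      have "S \<subseteq> ball x e" unfolding S_def
        using p q' by (intro closed_segment_subset) (auto simp: dist_commute)
      then show ?thesis using z by blast
    qed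
    ultimately show "\<exists>y\<in>face_points P. dist y x < e" by (auto simp: dist_commute)
  qed
qed

subsection \<open>Faces as components\<close>

text \<open>
  Both the normal and the level \<open>n \<bullet> x\<close> are locally constant on the face points.
\<close>

lemma face_component_normal:
  assumes C: "C \<in> components (face_points P)"
  obtains n b where "norm n = 1" "\<And>x. x \<in> C \<Longrightarrow> outward_normal_at P x n" "\<And>x. x \<in> C \<Longrightarrow> n \<bullet> x = b"
proof -
  define N where "N x = (THE n. outward_normal_at P x n)" for x
  have Neq: "N x = n" if n: "outward_normal_at P x n" for x n
    unfolding N_def using n outward_normal_at_unique[OF _ n] by (intro the_equality)
  have N: "outward_normal_at P x (N x)" if x: "x \<in> face_points P" for x
  proof -
    obtain n where n: "outward_normal_at P x n" using x unfolding face_points_def by blast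
    then show ?thesis using Neq[OF n] by simp
  qed
  have CP: "C \<subseteq> face_points P" "connected C" "C \<noteq> {}"
    using in_components_subset[OF C] in_components_connected[OF C] in_components_nonempty[OF C] by auto
  have "(\<lambda>x. (N x, N x \<bullet> x)) constant_on C"
  proof (rule locally_constant_imp_constant[OF CP(2)])
    fix x assume x: "x \<in> C"
    then have "outward_normal_at P x (N x)" using N CP by blast
    then obtain r where r: "r > 0"
      "\<And>y. y \<in> ball x r \<Longrightarrow> N x \<bullet> (y - x) = 0 \<Longrightarrow> outward_normal_at P y (N x)"
      "\<And>y. y \<in> ball x r \<Longrightarrow> y \<in> frontier P \<longleftrightarrow> N x \<bullet> (y - x) = 0"
      by (rule outward_normal_at_nearby) blast
    have "(N y, N y \<bullet> y) = (N x, N x \<bullet> x)" if y: "y \<in> C \<inter> ball x r" for y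
    proof -
      have "y \<in> frontier P" using y CP face_points_subset_frontier by blast
      then have e: "N x \<bullet> (y - x) = 0" using r(3)[of y] y by simp
      then have "N y = N x" using Neq r(2)[of y] y by blast
      then show ?thesis using e by (simp add: inner_diff_right)
    qed
    moreover have "openin (top_of_set C) (C \<inter> ball x r)" by auto
    moreover have "x \<in> C \<inter> ball x r" using x r by auto
    ultimately show "\<exists>T. openin (top_of_set C) T \<and> x \<in> T \<and> (\<forall>y\<in>T. (N y, N y \<bullet> y) = (N x, N x \<bullet> x))"
      by blast
  qed
  then obtain n b where nb: "\<And>x. x \<in> C \<Longrightarrow> N x = n \<and> N x \<bullet> x = b"
    unfolding constant_on_def by auto
  have on: "outward_normal_at P x n" if "x \<in> C" for x using N[of x] nb[OF that] that CP by auto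
  moreover have "norm n = 1" using on CP(3) outward_normal_at_def by blast
  moreover have "n \<bullet> x = b" if "x \<in> C" for x using nb[OF that] by auto
  ultimately show ?thesis using that by blast
qed

lemma face_component_contains_disc:
  assumes C: "C \<in> components (face_points P)" "x \<in> C" "outward_normal_at P x n"
  obtains r where "r > 0" "\<And>y. y \<in> ball x r \<Longrightarrow> n \<bullet> (y - x) = 0 \<Longrightarrow> y \<in> C"
    "\<And>y. y \<in> ball x r \<Longrightarrow> y \<in> frontier P \<Longrightarrow> y \<in> C"
proof -
  obtain r where r: "r > 0"
      "\<And>y. y \<in> ball x r \<Longrightarrow> n \<bullet> (y - x) = 0 \<Longrightarrow> outward_normal_at P y n"
      "\<And>y. y \<in> ball x r \<Longrightarrow> y \<in> frontier P \<longleftrightarrow> n \<bullet> (y - x) = 0"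
    using C(3) by (rule outward_normal_at_nearby) blast
  define D where "D = ball x r \<inter> {y. n \<bullet> y = n \<bullet> x}"
  have "D \<subseteq> face_points P"
  proof
    fix y assume "y \<in> D"
    then have "outward_normal_at P y n" using r(2)[of y] unfolding D_def by (simp add: inner_diff_right)
    then show "y \<in> face_points P" unfolding face_points_def by blast
  qed
  moreover have "convex D" unfolding D_def by (intro convex_Int convex_ball convex_hyperplane)
  moreover have "x \<in> D" unfolding D_def using r by simp
  ultimately have "D \<subseteq> C" using components_maximal[OF C(1), of D] C(2) convex_connected by blast
  then have 1: "y \<in> C" if "y \<in> ball x r" "n \<bullet> (y - x) = 0" for y
    using that unfolding D_def by (auto simp: inner_diff_right)
  show ?thesis using that[OF r(1)] 1 r(3) by blast
qed

text \<open>
  A face therefore determines its component, and faces may be counted as components.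
\<close>

lemma face_component_eq_closure_Int:
  assumes "C \<in> components (face_points P)"
  shows "closure C \<inter> face_points P = C"
proof -
  obtain T where T: "closed T" "C = face_points P \<inter> T"
    using closedin_component[OF assms] unfolding closedin_closed by blast
  then have "closure C \<subseteq> T" by (intro closure_minimal) auto
  then show ?thesis using T closure_subset by blast
qed

lemma inj_on_closure_face_components: "inj_on closure (components (face_points P))"
  by (rule inj_onI) (metis face_component_eq_closure_Int)

lemma card_faces: "card (faces P) = card (components (face_points P))"
  unfolding faces_def by (rule card_image[OF inj_on_closure_face_components])

lemma face_normal_eq:
  assumes "C \<in> components (face_points P)" "\<And>x. x \<in> C \<Longrightarrow> outward_normal_at P x n"
  shows "face_normal P (closure C) = n"
  unfolding face_normal_def face_component_eq_closure_Int[OF assms(1)]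
proof (rule the_equality)
  fix m assume m: "\<forall>x\<in>C. outward_normal_at P x m"
  obtain x where "x \<in> C" using in_components_nonempty[OF assms(1)] by blast
  then show "m = n" using m assms(2) outward_normal_at_unique by blast
qed (use assms(2) in blast)

lemma face_component_openin_plane:
  assumes "C \<in> components (face_points P)" "\<And>x. x \<in> C \<Longrightarrow> outward_normal_at P x n" "\<And>x. x \<in> C \<Longrightarrow> n \<bullet> x = b"
  shows "openin (top_of_set {y. n \<bullet> y = b}) C"
  unfolding openin_contains_ball
proof (intro conjI ballI)
  show "C \<subseteq> {y. n \<bullet> y = b}" using assms(3) by blast
  fix x assume x: "x \<in> C"
  obtain r where r: "r > 0" "\<And>y. y \<in> ball x r \<Longrightarrow> n \<bullet> (y - x) = 0 \<Longrightarrow> y \<in> C"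
    using face_component_contains_disc[OF assms(1) x assms(2)[OF x]] by metis
  have "ball x r \<inter> {y. n \<bullet> y = b} \<subseteq> C"
    using r(2) assms(3)[OF x] by (auto simp: inner_diff_right)
  then show "\<exists>e>0. ball x e \<inter> {y. n \<bullet> y = b} \<subseteq> C" using r(1) by blast
qed

lemma sgn_convex_combination:
  fixes a b u :: real
  assumes "sgn a = sgn b" "0 \<le> u" "u \<le> 1"
  shows "sgn ((1 - u) * a + u * b) = sgn a"
proof -
  consider "a > 0" "b > 0" | "a = 0" "b = 0" | "a < 0" "b < 0"
    using assms(1) by (cases "a > 0"; cases "a = 0"; cases "b > 0"; cases "b = 0") (auto simp: sgn_if split: if_splits)
  moreover have pos: "(1 - u) * p + u * q > 0" if "p > 0" "q > 0" for p q
    using that assms(2,3) by (cases "u = 0") (auto intro!: add_nonneg_pos)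
  ultimately show ?thesis
  proof cases
    case 3
    then show ?thesis using pos[of "-a" "-b"] by simp
  qed (use pos[of a b] in simp_all)
qed

lemma closure_Union_finite_family:
  assumes "finite \<A>" shows "closure (\<Union>\<A>) = \<Union>(closure ` \<A>)"
  using assms by (induction rule: finite_induct) auto

text \<open>
  The planes cut space into finitely many convex cells. A cell through a face point that lies on a
  single plane stays inside one component of the face points, and these cells exhaust the component
  up to closure. Hence there are finitely many components, and their closures are unions of polytopes.
\<close>

lemma plane_bounded_cells:
  assumes "plane_bounded P"
  shows "finite (components (face_points P))"
    and "C \<in> components (face_points P) \<Longrightarrow> \<exists>T. finite T \<and> (\<forall>D\<in>T. polytope D) \<and> closure C = \<Union>T"
proof -
  note P = plane_boundedD[OF assms]
  obtain \<H> where H: "finite \<H>" "\<And>h. h \<in> \<H> \<Longrightarrow> is_plane h" "frontier P \<subseteq> \<Union>\<H>"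
    using assms unfolding plane_bounded_def by blast
  have "\<forall>h\<in>\<H>. \<exists>ab. fst ab \<noteq> 0 \<and> h = {x. fst ab \<bullet> x = snd ab}"
    using H(2) unfolding is_plane_def by auto
  then obtain AB where AB: "\<And>h. h \<in> \<H> \<Longrightarrow> fst (AB h) \<noteq> 0 \<and> h = {x. fst (AB h) \<bullet> x = snd (AB h)}"
    by metis
  define f where "f h x = fst (AB h) \<bullet> x - snd (AB h)" for h x
  have hf: "x \<in> h \<longleftrightarrow> sgn (f h x) = 0" if "h \<in> \<H>" for h x
    using AB[OF that] by (auto simp: f_def sgn_eq_0_iff)
  have fcomb: "f h ((1 - u) *\<^sub>R y + u *\<^sub>R z) = (1 - u) * f h y + u * f h z" for h u y z
    unfolding f_def by (simp add: inner_add_right algebra_simps)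
  define sg where "sg x = restrict (\<lambda>h. sgn (f h x)) \<H>" for x
  define cell where "cell x = {y. sg y = sg x}" for x
  have sgD: "sgn (f h y) = sgn (f h x)" if "sg y = sg x" "h \<in> \<H>" for x y h
    using that unfolding sg_def restrict_def by metis
  have sgI: "sg y = sg x" if "\<And>h. h \<in> \<H> \<Longrightarrow> sgn (f h y) = sgn (f h x)" for x y
    unfolding sg_def using that by (auto simp: restrict_def)
  have fin_sg: "finite (range sg)"
  proof (rule finite_subset)
    have s3: "sgn v \<in> {-1, 0, 1}" for v :: real by (simp add: sgn_if)
    have "sg x \<in> (\<Pi>\<^sub>E h\<in>\<H>. {-1, 0, 1})" for x
      unfolding sg_def restrict_PiE_iff using s3 by blast
    then show "range sg \<subseteq> (\<Pi>\<^sub>E h\<in>\<H>. {-1, 0, 1})" by blast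
  qed (use H(1) in \<open>auto intro: finite_PiE\<close>)
  have convex_cell: "convex (cell x)" for x
    unfolding convex_alt
  proof (intro ballI allI impI)
    fix y z u assume yz: "y \<in> cell x" "z \<in> cell x" and u: "0 \<le> (u::real) \<and> u \<le> 1"
    have "sg ((1 - u) *\<^sub>R y + u *\<^sub>R z) = sg y"
    proof (rule sgI)
      fix h assume h: "h \<in> \<H>"
      have "sgn (f h y) = sgn (f h z)" using sgD[of y x h] sgD[of z x h] yz h unfolding cell_def by simp
      then show "sgn (f h ((1 - u) *\<^sub>R y + u *\<^sub>R z)) = sgn (f h y)"
        unfolding fcomb using u by (intro sgn_convex_combination) auto
    qed
    then show "(1 - u) *\<^sub>R y + u *\<^sub>R z \<in> cell x" using yz unfolding cell_def by simp
  qed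
  define G where "G = {x \<in> frontier P. \<exists>h\<in>\<H>. x \<in> h \<and> (\<forall>h'\<in>\<H>. x \<in> h' \<longrightarrow> h' = h)}"
  have cellC: "cell x \<subseteq> C" if C: "C \<in> components (face_points P)" and x: "x \<in> C" "x \<in> G" for C x
  proof -
    obtain h where h: "h \<in> \<H>" "x \<in> h" "\<And>h'. h' \<in> \<H> \<Longrightarrow> x \<in> h' \<Longrightarrow> h' = h"
      using x(2) unfolding G_def by blast
    have inh: "y \<in> h' \<longleftrightarrow> h' = h" if y: "y \<in> cell x" "h' \<in> \<H>" for y h'
    proof -
      have "sgn (f h' y) = sgn (f h' x)" using sgD[of y x h'] y unfolding cell_def by simp
      then have "y \<in> h' \<longleftrightarrow> x \<in> h'" using hf[OF y(2)] by simp
      then show ?thesis using h y(2) by blast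
    qed
    have nrm: "\<exists>n. outward_normal_at P y n \<and> h = {z. n \<bullet> (z - y) = 0}"
      if y: "y \<in> cell x" "y \<in> frontier P" for y
      by (rule face_point_if_unique_plane[OF H P(3) y(2) h(1)]) (use inh y h(1) in blast)+
    have "cell x \<inter> frontier P = {} \<or> cell x \<inter> frontier P = cell x"
    proof (rule connected_clopen[THEN iffD1, rule_format])
      show "connected (cell x)" by (rule convex_connected[OF convex_cell])
      show "openin (top_of_set (cell x)) (cell x \<inter> frontier P) \<and>
            closedin (top_of_set (cell x)) (cell x \<inter> frontier P)"
      proof
        show "openin (top_of_set (cell x)) (cell x \<inter> frontier P)"
          unfolding openin_contains_ball
        proof (intro conjI ballI)
          fix y assume y: "y \<in> cell x \<inter> frontier P"
          then obtain n where n: "outward_normal_at P y n" "h = {z. n \<bullet> (z - y) = 0}" using nrm by blast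
          obtain r where r: "r > 0" "\<And>z. z \<in> ball y r \<Longrightarrow> z \<in> frontier P \<longleftrightarrow> n \<bullet> (z - y) = 0"
            using n(1) by (rule outward_normal_at_nearby) blast
          have "ball y r \<inter> cell x \<subseteq> cell x \<inter> frontier P"
            using r(2) inh[OF _ h(1)] n(2) by blast
          then show "\<exists>e>0. ball y e \<inter> cell x \<subseteq> cell x \<inter> frontier P" using r(1) by blast
        qed blast
        show "closedin (top_of_set (cell x)) (cell x \<inter> frontier P)"
          by (intro closedin_closed_Int frontier_closed)
      qed
    qed
    moreover have "x \<in> cell x \<inter> frontier P" using x(2) unfolding G_def cell_def by blast
    ultimately have "cell x \<subseteq> frontier P" by blast
    then have "cell x \<subseteq> face_points P" using nrm unfolding face_points_def by blast
    then show ?thesis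
      using components_maximal[OF C convex_connected[OF convex_cell], of x] x(1) unfolding cell_def by blast
  qed
  have dense: "C \<subseteq> closure (C \<inter> G)" if C: "C \<in> components (face_points P)" for C
  proof
    fix x assume x: "x \<in> C"
    obtain n where n: "outward_normal_at P x n"
      using x in_components_subset[OF C] unfolding face_points_def by blast
    obtain r where r: "r > 0" "\<And>y. y \<in> ball x r \<Longrightarrow> n \<bullet> (y - x) = 0 \<Longrightarrow> y \<in> C"
      using face_component_contains_disc[OF C x n] by metis
    define p where "p = {y. n \<bullet> y = n \<bullet> x}"
    have "n \<noteq> 0" using n unfolding outward_normal_at_def by auto
    then have pp: "is_plane p" unfolding is_plane_def p_def by blast
    show "x \<in> closure (C \<inter> G)" unfolding closure_approachable
    proof (intro allI impI)
      fix e :: real assume e: "e > 0"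
      have "\<exists>y. y \<in> p \<and> y \<in> ball x (min e r) \<and> (\<forall>T\<in>\<H> - {p}. y \<notin> T)"
      proof (rule affine_generic_point)
        show "closed T \<and> affine T \<and> \<not> p \<subseteq> T" if "T \<in> \<H> - {p}" for T
          using that is_plane_closed is_plane_affine is_plane_eq_if_subset[OF pp] H(2) by blast
        show "x \<in> p" "x \<in> ball x (min e r)" unfolding p_def using e r by auto
      qed (use H(1) is_plane_affine[OF pp] in auto)
      then obtain y where y: "y \<in> p" "y \<in> ball x (min e r)" "\<forall>T\<in>\<H> - {p}. y \<notin> T" by blast
      have "y \<in> C" using r(2)[of y] y unfolding p_def by (auto simp: inner_diff_right)
      then have "y \<in> frontier P" using in_components_subset[OF C] face_points_subset_frontier by blast
      then have "y \<in> G" using H(3) y(3) unfolding G_def by blast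
      then show "\<exists>y\<in>C \<inter> G. dist y x < e" using \<open>y \<in> C\<close> y(2) by (auto simp: dist_commute)
    qed
  qed
  show "finite (components (face_points P))"
  proof -
    have "\<exists>x. x \<in> C \<and> x \<in> G" if C: "C \<in> components (face_points P)" for C
    proof (rule ccontr)
      assume "\<not> ?thesis"
      then have "C \<inter> G = {}" by blast
      then show False using dense[OF C] in_components_nonempty[OF C] by simp
    qed
    then obtain g where g: "\<And>C. C \<in> components (face_points P) \<Longrightarrow> g C \<in> C \<and> g C \<in> G" by metis
    have "inj_on (sg \<circ> g) (components (face_points P))"
    proof (rule inj_onI)
      fix C C' assume C: "C \<in> components (face_points P)" "C' \<in> components (face_points P)"
        "(sg \<circ> g) C = (sg \<circ> g) C'"
      then have "g C' \<in> cell (g C)" unfolding cell_def by simp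
      then have "g C' \<in> C" using cellC[OF C(1)] g[OF C(1)] by blast
      then show "C = C'" using components_eq[OF C(1,2)] g[OF C(2)] by blast
    qed
    moreover have "finite ((sg \<circ> g) ` components (face_points P))"
      by (rule finite_subset[OF _ fin_sg]) auto
    ultimately show ?thesis by (rule finite_imageD[rotated])
  qed
  show "\<exists>T. finite T \<and> (\<forall>D\<in>T. polytope D) \<and> closure C = \<Union>T"
    if C: "C \<in> components (face_points P)"
  proof -
    have CP: "C \<subseteq> P"
      using in_components_subset[OF C] face_points_subset_frontier P(2) frontier_subset_closed by blast
    define \<K> where "\<K> = cell ` (C \<inter> G)"
    have "finite \<K>"
    proof -
      have "\<K> \<subseteq> (\<lambda>s. {y. sg y = s}) ` range sg" unfolding \<K>_def cell_def by auto
      then show ?thesis using finite_subset fin_sg by blast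
    qed
    have poly: "polytope (closure (cell x))" if x: "x \<in> C \<inter> G" for x
    proof -
      define K where "K h = {y. sgn (f h x) * f h y \<ge> 0 \<and> (sgn (f h x) = 0 \<longrightarrow> f h y = 0)}" for h
      have Kpoly: "polyhedron (K h)" for h
      proof -
        consider "f h x = 0" | "f h x > 0" | "f h x < 0" by linarith
        then show ?thesis
        proof cases
          case 1
          then have "K h = {y. fst (AB h) \<bullet> y = snd (AB h)}" unfolding K_def f_def by auto
          then show ?thesis using polyhedron_hyperplane by auto
        next
          case 2
          then have "K h = {y. fst (AB h) \<bullet> y \<ge> snd (AB h)}" unfolding K_def by (auto simp: f_def)
          then show ?thesis using polyhedron_halfspace_ge by auto
        next
          case 3
          then have "K h = {y. fst (AB h) \<bullet> y \<le> snd (AB h)}" unfolding K_def by (auto simp: f_def)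
          then show ?thesis using polyhedron_halfspace_le by auto
        qed
      qed
      have cK: "closed (K h)" for h by (rule polyhedron_imp_closed[OF Kpoly])
      have "closure (cell x) = \<Inter>(K ` \<H>)"
      proof
        have "cell x \<subseteq> K h" if "h \<in> \<H>" for h
        proof
          fix y assume "y \<in> cell x"
          then have "sgn (f h y) = sgn (f h x)" using sgD that unfolding cell_def by blast
          then show "y \<in> K h" unfolding K_def by (auto simp: sgn_if split: if_splits)
        qed
        then show "closure (cell x) \<subseteq> \<Inter>(K ` \<H>)" using cK by (intro closure_minimal) auto
        show "\<Inter>(K ` \<H>) \<subseteq> closure (cell x)"
        proof
          fix y assume y: "y \<in> \<Inter>(K ` \<H>)"
          have "sg ((1 - u) *\<^sub>R y + u *\<^sub>R x) = sg x" if u: "0 < u" "u \<le> 1" for u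
          proof (rule sgI)
            fix h assume "h \<in> \<H>"
            then have yk: "sgn (f h x) * f h y \<ge> 0" "sgn (f h x) = 0 \<longrightarrow> f h y = 0"
              using y unfolding K_def by auto
            consider "f h x > 0" | "f h x = 0" | "f h x < 0" by linarith
            then show "sgn (f h ((1 - u) *\<^sub>R y + u *\<^sub>R x)) = sgn (f h x)"
            proof cases
              case 1
              then have "(1 - u) * f h y + u * f h x > 0" using u yk by (intro add_nonneg_pos) auto
              then show ?thesis unfolding fcomb using 1 by simp
            next
              case 2
              then show ?thesis unfolding fcomb using yk by simp
            next
              case 3
              then have "(1 - u) * (- f h y) + u * (- f h x) > 0"
                using u yk by (intro add_nonneg_pos mult_nonneg_nonneg mult_pos_pos) auto
              then show ?thesis unfolding fcomb using 3 by simp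
            qed
          qed
          then have inc: "(1 - u) *\<^sub>R y + u *\<^sub>R x \<in> cell x" if "0 < u" "u \<le> 1" for u
            using that unfolding cell_def by blast
          show "y \<in> closure (cell x)"
          proof (cases "y = x")
            case False
            have "open_segment y x \<subseteq> cell x" using inc by (auto simp: in_segment)
            then have "closure (open_segment y x) \<subseteq> closure (cell x)" by (rule closure_mono)
            then show ?thesis using False by (simp add: closure_open_segment) blast
          next
            case True
            then have "y \<in> cell x" unfolding cell_def by simp
            then show ?thesis using closure_subset by blast
          qed
        qed
      qed
      moreover have "polyhedron (\<Inter>(K ` \<H>))"
        by (rule polyhedron_Inter) (use H(1) Kpoly in auto)
      moreover have "bounded (closure (cell x))"
        using cellC[OF C] x CP compact_imp_bounded[OF P(1)] bounded_closure bounded_subset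
        by (metis IntD1 IntD2 subset_trans)
      ultimately show ?thesis by (simp add: polytope_eq_bounded_polyhedron)
    qed
    have "closure C = closure (\<Union>\<K>)"
    proof
      have "C \<inter> G \<subseteq> \<Union>\<K>" unfolding \<K>_def cell_def by blast
      then have "closure (C \<inter> G) \<subseteq> closure (\<Union>\<K>)" by (rule closure_mono)
      then show "closure C \<subseteq> closure (\<Union>\<K>)" using dense[OF C] closure_minimal by blast
      show "closure (\<Union>\<K>) \<subseteq> closure C"
        by (rule closure_mono) (use cellC[OF C] in \<open>auto simp: \<K>_def\<close>)
    qed
    also have "\<dots> = \<Union>(closure ` \<K>)" using closure_Union_finite_family[OF \<open>finite \<K>\<close>] by simp
    finally have "closure C = \<Union>(closure ` \<K>)" .
    moreover have "\<forall>D\<in>closure ` \<K>. polytope D" unfolding \<K>_def using poly by auto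
    ultimately show ?thesis using \<open>finite \<K>\<close> by blast
  qed
qed

text \<open>
  The component is open in its plane, hence contained in the relative interior of its closure.
\<close>

lemma plane_bounded_face_polygon:
  assumes "plane_bounded P" and C: "C \<in> components (face_points P)"
  shows "planar_polygon (closure C)"
proof -
  obtain n b where n: "norm n = 1" "\<And>x. x \<in> C \<Longrightarrow> outward_normal_at P x n" "\<And>x. x \<in> C \<Longrightarrow> n \<bullet> x = b"
    using face_component_normal[OF C] by blast
  define p where "p = {y. n \<bullet> y = b}"
  have "n \<noteq> 0" using n(1) by auto
  then have pp: "is_plane p" unfolding is_plane_def p_def by blast
  have ne: "C \<noteq> {}" by (rule in_components_nonempty[OF C])
  have op: "openin (top_of_set p) C" unfolding p_def by (rule face_component_openin_plane[OF C n(2,3)])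
  have hullp: "affine hull p = p" using is_plane_affine[OF pp] by (simp add: affine_hull_eq)
  have hullC: "affine hull C = p" using affine_hull_openin[of p C] op ne hullp by simp
  have "aff_dim C = 2" using is_plane_aff_dim[OF pp] hullC aff_dim_affine_hull[of C] by simp
  then have d: "aff_dim (closure C) = 2" by simp
  have "C \<subseteq> rel_interior (closure C)"
  proof -
    have "rel_interior C = C" using op hullC by (simp add: rel_interior_openin)
    then show ?thesis using subset_rel_interior[of C "closure C"] closure_subset by auto
  qed
  then have "closure C \<subseteq> closure (rel_interior (closure C))" by (rule closure_mono)
  moreover have "closure (rel_interior (closure C)) \<subseteq> closure C"
    using closure_minimal[OF rel_interior_subset closed_closure] .
  ultimately show ?thesis
    unfolding planar_polygon_def using d plane_bounded_cells(2)[OF assms] by blast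
qed

lemma solid_polyhedron_if_plane_bounded:
  assumes "plane_bounded P" "connected P" "interior P \<noteq> {}"
  shows "solid_polyhedron P"
proof -
  note P = plane_boundedD[OF assms(1)]
  have fin: "finite (components (face_points P))" by (rule plane_bounded_cells(1)[OF assms(1)])
  have "\<Union>(faces P) = closure (\<Union>(components (face_points P)))"
    unfolding faces_def using closure_Union_finite_family[OF fin] by simp
  also have "\<dots> = closure (face_points P)" by (simp add: Union_components)
  also have "\<dots> = frontier P"
    using frontier_subset_closure_face_points[OF assms(1)]
      closure_minimal[OF face_points_subset_frontier frontier_closed] by blast
  finally have "frontier P = \<Union>(faces P)" ..
  moreover have "\<forall>F\<in>faces P. planar_polygon F"
    unfolding faces_def using plane_bounded_face_polygon[OF assms(1)] by blast
  moreover have "finite (faces P)" unfolding faces_def using fin by simp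
  ultimately show ?thesis unfolding solid_polyhedron_def using P assms(2,3) by blast
qed

lemma solid_polyhedron_plane_bounded:
  assumes "solid_polyhedron P"
  shows "plane_bounded P"
proof -
  have P: "compact P" "closure (interior P) = P" "finite (faces P)" "\<forall>F\<in>faces P. planar_polygon F"
    "frontier P = \<Union>(faces P)" using assms unfolding solid_polyhedron_def by auto
  define \<H> where "\<H> = (\<lambda>F. affine hull F) ` faces P"
  have "is_plane h" if h: "h \<in> \<H>" for h
  proof -
    obtain F where "F \<in> faces P" "h = affine hull F" using h unfolding \<H>_def by blast
    moreover have "aff_dim F = DIM(real^3) - 1" using P(4) \<open>F \<in> faces P\<close> unfolding planar_polygon_def by auto
    ultimately show ?thesis unfolding is_plane_def using aff_dim_eq_hyperplane[of F] by auto
  qed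
  moreover have "frontier P \<subseteq> \<Union>\<H>"
  proof
    fix x assume "x \<in> frontier P"
    then obtain F where F: "F \<in> faces P" "x \<in> F" unfolding P(5) by blast
    then have "x \<in> affine hull F" by (simp add: hull_inc)
    then show "x \<in> \<Union>\<H>" using F(1) unfolding \<H>_def by blast
  qed
  moreover have "finite \<H>" unfolding \<H>_def using P(3) by simp
  ultimately show ?thesis unfolding plane_bounded_def using P(1,2) by blast
qed

section \<open>Edges and vertices\<close>

lemma vertices_not_invariant:
  assumes "x \<in> vertices P" "translation_invariant_near P x d"
  shows "d = 0"
  using assms edge_points_iff[of x P] unfolding vertices_def by blast

lemma vertices_Int_edge_points: "vertices P \<inter> edge_points P = {}"
  unfolding vertices_def by blast

lemma edge_points_subset_frontier: "edge_points P \<subseteq> frontier P"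
  unfolding edge_points_def by blast

lemma vertices_subset_frontier: "vertices P \<subseteq> frontier P"
  unfolding vertices_def by blast

text \<open>
  Near the apex of a cone the solid is a cone around the apex and also around \<open>x\<close>, hence invariant along
  the line through both. This makes vertices isolated.
\<close>

lemma no_vertex_near_apex:
  assumes "plane_bounded P" "conical_near P y r" "x \<in> ball y r" "x \<noteq> y"
  shows "x \<notin> vertices P"
proof
  assume x: "x \<in> vertices P"
  obtain r' where "r' > 0" "conical_near P x r'" using plane_bounded_conical[OF assms(1)] by blast
  then have "translation_invariant_near P x (x - y)"
    using translation_invariant_near_if_conical[OF assms(2)] assms(3,4) by blast
  then have "x - y = 0" by (rule vertices_not_invariant[OF x])
  then show False using assms(4) by simp
qed

lemma finite_vertices:
  assumes "plane_bounded P"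
  shows "finite (vertices P)"
proof (rule ccontr)
  assume inf: "infinite (vertices P)"
  have "compact (frontier P)" using plane_boundedD(1)[OF assms] by (rule compact_frontier)
  then obtain y where y: "y islimpt vertices P"
    using inf vertices_subset_frontier compact_eq_Bolzano_Weierstrass[of "frontier P"] by blast
  obtain r where r: "r > 0" "conical_near P y r" using plane_bounded_conical[OF assms] by blast
  obtain x where "x \<in> vertices P" "x \<in> ball y r" "x \<noteq> y"
    using y r(1) unfolding islimpt_def by (meson centre_in_ball open_ball)
  then show False using no_vertex_near_apex[OF assms r(2)] by blast
qed

lemma finite_edges:
  assumes "plane_bounded P"
  shows "finite (edges P)"
proof (rule finite_subset)
  show "edges P \<subseteq> (\<lambda>(a, b). closed_segment a b) ` (vertices P \<times> vertices P)"
    unfolding edges_def by auto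
qed (use finite_vertices[OF assms] in simp)

lemma diameter_closed_segment: "diameter (closed_segment a b) = dist a b" for a b :: "real^3"
proof (rule antisym)
  show "diameter (closed_segment a b) \<le> dist a b"
  proof (rule diameter_le)
    fix x y assume "x \<in> closed_segment a b" "y \<in> closed_segment a b"
    then obtain u v where uv: "0 \<le> u" "u \<le> 1" "x = (1 - u) *\<^sub>R a + u *\<^sub>R b"
      "0 \<le> v" "v \<le> 1" "y = (1 - v) *\<^sub>R a + v *\<^sub>R b" unfolding in_segment by blast
    have "x - y = (v - u) *\<^sub>R (a - b)" unfolding uv by (simp add: algebra_simps)
    then have "norm (x - y) = \<bar>v - u\<bar> * dist a b" by (simp add: dist_norm)
    also have "\<dots> \<le> 1 * dist a b" using uv by (intro mult_right_mono) auto
    finally show "norm (x - y) \<le> dist a b" by simp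
  qed simp
  show "dist a b \<le> diameter (closed_segment a b)"
    by (rule diameter_bounded_bound) (auto simp: compact_imp_bounded)
qed

lemma edgesE:
  assumes "E \<in> edges P"
  obtains a b where "E = closed_segment a b" "a \<in> vertices P" "b \<in> vertices P" "a \<noteq> b"
    "open_segment a b \<subseteq> edge_points P"
  using assms unfolding edges_def by blast

lemma edges_at_vertexE:
  assumes "E \<in> edges P" "H \<in> vertices P" "H \<in> E"
  obtains b where "E = closed_segment H b" "b \<in> vertices P" "b \<noteq> H" "open_segment H b \<subseteq> edge_points P"
proof -
  obtain a b where ab: "E = closed_segment a b" "a \<in> vertices P" "b \<in> vertices P" "a \<noteq> b"
    "open_segment a b \<subseteq> edge_points P" using edgesE[OF assms(1)] by metis
  have "H \<notin> open_segment a b" using ab(5) assms(2) vertices_Int_edge_points by blast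
  then consider "H = a" | "H = b" using assms(3) unfolding ab(1) open_segment_def by blast
  then show ?thesis
  proof cases
    case 1
    then show ?thesis using that[of b] ab by blast
  next
    case 2
    then show ?thesis using that[of a] ab by (metis closed_segment_commute open_segment_commute)
  qed
qed

text \<open>
  Two directions of invariance at a boundary point force a face point, so a boundary point that is
  approached by edge points along \<open>v\<close> has no direction of invariance other than \<open>v\<close>.
\<close>

lemma parallel_if_approached_by_edge_points:
  assumes P: "plane_bounded P" and t: "translation_invariant_near P x d" "d \<noteq> 0" and v: "v \<noteq> 0"
    and app: "\<And>\<epsilon>. \<epsilon> > 0 \<Longrightarrow> \<exists>s. 0 < s \<and> s < \<epsilon> \<and> x + s *\<^sub>R v \<in> edge_points P"
  shows "\<exists>k. v = k *\<^sub>R d"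
proof -
  obtain r1 where r1: "r1 > 0" "\<forall>y\<in>ball x r1. translation_invariant_near P y d"
    using translation_invariant_near_nearby[OF t(1)] by blast
  obtain r2 where r2: "r2 > 0" "conical_near P x r2" using plane_bounded_conical[OF P] by blast
  have "min r1 r2 / norm v > 0" using r1 r2 v by simp
  then obtain s where s: "0 < s" "s < min r1 r2 / norm v" "x + s *\<^sub>R v \<in> edge_points P" using app by blast
  define y where "y = x + s *\<^sub>R v"
  have "norm (s *\<^sub>R v) < min r1 r2" using s v by (simp add: pos_less_divide_eq)
  then have y: "y \<in> ball x r1" "y \<in> ball x r2" "y \<noteq> x"
    using s v unfolding y_def add_in_ball_iff by auto
  obtain r3 where r3: "r3 > 0" "conical_near P y r3" using plane_bounded_conical[OF P] by blast
  have ty: "translation_invariant_near P y (s *\<^sub>R v)"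
    using translation_invariant_near_if_conical[OF r2(2) r3(2,1) y(2,3)] unfolding y_def by simp
  have td: "translation_invariant_near P y d" using r1(2) y(1) by blast
  have ye: "y \<in> frontier P" "y \<notin> face_points P" using s(3) unfolding y_def edge_points_iff by auto
  obtain k where "s *\<^sub>R v = k *\<^sub>R d"
    using face_point_if_invariant_in_two_directions[OF P ye(1) td ty t(2)] ye(2) by blast
  then have "v = (k / s) *\<^sub>R d"
    using s(1) by (metis divide_inverse_commute scaleR_one scaleR_scaleR left_inverse less_irrefl)
  then show ?thesis by blast
qed

lemma open_segment_nearby:
  fixes a b :: "real^3"
  assumes "x \<in> open_segment a b" "\<epsilon> > 0"
  shows "\<exists>s. 0 < s \<and> s < \<epsilon> \<and> x + s *\<^sub>R (b - a) \<in> open_segment a b"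
proof -
  obtain u where u: "a \<noteq> b" "0 < u" "u < 1" "x = (1 - u) *\<^sub>R a + u *\<^sub>R b"
    using assms(1) unfolding in_segment by blast
  define s where "s = min \<epsilon> (1 - u) / 2"
  have s: "0 < s" "s < \<epsilon>" "u + s < 1" unfolding s_def using assms u by (auto simp: min_def field_simps)
  have "x + s *\<^sub>R (b - a) = (1 - (u + s)) *\<^sub>R a + (u + s) *\<^sub>R b" unfolding u by (simp add: algebra_simps)
  then have "x + s *\<^sub>R (b - a) \<in> open_segment a b"
    unfolding in_segment using u s by (metis add_pos_pos)
  then show ?thesis using s by blast
qed

text \<open>
  By definition an inner point of an edge has some direction of invariance; the neighbouring edge points
  force it to be that of the edge.
\<close>

lemma edge_points_direction:
  assumes P: "plane_bounded P" and E: "open_segment a b \<subseteq> edge_points P" "x \<in> open_segment a b"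
  shows "translation_invariant_near P x (b - a)"
proof -
  have ab: "a \<noteq> b" using E(2) by auto
  have "x \<in> edge_points P" using E by blast
  then obtain d where d: "d \<noteq> 0" "translation_invariant_near P x d" unfolding edge_points_iff by blast
  have "\<exists>k. b - a = k *\<^sub>R d"
  proof (rule parallel_if_approached_by_edge_points[OF P d(2,1)])
    show "\<exists>s. 0 < s \<and> s < \<epsilon> \<and> x + s *\<^sub>R (b - a) \<in> edge_points P" if "\<epsilon> > 0" for \<epsilon>
      using open_segment_nearby[OF E(2) that] E(1) by blast
  qed (use ab in simp)
  then obtain k where "b - a = k *\<^sub>R d" by blast
  then show ?thesis using translation_invariant_near_combination[OF d(2,2), of k 0] by simp
qed

lemma open_segment_line_iff:
  fixes x w :: "real^3"
  assumes "w \<noteq> 0" "\<alpha> < \<beta>"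
  shows "x + t *\<^sub>R w \<in> open_segment (x + \<alpha> *\<^sub>R w) (x + \<beta> *\<^sub>R w) \<longleftrightarrow> \<alpha> < t \<and> t < \<beta>"
proof
  assume "x + t *\<^sub>R w \<in> open_segment (x + \<alpha> *\<^sub>R w) (x + \<beta> *\<^sub>R w)"
  then obtain u where u: "0 < u" "u < 1" "x + t *\<^sub>R w = (1 - u) *\<^sub>R (x + \<alpha> *\<^sub>R w) + u *\<^sub>R (x + \<beta> *\<^sub>R w)"
    unfolding in_segment by blast
  have "x + t *\<^sub>R w = x + (\<alpha> + u * (\<beta> - \<alpha>)) *\<^sub>R w" unfolding u(3) by (simp add: algebra_simps)
  then have "t = \<alpha> + u * (\<beta> - \<alpha>)" using assms(1) by simp
  moreover have "0 < u * (\<beta> - \<alpha>)" "0 < (1 - u) * (\<beta> - \<alpha>)"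
    using u assms(2) by auto
  ultimately show "\<alpha> < t \<and> t < \<beta>" by (simp add: algebra_simps)
next
  assume t: "\<alpha> < t \<and> t < \<beta>"
  define u where "u = (t - \<alpha>) / (\<beta> - \<alpha>)"
  have u: "0 < u" "u < 1" "t = \<alpha> + u * (\<beta> - \<alpha>)" unfolding u_def using t assms(2) by auto
  have "x + t *\<^sub>R w = (1 - u) *\<^sub>R (x + \<alpha> *\<^sub>R w) + u *\<^sub>R (x + \<beta> *\<^sub>R w)"
    unfolding u(3) by (simp add: algebra_simps)
  then show "x + t *\<^sub>R w \<in> open_segment (x + \<alpha> *\<^sub>R w) (x + \<beta> *\<^sub>R w)"
    unfolding in_segment using u assms by auto
qed

text \<open>
  Edges through a common inner point have the same direction there, and neither can end inside the
  other, since inner points of edges are not vertices.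
\<close>

lemma edges_eq_if_meet:
  assumes P: "plane_bounded P" and E: "E = closed_segment a b" "a \<in> vertices P" "b \<in> vertices P"
      "open_segment a b \<subseteq> edge_points P"
    and F: "F = closed_segment a' b'" "a' \<in> vertices P" "b' \<in> vertices P"
      "open_segment a' b' \<subseteq> edge_points P"
    and x: "x \<in> open_segment a b" "x \<in> open_segment a' b'"
  shows "E = F"
proof -
  define w where "w = b - a"
  have w: "w \<noteq> 0" using x(1) unfolding w_def by auto
  have "a' \<noteq> b'" using x(2) by auto
  have "\<exists>k. b' - a' = k *\<^sub>R w"
  proof (rule parallel_if_approached_by_edge_points[OF P])
    show "translation_invariant_near P x w" unfolding w_def by (rule edge_points_direction[OF P E(4) x(1)])
    show "\<exists>s. 0 < s \<and> s < \<epsilon> \<and> x + s *\<^sub>R (b' - a') \<in> edge_points P" if "\<epsilon> > 0" for \<epsilon>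
      using open_segment_nearby[OF x(2) that] F(4) by blast
  qed (use w \<open>a' \<noteq> b'\<close> in auto)
  then obtain k where k: "b' - a' = k *\<^sub>R w" by blast
  have k0: "k \<noteq> 0" using k \<open>a' \<noteq> b'\<close> by auto
  have seg: "\<exists>u. 0 < u \<and> u < 1 \<and> p = x + (- u) *\<^sub>R (q - p) \<and> q = x + (1 - u) *\<^sub>R (q - p)"
    if pq: "x \<in> open_segment p q" for p q
  proof -
    obtain u where u: "0 < u" "u < 1" "x = (1 - u) *\<^sub>R p + u *\<^sub>R q" using pq unfolding in_segment by blast
    have "p = x + (- u) *\<^sub>R (q - p)" "q = x + (1 - u) *\<^sub>R (q - p)" unfolding u by (auto simp: algebra_simps)
    then show ?thesis using u by blast
  qed
  obtain u where u: "0 < u" "u < 1" "a = x + (- u) *\<^sub>R w" "b = x + (1 - u) *\<^sub>R w"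
    using seg[OF x(1)] unfolding w_def by blast
  obtain u' where u': "0 < u'" "u' < 1" "a' = x + (- u') *\<^sub>R (k *\<^sub>R w)" "b' = x + (1 - u') *\<^sub>R (k *\<^sub>R w)"
    using seg[OF x(2)] unfolding k by blast
  have main: "\<alpha> = - u \<and> \<beta> = 1 - u"
    if ab: "\<alpha> < 0" "0 < \<beta>" "x + \<alpha> *\<^sub>R w \<in> vertices P" "x + \<beta> *\<^sub>R w \<in> vertices P"
      "open_segment (x + \<alpha> *\<^sub>R w) (x + \<beta> *\<^sub>R w) \<subseteq> edge_points P" for \<alpha> \<beta>
  proof -
    have n1: "\<not> (- u < t \<and> t < 1 - u)" if "x + t *\<^sub>R w \<in> vertices P" for t
    proof
      assume "- u < t \<and> t < 1 - u"
      then have "x + t *\<^sub>R w \<in> open_segment a b"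
        unfolding u using open_segment_line_iff[OF w, of "- u" "1 - u" x t] by simp
      then show False using that E(4) vertices_Int_edge_points by blast
    qed
    have n2: "\<not> (\<alpha> < t \<and> t < \<beta>)" if "x + t *\<^sub>R w \<in> vertices P" for t
    proof
      assume "\<alpha> < t \<and> t < \<beta>"
      then have "x + t *\<^sub>R w \<in> open_segment (x + \<alpha> *\<^sub>R w) (x + \<beta> *\<^sub>R w)"
        using open_segment_line_iff[OF w, of \<alpha> \<beta> x t] ab by simp
      then show False using that ab(5) vertices_Int_edge_points by blast
    qed
    show ?thesis
      using n1[OF ab(3)] n1[OF ab(4)] n2[of "- u"] n2[of "1 - u"] E(2,3) ab(1,2) u by auto
  qed
  show ?thesis
  proof (cases "k > 0")
    case True
    have "- u' * k < 0" "0 < (1 - u') * k" using True u' by auto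
    moreover have e: "a' = x + (- u' * k) *\<^sub>R w" "b' = x + ((1 - u') * k) *\<^sub>R w" using u' by auto
    ultimately have "- u' * k = - u \<and> (1 - u') * k = 1 - u"
      using main[of "- u' * k" "(1 - u') * k"] F(2,3,4) by simp
    then have "a' = a" "b' = b" using e u by auto
    then show ?thesis using E F by simp
  next
    case False
    then have kn: "k < 0" using k0 by simp
    have "(1 - u') * k < 0" "0 < - u' * k" using kn u' by (auto simp: mult_less_0_iff)
    moreover have e: "a' = x + (- u' * k) *\<^sub>R w" "b' = x + ((1 - u') * k) *\<^sub>R w" using u' by auto
    moreover have "open_segment b' a' \<subseteq> edge_points P"
      using F(4) by (subst open_segment_commute)
    then have "open_segment (x + ((1 - u') * k) *\<^sub>R w) (x + (- u' * k) *\<^sub>R w) \<subseteq> edge_points P"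
      by (simp only: e)
    moreover have "x + ((1 - u') * k) *\<^sub>R w \<in> vertices P" "x + (- u' * k) *\<^sub>R w \<in> vertices P"
      using F(2,3) unfolding e by auto
    ultimately have "(1 - u') * k = - u \<and> - u' * k = 1 - u" by (intro main)
    then have "b' = a" "a' = b" using e u by auto
    then show ?thesis using E F by (simp add: closed_segment_commute)
  qed
qed

subsection \<open>Following an edge\<close>

lemma outward_normal_at_translation:
  "outward_normal_at ((+) a ` P) (a + x) n \<longleftrightarrow> outward_normal_at P x n"
proof -
  have imp: "outward_normal_at ((+) a ` P) (a + x) n" if o: "outward_normal_at P x n" for a x P
  proof -
    obtain r where r: "norm n = 1" "r > 0" "\<And>y. y \<in> ball x r \<Longrightarrow> y \<in> P \<longleftrightarrow> n \<bullet> (y - x) \<le> 0"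
      using o by (rule outward_normal_atE) blast
    show ?thesis
    proof (rule outward_normal_atI[OF r(1,2)])
      fix y assume "y \<in> ball (a + x) r"
      then have "y - a \<in> ball x r" by (simp add: dist_norm algebra_simps)
      then have "y - a \<in> P \<longleftrightarrow> n \<bullet> (y - a - x) \<le> 0" by (rule r(3))
      moreover have "y \<in> (+) a ` P \<longleftrightarrow> y - a \<in> P" by (auto intro!: image_eqI[of _ _ "y - a"])
      ultimately show "y \<in> (+) a ` P \<longleftrightarrow> n \<bullet> (y - (a + x)) \<le> 0" by (simp add: algebra_simps)
    qed
  qed
  show ?thesis
  proof
    assume "outward_normal_at ((+) a ` P) (a + x) n"
    from imp[OF this, of "-a"] show "outward_normal_at P x n" by (simp add: image_image)
  qed (rule imp)
qed

lemma translation_invariant_near_germ_along: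
  assumes "translation_invariant_near P x d"
  obtains r where "r > 0"
    "\<And>y s. y \<in> ball x r \<Longrightarrow> y + s *\<^sub>R d \<in> ball x r \<Longrightarrow>
      (y + s *\<^sub>R d \<in> face_points P \<longleftrightarrow> y \<in> face_points P) \<and>
      (y + s *\<^sub>R d \<in> frontier P \<longleftrightarrow> y \<in> frontier P)"
proof -
  obtain r where r: "r > 0" "\<And>y s. y \<in> ball x r \<Longrightarrow> y + s *\<^sub>R d \<in> ball x r \<Longrightarrow>
      (y + s *\<^sub>R d \<in> P \<longleftrightarrow> y \<in> P)"
    using translation_invariant_nearE[OF assms] by metis
  have "(y + s *\<^sub>R d \<in> face_points P \<longleftrightarrow> y \<in> face_points P) \<and>
      (y + s *\<^sub>R d \<in> frontier P \<longleftrightarrow> y \<in> frontier P)"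
    if y: "y \<in> ball x r" "y + s *\<^sub>R d \<in> ball x r" for y s
  proof -
    define \<delta> where "\<delta> = min (r - dist x y) (r - dist x (y + s *\<^sub>R d))"
    have d: "\<delta> > 0" "\<delta> \<le> r - dist x y" "\<delta> \<le> r - dist x (y + s *\<^sub>R d)" unfolding \<delta>_def using y by auto
    have "z \<in> (+) (s *\<^sub>R d) ` P \<longleftrightarrow> z \<in> P" if z: "z \<in> ball (y + s *\<^sub>R d) \<delta>" for z
    proof -
      have "dist y (z - s *\<^sub>R d) < \<delta>" using z by (simp add: dist_norm algebra_simps)
      then have 1: "z - s *\<^sub>R d \<in> ball x r" using dist_triangle[of x "z - s *\<^sub>R d" y] d by simp
      have 2: "z \<in> ball x r" using dist_triangle[of x z "y + s *\<^sub>R d"] d z by simp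
      have "z \<in> (+) (s *\<^sub>R d) ` P \<longleftrightarrow> z - s *\<^sub>R d \<in> P"
        by (auto intro!: image_eqI[of _ _ "z - s *\<^sub>R d"])
      also have "\<dots> \<longleftrightarrow> z \<in> P" using r(2)[OF 1, of s] 2 by simp
      finally show ?thesis .
    qed
    then have g: "(+) (s *\<^sub>R d) ` P \<inter> ball (y + s *\<^sub>R d) \<delta> = P \<inter> ball (y + s *\<^sub>R d) \<delta>" by blast
    have 1: "y + s *\<^sub>R d \<in> face_points P \<longleftrightarrow> y \<in> face_points P"
    proof -
      have "y + s *\<^sub>R d \<in> face_points P \<longleftrightarrow> s *\<^sub>R d + y \<in> face_points ((+) (s *\<^sub>R d) ` P)"
        using face_points_germ[OF g d(1)] by (simp add: add.commute)
      also have "\<dots> \<longleftrightarrow> y \<in> face_points P"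
        using outward_normal_at_translation[of "s *\<^sub>R d" P y] unfolding face_points_def by blast
      finally show ?thesis .
    qed
    have 2: "y + s *\<^sub>R d \<in> frontier P \<longleftrightarrow> y \<in> frontier P"
    proof -
      have "y + s *\<^sub>R d \<in> frontier P \<longleftrightarrow> s *\<^sub>R d + y \<in> frontier ((+) (s *\<^sub>R d) ` P)"
        using frontier_germ[OF g d(1)] by (simp add: add.commute)
      also have "\<dots> \<longleftrightarrow> y \<in> frontier P" by (auto simp: frontier_translation)
      finally show ?thesis .
    qed
    show ?thesis using 1 2 by blast
  qed
  then show ?thesis using that[OF r(1)] by blast
qed

text \<open>
  The edge points on a ray can only stop at a vertex: at an edge point they would go on, and near a
  face point there are none.
\<close>

lemma edge_along_ray:
  assumes P: "plane_bounded P" and v: "v \<noteq> 0" and s0: "s0 > 0"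
    and e: "\<And>s. 0 < s \<Longrightarrow> s < s0 \<Longrightarrow> H + s *\<^sub>R v \<in> edge_points P"
  obtains k where "k > 0" "H + k *\<^sub>R v \<in> vertices P" "open_segment H (H + k *\<^sub>R v) \<subseteq> edge_points P"
proof -
  define T where "T = {s. 0 < s \<and> H + s *\<^sub>R v \<notin> edge_points P}"
  have "bounded (frontier P)"
    using compact_frontier[OF plane_boundedD(1)[OF P]] by (rule compact_imp_bounded)
  then obtain M where M: "M > 0" "\<And>x. x \<in> frontier P \<Longrightarrow> norm x \<le> M" using bounded_pos by metis
  have "(M + norm H + 1) / norm v \<in> T"
  proof -
    have pos: "(M + norm H + 1) / norm v > 0" using M v by (simp add: add_pos_nonneg)
    have "norm (((M + norm H + 1) / norm v) *\<^sub>R v) = M + norm H + 1" using M v by (simp add: add_nonneg_nonneg)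
    then have "norm (H + ((M + norm H + 1) / norm v) *\<^sub>R v) \<ge> M + 1"
      using norm_triangle_ineq4[of "H + ((M + norm H + 1) / norm v) *\<^sub>R v" H] by simp
    then have "H + ((M + norm H + 1) / norm v) *\<^sub>R v \<notin> frontier P" using M(2) by (meson not_less_eq_eq add_increasing2 leD less_add_one order_less_le_trans)
    then show ?thesis using pos edge_points_subset_frontier unfolding T_def by blast
  qed
  then have Tne: "T \<noteq> {}" by blast
  have Tlb: "s0 \<le> s" if "s \<in> T" for s using that e[of s] unfolding T_def by force
  then have Tbdd: "bdd_below T" by (meson bdd_belowI)
  define k where "k = Inf T"
  have ks0: "s0 \<le> k" unfolding k_def by (rule cInf_greatest[OF Tne Tlb])
  have k: "k > 0" using ks0 s0 by simp
  have below: "H + s *\<^sub>R v \<in> edge_points P" if "0 < s" "s < k" for s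
    using that cInf_lower[OF _ Tbdd, of s] unfolding k_def T_def by force
  define b where "b = H + k *\<^sub>R v"
  have bk: "b + s *\<^sub>R (- v) \<in> edge_points P" if "0 < s" "s < k" for s
  proof -
    have "b + s *\<^sub>R (- v) = H + (k - s) *\<^sub>R v" unfolding b_def by (simp add: algebra_simps)
    then show ?thesis using below[of "k - s"] that by simp
  qed
  have near: "\<exists>y\<in>edge_points P. y \<in> ball b \<epsilon>" if "\<epsilon> > 0" for \<epsilon>
  proof -
    define s where "s = min k (\<epsilon> / norm v) / 2"
    have "0 < s" "s < k" "s < \<epsilon> / norm v" unfolding s_def using k that v by (auto simp: min_def field_simps)
    then have "norm (s *\<^sub>R (- v)) < \<epsilon>" using v by (simp add: pos_less_divide_eq)
    then show ?thesis using bk[OF \<open>0 < s\<close> \<open>s < k\<close>] add_in_ball_iff by blast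
  qed
  have bf: "b \<in> frontier P"
  proof -
    have "b \<in> closure (frontier P)" unfolding closure_approachable
    proof (intro allI impI)
      fix \<epsilon> :: real assume "\<epsilon> > 0"
      then obtain y where "y \<in> edge_points P" "y \<in> ball b \<epsilon>" using near by blast
      then show "\<exists>y\<in>frontier P. dist y b < \<epsilon>"
        using edge_points_subset_frontier by (intro bexI[of _ y]) (auto simp: dist_commute)
    qed
    then show ?thesis by simp
  qed
  have bnface: "b \<notin> face_points P"
  proof
    assume "b \<in> face_points P"
    then obtain \<epsilon> where "\<epsilon> > 0" "\<forall>y\<in>ball b \<epsilon>. y \<in> frontier P \<longrightarrow> y \<in> face_points P"
      using frontier_near_face_point by blast
    moreover obtain y where "y \<in> edge_points P" "y \<in> ball b \<epsilon>" using near[OF \<open>\<epsilon> > 0\<close>] by blast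
    ultimately show False using edge_points_iff[of y P] by blast
  qed
  have bnedge: "b \<notin> edge_points P"
  proof
    assume "b \<in> edge_points P"
    then obtain d where d: "d \<noteq> 0" "translation_invariant_near P b d" unfolding edge_points_iff by blast
    have "\<exists>\<kappa>. - v = \<kappa> *\<^sub>R d"
    proof (rule parallel_if_approached_by_edge_points[OF P d(2,1)])
      fix \<epsilon> :: real assume "\<epsilon> > 0"
      then have "0 < min \<epsilon> k / 2" "min \<epsilon> k / 2 < \<epsilon>" "min \<epsilon> k / 2 < k" using k by auto
      then show "\<exists>s>0. s < \<epsilon> \<and> b + s *\<^sub>R (- v) \<in> edge_points P" using bk by blast
    qed (use v in simp)
    then obtain \<kappa> where kap: "- v = \<kappa> *\<^sub>R d" by blast
    have "v = (- \<kappa>) *\<^sub>R d + 0 *\<^sub>R d" using kap[symmetric] by simp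
    then have tv: "translation_invariant_near P b v"
      using translation_invariant_near_combination[OF d(2,2), of "- \<kappa>" 0] by simp
    obtain r1 where r1: "r1 > 0" "\<And>y s. y \<in> ball b r1 \<Longrightarrow> y + s *\<^sub>R v \<in> ball b r1 \<Longrightarrow>
      (y + s *\<^sub>R v \<in> face_points P \<longleftrightarrow> y \<in> face_points P) \<and>
      (y + s *\<^sub>R v \<in> frontier P \<longleftrightarrow> y \<in> frontier P)"
      using translation_invariant_near_germ_along[OF tv] by metis
    obtain r2 where r2: "r2 > 0" "\<forall>y\<in>ball b r2. translation_invariant_near P y v"
      using translation_invariant_near_nearby[OF tv] by blast
    have "min r1 r2 / norm v > 0" using r1 r2 v by simp
    then obtain s where s: "s \<in> T" "s < k + min r1 r2 / norm v"
      using cInf_lessD[OF Tne, of "k + min r1 r2 / norm v"] unfolding k_def by auto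
    have sk: "k \<le> s" unfolding k_def by (rule cInf_lower[OF s(1) Tbdd])
    have "(s - k) * norm v < min r1 r2"
      using s(2) v pos_less_divide_eq[of "norm v" "s - k" "min r1 r2"] by simp
    then have "norm ((s - k) *\<^sub>R v) < min r1 r2" using sk unfolding norm_scaleR by simp
    then have y: "b + (s - k) *\<^sub>R v \<in> ball b r1" "b + (s - k) *\<^sub>R v \<in> ball b r2"
      unfolding add_in_ball_iff by auto
    have "b + (s - k) *\<^sub>R v \<in> edge_points P"
      unfolding edge_points_iff using r1(2)[of b "s - k"] r1(1) y r2(2) bf bnface v by auto
    moreover have "b + (s - k) *\<^sub>R v = H + s *\<^sub>R v" unfolding b_def by (simp add: algebra_simps)
    ultimately show False using s(1) unfolding T_def by simp
  qed
  have "b \<in> vertices P" using bf bnface bnedge unfolding vertices_def by blast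
  moreover have "open_segment H b \<subseteq> edge_points P"
  proof
    fix x assume "x \<in> open_segment H b"
    then obtain u where u: "0 < u" "u < 1" "x = (1 - u) *\<^sub>R H + u *\<^sub>R b" unfolding in_segment by blast
    have "x = H + (u * k) *\<^sub>R v" unfolding u b_def by (simp add: algebra_simps)
    then show "x \<in> edge_points P" using below[of "u * k"] u k by simp
  qed
  ultimately show ?thesis using that[OF k] unfolding b_def by blast
qed

text \<open>
  Translating along the edge moves nearby points of the face within the face, so the points of the edge
  that belong to the face form a relatively open set.
\<close>

lemma face_contains_edge:
  assumes P: "plane_bounded P" and C: "C \<in> components (face_points P)"
    and E: "open_segment a b \<subseteq> edge_points P" "x \<in> open_segment a b" "x \<in> closure C"
  shows "closed_segment a b \<subseteq> closure C"
proof -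
  have ab: "a \<noteq> b" using E(2) by auto
  have "open_segment a b \<inter> closure C = {} \<or> open_segment a b \<inter> closure C = open_segment a b"
  proof (rule connected_clopen[THEN iffD1, rule_format])
    show "connected (open_segment a b)" by (rule convex_connected[OF convex_open_segment])
    show "openin (top_of_set (open_segment a b)) (open_segment a b \<inter> closure C) \<and>
            closedin (top_of_set (open_segment a b)) (open_segment a b \<inter> closure C)"
    proof
      show "openin (top_of_set (open_segment a b)) (open_segment a b \<inter> closure C)"
        unfolding openin_contains_ball
      proof (intro conjI ballI)
        fix y assume y: "y \<in> open_segment a b \<inter> closure C"
        then have y1: "y \<in> open_segment a b" by blast
        have "translation_invariant_near P y (b - a)" by (rule edge_points_direction[OF P E(1) y1])
        then obtain r where r: "r > 0" "\<And>z s. z \<in> ball y r \<Longrightarrow> z + s *\<^sub>R (b - a) \<in> ball y r \<Longrightarrow>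
          (z + s *\<^sub>R (b - a) \<in> face_points P \<longleftrightarrow> z \<in> face_points P)"
          using translation_invariant_near_germ_along by metis
        have "y' \<in> closure C" if y': "y' \<in> ball y r" "y' \<in> open_segment a b" for y'
        proof -
          obtain u where u: "y = (1 - u) *\<^sub>R a + u *\<^sub>R b" using y1 unfolding in_segment by blast
          obtain u' where u': "y' = (1 - u') *\<^sub>R a + u' *\<^sub>R b" using y' unfolding in_segment by blast
          define \<sigma> where "\<sigma> = u' - u"
          have y'eq: "y' = y + \<sigma> *\<^sub>R (b - a)" unfolding u u' \<sigma>_def by (simp add: algebra_simps)
          show ?thesis unfolding closure_approachable
          proof (intro allI impI)
            fix \<epsilon> :: real assume eps: "\<epsilon> > 0"
            have "min \<epsilon> (r - dist y y') > 0" using eps y' by simp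
            then obtain z where z: "z \<in> C" "dist z y < min \<epsilon> (r - dist y y')"
              using y closure_approachable by blast
            have zb: "z \<in> ball y r" using z(2) zero_le_dist[of y y'] unfolding mem_ball dist_commute[of y z] by linarith
            have dz: "dist (z + \<sigma> *\<^sub>R (b - a)) y' = dist z y" unfolding y'eq by (simp add: dist_norm)
            have zb': "z + \<sigma> *\<^sub>R (b - a) \<in> ball y r"
              using dist_triangle[of y "z + \<sigma> *\<^sub>R (b - a)" y'] dz z(2) by (simp add: dist_commute)
            define S where "S = closed_segment z (z + \<sigma> *\<^sub>R (b - a))"
            have SB: "S \<subseteq> ball y r" unfolding S_def using zb zb' by (intro closed_segment_subset) auto
            have "S \<subseteq> face_points P"
            proof
              fix p assume p: "p \<in> S"
              then obtain \<tau> where "p = (1 - \<tau>) *\<^sub>R z + \<tau> *\<^sub>R (z + \<sigma> *\<^sub>R (b - a))" unfolding S_def in_segment by blast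
              then have pe: "p = z + (\<tau> * \<sigma>) *\<^sub>R (b - a)" by (simp add: algebra_simps)
              have "z \<in> face_points P" using z(1) in_components_subset[OF C] by blast
              then show "p \<in> face_points P" using r(2)[OF zb, of "\<tau> * \<sigma>"] SB p unfolding pe by blast
            qed
            moreover have "connected S" "z \<in> S" unfolding S_def by auto
            ultimately have "S \<subseteq> C" using components_maximal[OF C, of S] z(1) by blast
            then have "z + \<sigma> *\<^sub>R (b - a) \<in> C" unfolding S_def by auto
            then show "\<exists>q\<in>C. dist q y' < \<epsilon>" using dz z(2) by (intro bexI[of _ "z + \<sigma> *\<^sub>R (b - a)"]) auto
          qed
        qed
        then have "ball y r \<inter> open_segment a b \<subseteq> open_segment a b \<inter> closure C" by blast
        then show "\<exists>e>0. ball y e \<inter> open_segment a b \<subseteq> open_segment a b \<inter> closure C" using r(1) by blast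
      qed blast
      show "closedin (top_of_set (open_segment a b)) (open_segment a b \<inter> closure C)"
        by (intro closedin_closed_Int) auto
    qed
  qed
  then have "open_segment a b \<subseteq> closure C" using E by blast
  then have "closure (open_segment a b) \<subseteq> closure C" by (rule closure_minimal) simp
  then show ?thesis using ab by (simp add: closure_open_segment)
qed

lemma face_component_closure_plane:
  assumes "\<And>y. y \<in> C \<Longrightarrow> n \<bullet> y = b" "x \<in> closure C"
  shows "n \<bullet> x = b"
proof -
  have "closure C \<subseteq> {y. n \<bullet> y = b}" by (intro closure_minimal closed_hyperplane) (use assms in auto)
  then show ?thesis using assms(2) by blast
qed

text \<open>If all faces at a boundary point had parallel normals, the boundary would be flat there.\<close>

lemma two_faces_at_edge_point:
  assumes P: "plane_bounded P" and x: "x \<in> edge_points P"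
  obtains C1 C2 n1 n2 where
    "C1 \<in> components (face_points P)" "C2 \<in> components (face_points P)"
    "x \<in> closure C1" "x \<in> closure C2"
    "\<And>y. y \<in> C1 \<Longrightarrow> outward_normal_at P y n1" "\<And>y. y \<in> C2 \<Longrightarrow> outward_normal_at P y n2"
    "n1 \<noteq> n2" "n1 \<noteq> - n2"
proof -
  have xf: "x \<in> frontier P" "x \<notin> face_points P" using x unfolding edge_points_iff by auto
  define \<C> where "\<C> = components (face_points P)"
  have fin: "finite \<C>" unfolding \<C>_def by (rule plane_bounded_cells(1)[OF P])
  define U where "U = - \<Union>(closure ` {C \<in> \<C>. x \<notin> closure C})"
  have "open U" unfolding U_def by (intro open_Compl closed_Union) (use fin in auto)
  moreover have "x \<in> U" unfolding U_def by blast
  ultimately obtain r where r: "r > 0" "ball x r \<subseteq> U" by (meson openE)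
  have near: "\<exists>C\<in>\<C>. y \<in> C \<and> x \<in> closure C" if y: "y \<in> face_points P" "y \<in> ball x r" for y
  proof -
    obtain C where C: "C \<in> \<C>" "y \<in> C" using y(1) Union_components[of "face_points P"] unfolding \<C>_def by blast
    then have "x \<in> closure C" using r(2) y(2) closure_subset[of C] unfolding U_def by blast
    then show ?thesis using C by blast
  qed
  have "x \<in> closure (face_points P)" using frontier_subset_closure_face_points[OF P] xf(1) by blast
  then obtain y where y: "y \<in> face_points P" "dist y x < r" using r(1) closure_approachable by blast
  then obtain C1 where C1: "C1 \<in> \<C>" "y \<in> C1" "x \<in> closure C1" using near[of y] by (auto simp: dist_commute)
  obtain n1 b1 where n1: "norm n1 = 1" "\<And>z. z \<in> C1 \<Longrightarrow> outward_normal_at P z n1" "\<And>z. z \<in> C1 \<Longrightarrow> n1 \<bullet> z = b1"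
    by (rule face_component_normal[OF C1(1)[unfolded \<C>_def]]) (rule that)
  have "\<exists>C2 n2. C2 \<in> \<C> \<and> x \<in> closure C2 \<and> (\<forall>z\<in>C2. outward_normal_at P z n2) \<and> n1 \<noteq> n2 \<and> n1 \<noteq> - n2"
  proof (rule ccontr)
    assume no: "\<not> ?thesis"
    have flat: "n1 \<bullet> (z - x) = 0" if z: "z \<in> face_points P" "z \<in> ball x r" for z
    proof -
      obtain C where C: "C \<in> \<C>" "z \<in> C" "x \<in> closure C" using near[OF z] by blast
      obtain n b where nn: "norm n = 1" and n: "\<And>z. z \<in> C \<Longrightarrow> outward_normal_at P z n"
        "\<And>z. z \<in> C \<Longrightarrow> n \<bullet> z = b"
        by (rule face_component_normal[OF C(1)[unfolded \<C>_def]]) (rule that)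
      have "n \<bullet> x = b" by (rule face_component_closure_plane[OF n(2) C(3)])
      then have "n \<bullet> (z - x) = 0" using n(2)[OF C(2)] by (simp add: inner_diff_right)
      moreover have "n1 = n \<or> n1 = - n"
      proof (rule ccontr)
        assume "\<not> (n1 = n \<or> n1 = - n)"
        then have "C \<in> \<C> \<and> x \<in> closure C \<and> (\<forall>z\<in>C. outward_normal_at P z n) \<and> n1 \<noteq> n \<and> n1 \<noteq> - n"
          using C n(1) by simp
        then show False using no by (elim notE) (intro exI)
      qed
      ultimately show ?thesis by auto
    qed
    have "outward_normal_at P x n1 \<or> outward_normal_at P x (- n1)"
    proof (rule face_point_if_frontier_in_plane[OF plane_boundedD(2,3)[OF P] xf(1) n1(1) r(1)])
      fix z assume z: "z \<in> frontier P" "z \<in> ball x r"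
      have "z \<in> closure (face_points P)" using frontier_subset_closure_face_points[OF P] z by blast
      then have "z \<in> closure (ball x r \<inter> face_points P)"
        using open_Int_closure_subset[OF open_ball] z(2) by blast
      then show "n1 \<bullet> (z - x) = 0"
        using face_component_closure_plane[of "ball x r \<inter> face_points P" n1 "n1 \<bullet> x" z] flat
        by (simp add: inner_diff_right)
    qed
    then show False using xf(2) unfolding face_points_def by blast
  qed
  then obtain C2 n2 where "C2 \<in> \<C>" "x \<in> closure C2" "\<And>z. z \<in> C2 \<Longrightarrow> outward_normal_at P z n2"
    "n1 \<noteq> n2" "n1 \<noteq> - n2" by blast
  then show ?thesis using that[of C1 C2 n1 n2] C1 n1(2) unfolding \<C>_def by blast
qed

section \<open>The tangent cone at an exposed vertex\<close>

locale convex_corner =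
  fixes P :: "(real^3) set" and H :: "real^3" and r :: real
  assumes plane_bounded: "plane_bounded P"
    and vertex: "H \<in> vertices P"
    and radius: "r > 0"
    and conical: "conical_near P H r"
    and convex_near: "convex (P \<inter> ball H r)"
begin

text \<open>
  By conicality any sufficiently small \<open>s\<close> decides whether \<open>k\<close> belongs to the cone.
\<close>

definition tangent_cone :: "(real^3) set" where
  "tangent_cone = {k. \<exists>s>0. s * norm k < r \<and> H + s *\<^sub>R k \<in> P}"

lemma frontier_subset_P: "frontier P \<subseteq> P"
  by (rule frontier_subset_closed[OF plane_boundedD(2)[OF plane_bounded]])

lemma H_in_P: "H \<in> P" and H_not_interior: "H \<notin> interior P"
  using vertex vertices_subset_frontier[of P] frontier_subset_P by (auto simp: frontier_def)

lemma tangent_cone_iff: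
  assumes "0 < s" "s * norm k < r"
  shows "k \<in> tangent_cone \<longleftrightarrow> H + s *\<^sub>R k \<in> P"
proof
  assume "k \<in> tangent_cone"
  then obtain s' where s': "s' > 0" "s' * norm k < r" "H + s' *\<^sub>R k \<in> P" unfolding tangent_cone_def by blast
  have e: "H + (s / s') *\<^sub>R (H + s' *\<^sub>R k - H) = H + s *\<^sub>R k" using s' by simp
  have "H + (s / s') *\<^sub>R (H + s' *\<^sub>R k - H) \<in> P \<longleftrightarrow> H + s' *\<^sub>R k \<in> P"
    by (rule conical_near_iff[OF conical]) (use s' assms in \<open>simp_all add: e add_in_ball_iff del: mem_ball\<close>)
  then show "H + s *\<^sub>R k \<in> P" using s'(3) unfolding e by simp
qed (use assms in \<open>auto simp: tangent_cone_def\<close>)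

lemma in_P_iff_tangent_cone: "y \<in> ball H r \<Longrightarrow> y \<in> P \<longleftrightarrow> y - H \<in> tangent_cone"
  using tangent_cone_iff[of 1 "y - H"] by (simp add: dist_norm norm_minus_commute)

lemma tangent_cone_zero: "0 \<in> tangent_cone"
  using H_in_P radius unfolding tangent_cone_def by (auto intro!: exI[of _ 1])

lemma common_scale:
  fixes k l :: "real^3"
  obtains s where "s > 0" "s * norm k < r" "s * norm l < r"
proof -
  define s where "s = r / (1 + norm k + norm l)"
  have pos: "1 + norm k + norm l > 0" by (simp add: add_pos_nonneg)
  then have "s > 0" unfolding s_def using radius by simp
  moreover have "s * (1 + norm k + norm l) = r" unfolding s_def using pos by simp
  then have "s + s * norm k + s * norm l = r" by (simp add: algebra_simps)
  moreover have "s * norm k \<ge> 0" "s * norm l \<ge> 0" using \<open>s > 0\<close> by auto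
  ultimately have "s * norm k < r" "s * norm l < r" by linarith+
  then show ?thesis using that \<open>s > 0\<close> by blast
qed

lemma tangent_cone_scale:
  assumes "k \<in> tangent_cone" "\<mu> \<ge> 0"
  shows "\<mu> *\<^sub>R k \<in> tangent_cone"
proof (cases "\<mu> = 0")
  case False
  then have m: "\<mu> > 0" using assms by simp
  obtain s where s: "s > 0" "s * norm (\<mu> *\<^sub>R k) < r" using common_scale by metis
  have "(s * \<mu>) * norm k < r" "s * \<mu> > 0" using s m by auto
  then have "H + (s * \<mu>) *\<^sub>R k \<in> P" using tangent_cone_iff assms(1) by blast
  then show ?thesis using tangent_cone_iff[OF s] by simp
qed (use tangent_cone_zero in simp)

lemma tangent_cone_add:
  assumes "k \<in> tangent_cone" "l \<in> tangent_cone"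
  shows "k + l \<in> tangent_cone"
proof -
  obtain s where s: "s > 0" "s * norm k < r" "s * norm l < r" using common_scale by blast
  have "H + s *\<^sub>R k \<in> P \<inter> ball H r" "H + s *\<^sub>R l \<in> P \<inter> ball H r"
    using tangent_cone_iff[OF s(1,2)] tangent_cone_iff[OF s(1,3)] assms s
    by (auto simp: add_in_ball_iff simp del: mem_ball)
  then have "(1/2) *\<^sub>R (H + s *\<^sub>R k) + (1/2) *\<^sub>R (H + s *\<^sub>R l) \<in> P \<inter> ball H r"
    using convexD[OF convex_near, of "H + s *\<^sub>R k" "H + s *\<^sub>R l" "1/2" "1/2"] by simp
  moreover have "(1/2) *\<^sub>R (H + s *\<^sub>R k) + (1/2) *\<^sub>R (H + s *\<^sub>R l) = H + (s/2) *\<^sub>R (k + l)"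
  proof -
    have "(1/2) *\<^sub>R H + (1/2) *\<^sub>R H = H" by (simp flip: scaleR_add_left)
    then have "H + (s/2) *\<^sub>R (k + l) = (1/2) *\<^sub>R H + (1/2) *\<^sub>R H + (s/2) *\<^sub>R (k + l)" by simp
    then show ?thesis by (simp add: scaleR_add_right)
  qed
  ultimately have m: "H + (s/2) *\<^sub>R (k + l) \<in> P \<inter> ball H r" by simp
  then have "norm ((s/2) *\<^sub>R (k + l)) < r" using add_in_ball_iff by blast
  then show ?thesis using tangent_cone_iff[of "s/2" "k + l"] m s(1) by simp
qed

lemma convex_tangent_cone: "convex tangent_cone"
  unfolding convex_def using tangent_cone_add tangent_cone_scale by auto

lemma closed_tangent_cone: "closed tangent_cone"
proof -
  have "k \<in> tangent_cone" if k: "k \<in> closure tangent_cone" for k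
  proof -
    define s where "s = r / (2 + norm k)"
    have pos: "2 + norm k > 0" by (simp add: add_pos_nonneg)
    then have s: "s > 0" "s * (2 + norm k) = r" unfolding s_def using radius by auto
    have lt: "s * norm l < r" if "dist l k < 1" for l
    proof -
      have "norm l < 1 + norm k" using that norm_triangle_ineq2[of l k] by (simp add: dist_norm)
      then have "s * norm l < s * (2 + norm k)" using s(1) by (intro mult_strict_left_mono) auto
      then show ?thesis using s by simp
    qed
    have "H + s *\<^sub>R k \<in> closure P" unfolding closure_approachable
    proof (intro allI impI)
      fix e :: real assume e: "e > 0"
      then have "min 1 (e / s) > 0" using s by simp
      then obtain l where l: "l \<in> tangent_cone" "dist l k < min 1 (e / s)" using k closure_approachable by blast
      have "H + s *\<^sub>R l \<in> P" using tangent_cone_iff[OF s(1) lt[of l]] l by simp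
      moreover have "dist (H + s *\<^sub>R l) (H + s *\<^sub>R k) = s * dist l k"
        using s(1) by (simp add: dist_norm flip: scaleR_diff_right)
      moreover have "s * dist l k < e" using l(2) s(1) by (simp add: pos_less_divide_eq mult.commute)
      ultimately show "\<exists>y\<in>P. dist y (H + s *\<^sub>R k) < e" by (intro bexI[of _ "H + s *\<^sub>R l"]) auto
    qed
    then have "H + s *\<^sub>R k \<in> P" using plane_boundedD(2)[OF plane_bounded] by simp
    then show ?thesis using tangent_cone_iff[OF s(1) lt[of k]] by simp
  qed
  then show ?thesis using closure_subset_eq by blast
qed

text \<open>A line in the tangent cone would make the solid invariant along it near the vertex.\<close>

lemma tangent_cone_pointed:
  assumes "k \<in> tangent_cone" "- k \<in> tangent_cone"
  shows "k = 0"
proof -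
  have "translation_invariant_near P H k"
  proof (rule translation_invariant_nearI[OF radius])
    fix y s assume y: "y \<in> ball H r" "y + s *\<^sub>R k \<in> ball H r" "y \<in> P"
    have "s *\<^sub>R k \<in> tangent_cone"
      using tangent_cone_scale[OF assms(1), of s] tangent_cone_scale[OF assms(2), of "- s"]
      by (cases "s \<ge> 0") auto
    then have "(y - H) + s *\<^sub>R k \<in> tangent_cone" using in_P_iff_tangent_cone y tangent_cone_add by blast
    then show "y + s *\<^sub>R k \<in> P" using in_P_iff_tangent_cone[OF y(2)] by (simp add: algebra_simps)
  qed
  then show ?thesis using vertices_not_invariant[OF vertex] by blast
qed

lemma tangent_cone_interior:
  obtains k \<epsilon> where "\<epsilon> > 0" "ball k \<epsilon> \<subseteq> tangent_cone"
proof -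
  have "H \<in> closure (interior P)" using H_in_P plane_boundedD(3)[OF plane_bounded] by simp
  then obtain y where y: "y \<in> interior P" "dist y H < r" using radius closure_approachable by blast
  have "open (interior P \<inter> ball H r)" by auto
  moreover have "y \<in> interior P \<inter> ball H r" using y by (simp add: dist_commute)
  ultimately obtain \<epsilon> where e: "\<epsilon> > 0" "ball y \<epsilon> \<subseteq> interior P \<inter> ball H r" by (meson openE)
  have "ball (y - H) \<epsilon> \<subseteq> tangent_cone"
  proof
    fix k assume "k \<in> ball (y - H) \<epsilon>"
    then have "H + k \<in> ball y \<epsilon>" by (simp add: dist_norm algebra_simps)
    then have "H + k \<in> P" "H + k \<in> ball H r" using e interior_subset by blast+
    then show "k \<in> tangent_cone" using in_P_iff_tangent_cone[of "H + k"] by simp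
  qed
  then show ?thesis using that e by blast
qed

text \<open>
  Since the cone is pointed, it remains convex without its apex. So the convex hull of its unit vectors
  does not contain \<open>0\<close> and is separated from it by a plane.
\<close>

lemma tangent_cone_supporting_direction:
  obtains c m where "m > 0" "\<And>k. k \<in> tangent_cone \<Longrightarrow> c \<bullet> k \<le> - m * norm k"
proof -
  define S where "S = convex hull (tangent_cone \<inter> sphere 0 1)"
  have "compact (tangent_cone \<inter> sphere 0 1)"
    using closed_tangent_cone by (simp add: closed_Int_compact)
  then have "compact S" unfolding S_def by (rule compact_convex_hull)
  have cv: "convex (tangent_cone - {0})"
    unfolding convex_alt
  proof (intro ballI allI impI)
    fix x y and u :: real assume xy: "x \<in> tangent_cone - {0}" "y \<in> tangent_cone - {0}" and u: "0 \<le> u \<and> u \<le> 1"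
    have px: "(1 - u) *\<^sub>R x \<in> tangent_cone" and py: "u *\<^sub>R y \<in> tangent_cone"
      using xy u tangent_cone_scale by auto
    have "(1 - u) *\<^sub>R x + u *\<^sub>R y \<noteq> 0"
    proof
      assume z: "(1 - u) *\<^sub>R x + u *\<^sub>R y = 0"
      then have "- ((1 - u) *\<^sub>R x) = u *\<^sub>R y" by (simp add: add_eq_0_iff)
      then have 1: "(1 - u) *\<^sub>R x = 0" using tangent_cone_pointed[OF px] py by simp
      have "u *\<^sub>R y = 0" using z unfolding 1 by simp
      then show False using 1 xy by auto
    qed
    then show "(1 - u) *\<^sub>R x + u *\<^sub>R y \<in> tangent_cone - {0}" using tangent_cone_add px py by blast
  qed
  have "S \<subseteq> tangent_cone - {0}" unfolding S_def by (rule hull_minimal) (use cv in auto)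
  then have "0 \<notin> S" by blast
  moreover have "convex S" unfolding S_def by simp
  ultimately obtain a b where ab: "0 < b" "\<And>x. x \<in> S \<Longrightarrow> a \<bullet> x > b"
    using separating_hyperplane_closed_0[OF _ compact_imp_closed[OF \<open>compact S\<close>]] by blast
  have "(- a) \<bullet> k \<le> - b * norm k" if k: "k \<in> tangent_cone" for k
  proof (cases "k = 0")
    case False
    define u where "u = (1 / norm k) *\<^sub>R k"
    have "u \<in> tangent_cone \<inter> sphere 0 1" using tangent_cone_scale[OF k, of "1 / norm k"] False unfolding u_def by simp
    then have "u \<in> S" unfolding S_def by (rule hull_inc)
    then have "a \<bullet> u > b" by (rule ab(2))
    then have "norm k * (a \<bullet> u) \<ge> norm k * b" by (intro mult_left_mono) auto
    moreover have "norm k * (a \<bullet> u) = a \<bullet> k" using False unfolding u_def by simp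
    ultimately show ?thesis by (simp add: mult.commute)
  qed simp
  then show ?thesis using that ab(1) by blast
qed

text \<open>
  Extremality of the ray through \<open>v\<close>, stated without reference to a section of the cone.
\<close>

definition extreme_direction :: "real^3 \<Rightarrow> bool" where
  "extreme_direction v \<longleftrightarrow> v \<noteq> 0 \<and> v \<in> tangent_cone \<and>
     (\<forall>k\<in>tangent_cone. \<forall>l\<in>tangent_cone. \<forall>s. k + l = s *\<^sub>R v \<longrightarrow> (\<exists>\<kappa>. k = \<kappa> *\<^sub>R v))"

text \<open>
  A bounded section of the cone is the convex hull of its extreme points, and these cannot all
  coincide because the cone has interior points.
\<close>

lemma two_extreme_directions:
  obtains v w where "extreme_direction v" "extreme_direction w" "\<And>\<kappa>. w \<noteq> \<kappa> *\<^sub>R v"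
proof -
  obtain c m where cm: "m > 0" "\<And>k. k \<in> tangent_cone \<Longrightarrow> c \<bullet> k \<le> - m * norm k"
    by (rule tangent_cone_supporting_direction) (rule that)
  have neg: "c \<bullet> k < 0" if "k \<in> tangent_cone" "k \<noteq> 0" for k
  proof -
    have "m * norm k > 0" using cm(1) that(2) by simp
    then show ?thesis using cm(2)[OF that(1)] by simp
  qed
  define D where "D = tangent_cone \<inter> {k. c \<bullet> k = -1}"
  have sc: "(1 / - (c \<bullet> k)) *\<^sub>R k \<in> D" if "k \<in> tangent_cone" "k \<noteq> 0" for k
  proof -
    have "c \<bullet> k < 0" by (rule neg[OF that])
    then show ?thesis unfolding D_def using tangent_cone_scale[OF that(1), of "1 / - (c \<bullet> k)"] by simp
  qed
  have Dc: "convex D" unfolding D_def by (intro convex_Int convex_tangent_cone convex_hyperplane)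
  have "compact D"
  proof -
    have "closed D" unfolding D_def by (intro closed_Int closed_tangent_cone closed_hyperplane)
    moreover have "bounded D" unfolding bounded_iff
    proof (intro exI ballI)
      fix k assume "k \<in> D"
      then have "m * norm k \<le> 1" using cm(2)[of k] unfolding D_def by auto
      then show "norm k \<le> 1 / m" using cm(1) by (simp add: field_simps)
    qed
    ultimately show ?thesis by (simp add: compact_eq_bounded_closed)
  qed
  then have KM: "D = convex hull {x. x extreme_point_of D}" using Dc by (rule Krein_Milman_Minkowski)
  have ext: "extreme_direction v" if v: "v extreme_point_of D" for v
    unfolding extreme_direction_def
  proof (intro conjI ballI allI impI)
    have vD: "v \<in> D" "c \<bullet> v = -1" using v unfolding extreme_point_of_def D_def by auto
    show "v \<noteq> 0" using vD by auto
    show "v \<in> tangent_cone" using vD unfolding D_def by blast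
    fix k l s assume kl: "k \<in> tangent_cone" "l \<in> tangent_cone" "k + l = s *\<^sub>R v"
    show "\<exists>\<kappa>. k = \<kappa> *\<^sub>R v"
    proof (cases "k = 0 \<or> l = 0")
      case True
      then show ?thesis using kl(3) by (metis add.right_neutral scaleR_zero_left)
    next
      case False
      define p q where "p = - (c \<bullet> k)" and "q = - (c \<bullet> l)"
      have pq: "p > 0" "q > 0" unfolding p_def q_def using neg kl False by auto
      have "c \<bullet> (k + l) = - s" unfolding kl(3) using vD by simp
      then have s: "s = p + q" unfolding p_def q_def by (simp add: inner_add_right)
      define k' l' where "k' = (1 / p) *\<^sub>R k" and "l' = (1 / q) *\<^sub>R l"
      have D': "k' \<in> D" "l' \<in> D" unfolding k'_def l'_def p_def q_def using sc kl False by auto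
      have "v = (1 / s) *\<^sub>R (s *\<^sub>R v)" using s pq by simp
      also have "\<dots> = (1 / s) *\<^sub>R (k + l)" using kl(3) by simp
      also have "\<dots> = (1 - q / s) *\<^sub>R k' + (q / s) *\<^sub>R l'"
        unfolding k'_def l'_def s using pq by (simp add: scaleR_add_right add_divide_distrib[symmetric] diff_divide_eq_iff)
      finally have ve: "v = (1 - q / s) *\<^sub>R k' + (q / s) *\<^sub>R l'" .
      have "0 < q / s" "q / s < 1" using s pq by auto
      then have "k' = l'" using v D' ve unfolding extreme_point_of_def in_segment by metis
      then have "v = k'" using ve by (simp flip: scaleR_add_left)
      then have "k = p *\<^sub>R v" unfolding k'_def using pq by simp
      then show ?thesis by blast
    qed
  qed
  obtain k \<epsilon> where ke: "\<epsilon> > 0" "ball k \<epsilon> \<subseteq> tangent_cone" by (rule tangent_cone_interior) (rule that)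
  obtain w0 :: "real^3" where w0: "w0 \<noteq> 0" "orthogonal c w0"
    using orthogonal_to_vector_exists[of c] by auto
  define w where "w = (\<epsilon> / (2 * norm w0)) *\<^sub>R w0"
  have w: "w \<noteq> 0" "norm w < \<epsilon>" "c \<bullet> w = 0" unfolding w_def using w0 ke by (auto simp: orthogonal_def)
  have k0: "k \<noteq> 0"
  proof
    assume "k = 0"
    then have "w \<in> tangent_cone" "- w \<in> tangent_cone" using ke(2) w(2) by auto
    then show False using tangent_cone_pointed w(1) by blast
  qed
  have kK: "k \<in> tangent_cone" "k + w \<in> tangent_cone"
    using ke w add_in_ball_iff by (auto simp: subset_iff simp del: mem_ball)
  have kw0: "k + w \<noteq> 0"
  proof
    assume "k + w = 0"
    then have "c \<bullet> (k + w) = 0" by simp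
    then have "c \<bullet> k = 0" using w(3) by (simp add: inner_add_right)
    then show False using neg[OF kK(1) k0] by simp
  qed
  have "\<not> (\<exists>a. D \<subseteq> {a})"
  proof
    assume "\<exists>a. D \<subseteq> {a}"
    then have "(1 / - (c \<bullet> k)) *\<^sub>R k = (1 / - (c \<bullet> (k + w))) *\<^sub>R (k + w)"
      using sc[OF kK(1) k0] sc[OF kK(2) kw0] by blast
    then have "(1 / - (c \<bullet> k)) *\<^sub>R w = 0" using w(3) by (simp add: inner_add_right scaleR_add_right)
    then show False using w(1) neg[OF kK(1) k0] by simp
  qed
  then have nh: "\<not> (\<exists>a. {x. x extreme_point_of D} \<subseteq> {a})"
  proof -
    have "D \<subseteq> {a}" if "{x. x extreme_point_of D} \<subseteq> {a}" for a
      using hull_mono[OF that, of convex] KM by simp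
    then show ?thesis using \<open>\<not> (\<exists>a. D \<subseteq> {a})\<close> by blast
  qed
  then obtain v where v: "v extreme_point_of D" by blast
  then obtain v' where v': "v' extreme_point_of D" "v' \<noteq> v" using nh by blast
  have "v' \<noteq> \<kappa> *\<^sub>R v" for \<kappa>
  proof
    assume e: "v' = \<kappa> *\<^sub>R v"
    have "c \<bullet> v = -1" "c \<bullet> v' = -1" using v v' unfolding extreme_point_of_def D_def by auto
    then have "\<kappa> = 1" unfolding e by simp
    then show False using e v' by simp
  qed
  then show ?thesis using that ext v v'(1) by blast
qed

text \<open>
  On the ray the solid is invariant along \<open>v\<close>. At an interior or face point it would moreover contain
  segments centred at that point in a second direction, against extremality.
\<close>

lemma edge_points_on_extreme_ray:
  assumes v: "extreme_direction v" and s: "s > 0" "s * norm v < r"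
  shows "H + s *\<^sub>R v \<in> edge_points P"
proof -
  define x where "x = H + s *\<^sub>R v"
  have vK: "v \<noteq> 0" "v \<in> tangent_cone" using v unfolding extreme_direction_def by auto
  have xP: "x \<in> P" using tangent_cone_iff[OF s] vK unfolding x_def by simp
  have xb: "x \<in> ball H r" unfolding x_def add_in_ball_iff using s by simp
  \<comment> \<open>Moving from \<open>x\<close> both ways along \<open>w\<close> would split the ray direction into two others.\<close>
  have no: "\<exists>\<kappa>. w = \<kappa> *\<^sub>R v" if w: "x + w \<in> P" "x - w \<in> P" "x + w \<in> ball H r" "x - w \<in> ball H r" for w
  proof -
    have K: "s *\<^sub>R v + w \<in> tangent_cone" "s *\<^sub>R v - w \<in> tangent_cone"
      using w in_P_iff_tangent_cone[of "x + w"] in_P_iff_tangent_cone[of "x - w"] unfolding x_def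
      by (auto simp del: mem_ball simp: algebra_simps)
    have "(s *\<^sub>R v + w) + (s *\<^sub>R v - w) = (2 * s) *\<^sub>R v" by (simp add: scaleR_2 flip: scaleR_scaleR)
    then obtain \<kappa> where "s *\<^sub>R v + w = \<kappa> *\<^sub>R v" using v K unfolding extreme_direction_def by blast
    then have "w = (\<kappa> - s) *\<^sub>R v" by (simp add: algebra_simps)
    then show ?thesis by blast
  qed
  have small: "\<exists>u. u \<noteq> 0 \<and> norm u < \<delta> \<and> n \<bullet> u = 0 \<and> (\<forall>\<kappa>. u \<noteq> \<kappa> *\<^sub>R v)" if d: "\<delta> > 0" for \<delta> n
  proof -
    have "dim {n, v} \<le> 2" using dim_le_card'[of "{n, v}"] by (simp add: card_insert_if split: if_splits)
    then have d3: "dim {n, v} < DIM(real^3)" by simp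
    obtain w0 where w0: "w0 \<noteq> 0" "\<And>y. y \<in> span {n, v} \<Longrightarrow> orthogonal w0 y"
      by (rule orthogonal_to_subspace_exists[OF d3]) (rule that)
    have "orthogonal w0 n" "orthogonal w0 v" by (rule w0(2), simp add: span_base)+
    then have o: "n \<bullet> w0 = 0" "v \<bullet> w0 = 0" by (simp_all add: orthogonal_def inner_commute)
    define u where "u = (\<delta> / (2 * norm w0)) *\<^sub>R w0"
    have u: "u \<noteq> 0" "norm u < \<delta>" "n \<bullet> u = 0" "v \<bullet> u = 0" unfolding u_def using d w0(1) o by auto
    have "u \<noteq> \<kappa> *\<^sub>R v" for \<kappa>
    proof
      assume "u = \<kappa> *\<^sub>R v"
      then have "u \<bullet> u = \<kappa> * (v \<bullet> u)" by (simp add: inner_commute)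
      then show False using u by simp
    qed
    then show ?thesis using u by blast
  qed
  have "x \<in> frontier P"
  proof (rule ccontr)
    assume "x \<notin> frontier P"
    then have "x \<in> interior P \<inter> ball H r" using xP xb closure_subset by (auto simp: frontier_def)
    moreover have "open (interior P \<inter> ball H r)" by auto
    ultimately obtain \<delta> where d: "\<delta> > 0" "ball x \<delta> \<subseteq> interior P \<inter> ball H r" by (meson openE)
    obtain u where u: "norm u < \<delta>" "\<And>\<kappa>. u \<noteq> \<kappa> *\<^sub>R v" using small[OF d(1)] by blast
    have "x + u \<in> ball x \<delta>" "x - u \<in> ball x \<delta>"
      using u(1) add_in_ball_iff[of x u] add_in_ball_iff[of x "-u"] by auto
    then show False using no[of u] u(2) d(2) interior_subset by blast
  qed
  moreover have "x \<notin> face_points P"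
  proof
    assume "x \<in> face_points P"
    then obtain n where "outward_normal_at P x n" unfolding face_points_def by blast
    then obtain r1 where r1: "r1 > 0" "\<And>y. y \<in> ball x r1 \<Longrightarrow> y \<in> P \<longleftrightarrow> n \<bullet> (y - x) \<le> 0"
      by (rule outward_normal_atE) blast
    have "min r1 (r - dist H x) > 0" using r1 xb by simp
    then obtain u where u: "norm u < min r1 (r - dist H x)" "n \<bullet> u = 0" "\<And>\<kappa>. u \<noteq> \<kappa> *\<^sub>R v" using small by blast
    have b: "x + u \<in> ball x r1" "x - u \<in> ball x r1"
      using u(1) add_in_ball_iff[of x u] add_in_ball_iff[of x "-u"] by auto
    have bH: "x + u \<in> ball H r" "x - u \<in> ball H r"
      using u(1) dist_triangle[of H "x + u" x] dist_triangle[of H "x - u" x] by (auto simp: dist_norm)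
    show False using no[of u] u(2,3) b bH r1(2) by simp
  qed
  moreover have "translation_invariant_near P x v"
  proof -
    obtain r' where "r' > 0" "conical_near P x r'" using plane_bounded_conical[OF plane_bounded] by blast
    then have "translation_invariant_near P x (s *\<^sub>R v)"
      using translation_invariant_near_if_conical[OF conical, of x r'] xb vK s unfolding x_def by simp
    then show ?thesis using translation_invariant_near_combination[of P x "s *\<^sub>R v" "s *\<^sub>R v" "1 / s" 0] s by simp
  qed
  ultimately show ?thesis unfolding x_def[symmetric] edge_points_iff using vK by blast
qed

text \<open>
  From a point of the face close to \<open>H\<close>, a small step along \<open>k\<close> stays in \<open>P\<close>, because the tangent cone is
  closed under addition. So \<open>k\<close> does not point to the outside of the face.
\<close>

lemma face_component_at_H_normal:
  assumes C: "\<And>y. y \<in> C \<Longrightarrow> outward_normal_at P y n" "H \<in> closure C"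
    and k: "k \<in> tangent_cone"
  shows "n \<bullet> k \<le> 0"
proof -
  obtain y where y: "y \<in> C" "dist y H < r" using C(2) radius closure_approachable by blast
  obtain r1 where r1: "r1 > 0" "\<And>z. z \<in> ball y r1 \<Longrightarrow> z \<in> P \<longleftrightarrow> n \<bullet> (z - y) \<le> 0"
    using C(1)[OF y(1)] by (rule outward_normal_atE) blast
  define \<epsilon> where "\<epsilon> = min r1 (r - dist H y) / (1 + norm k)"
  have pos: "1 + norm k > 0" by (simp add: add_pos_nonneg)
  have m: "min r1 (r - dist H y) > 0" using r1 y by (simp add: dist_commute)
  then have eps: "\<epsilon> > 0" unfolding \<epsilon>_def using pos by simp
  have "\<epsilon> * (1 + norm k) = min r1 (r - dist H y)" unfolding \<epsilon>_def using pos by simp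
  then have "\<epsilon> + \<epsilon> * norm k = min r1 (r - dist H y)" by (simp add: algebra_simps)
  then have "\<epsilon> * norm k < min r1 (r - dist H y)" using eps by linarith
  then have ek: "norm (\<epsilon> *\<^sub>R k) < min r1 (r - dist H y)" using eps by simp
  have b1: "y + \<epsilon> *\<^sub>R k \<in> ball y r1" unfolding add_in_ball_iff using ek by simp
  have b2: "y + \<epsilon> *\<^sub>R k \<in> ball H r"
    using dist_triangle[of H "y + \<epsilon> *\<^sub>R k" y] ek by (simp add: dist_norm)
  have "y \<in> P" using r1 by simp
  then have "y - H \<in> tangent_cone" using in_P_iff_tangent_cone[of y] y by (simp add: dist_commute)
  then have "(y - H) + \<epsilon> *\<^sub>R k \<in> tangent_cone" using tangent_cone_add tangent_cone_scale k eps by simp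
  then have "y + \<epsilon> *\<^sub>R k \<in> P" using in_P_iff_tangent_cone[OF b2] by (simp add: algebra_simps)
  then have "n \<bullet> (\<epsilon> *\<^sub>R k) \<le> 0" using r1(2)[OF b1] by simp
  then show ?thesis using eps by (simp add: mult_le_0_iff)
qed

lemma gauss_image_in_normal_cone:
  assumes "g \<in> gauss_image P H" "k \<in> tangent_cone"
  shows "g \<bullet> k \<le> 0"
proof -
  define N where "N = {g. g \<bullet> k \<le> 0}"
  have "N = {g. k \<bullet> g \<le> 0}" unfolding N_def by (simp add: inner_commute)
  then have cN: "convex N" by (simp add: convex_halfspace_le)
  have "gauss_curve P H \<subseteq> N"
  proof
    fix x assume "x \<in> gauss_curve P H"
    then obtain F G where FG: "adjacent_faces_at P H F G" "x \<in> geodesic_arc (face_normal P F) (face_normal P G)"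
      unfolding gauss_curve_def by blast
    have fn: "face_normal P F \<in> N" if F: "F \<in> faces P" "H \<in> F" for F
    proof -
      obtain C where C: "C \<in> components (face_points P)" "F = closure C" using F(1) unfolding faces_def by blast
      obtain n b where nb: "norm n = 1" "\<And>x. x \<in> C \<Longrightarrow> outward_normal_at P x n" "\<And>x. x \<in> C \<Longrightarrow> n \<bullet> x = b"
        by (rule face_component_normal[OF C(1)]) (rule that)
      have "face_normal P F = n" unfolding C(2) by (rule face_normal_eq[OF C(1) nb(2)])
      then show ?thesis unfolding N_def using face_component_at_H_normal[OF nb(2)] F(2) C(2) assms(2) by simp
    qed
    have "F \<in> faces P" "G \<in> faces P" "H \<in> F" "H \<in> G" using FG(1) unfolding adjacent_faces_at_def by auto
    then have ab: "face_normal P F \<in> N" "face_normal P G \<in> N" using fn by auto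
    obtain y where y: "y \<in> closed_segment (face_normal P F) (face_normal P G)" "x = sgn y"
      using FG(2) unfolding geodesic_arc_def by blast
    have "y \<in> N" using y(1) closed_segment_subset[OF ab cN] by blast
    then show "x \<in> N" unfolding y(2) N_def sgn_div_norm by (simp add: mult_nonneg_nonpos)
  qed
  moreover have "convex_cone N"
  proof -
    have "0 \<in> N" unfolding N_def by simp
    moreover have "conic N" unfolding conic_def N_def by (simp add: mult_nonneg_nonpos)
    ultimately show ?thesis unfolding convex_cone_def using cN by blast
  qed
  ultimately have "convex_cone hull (gauss_curve P H) \<subseteq> N" by (rule hull_minimal)
  then show ?thesis using assms(1) unfolding gauss_image_def N_def by blast
qed

text \<open>
  The extreme ray carries an edge from \<open>H\<close> to another vertex. Two non-parallel faces meet at an inner point of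
  this edge, contain all of it and so are adjacent at \<open>H\<close>.
\<close>

lemma extreme_direction_normals:
  assumes v: "extreme_direction v"
  obtains n1 n2 where "n1 \<in> gauss_curve P H" "n2 \<in> gauss_curve P H" "norm n1 = 1" "norm n2 = 1"
    "n1 \<noteq> n2" "n1 \<noteq> - n2" "n1 \<bullet> v = 0" "n2 \<bullet> v = 0"
proof -
  have v0: "v \<noteq> 0" using v unfolding extreme_direction_def by blast
  have "r / norm v > 0" using radius v0 by simp
  have e: "H + s *\<^sub>R v \<in> edge_points P" if "0 < s" "s < r / norm v" for s
    using edge_points_on_extreme_ray[OF v that(1)] that(2) v0 by (simp add: pos_less_divide_eq)
  obtain k where k: "k > 0" "H + k *\<^sub>R v \<in> vertices P" "open_segment H (H + k *\<^sub>R v) \<subseteq> edge_points P"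
    by (rule edge_along_ray[OF plane_bounded v0 \<open>r / norm v > 0\<close>], erule (1) e, rule that)
  define b where "b = H + k *\<^sub>R v"
  have bH: "b \<noteq> H" unfolding b_def using k v0 by simp
  then obtain x where x: "x \<in> open_segment H b" by (metis all_not_in_conv open_segment_eq_empty)
  then have xe: "x \<in> edge_points P" using k(3) unfolding b_def by blast
  obtain C1 C2 n1 n2 where C: "C1 \<in> components (face_points P)" "C2 \<in> components (face_points P)"
    "x \<in> closure C1" "x \<in> closure C2"
    "\<And>y. y \<in> C1 \<Longrightarrow> outward_normal_at P y n1" "\<And>y. y \<in> C2 \<Longrightarrow> outward_normal_at P y n2"
    "n1 \<noteq> n2" "n1 \<noteq> - n2"
    by (rule two_faces_at_edge_point[OF plane_bounded xe]) (rule that)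
  have sub: "closed_segment H b \<subseteq> closure C1" "closed_segment H b \<subseteq> closure C2"
    using face_contains_edge[OF plane_bounded _ _ x] C k(3) unfolding b_def by auto
  have fn: "face_normal P (closure C1) = n1" "face_normal P (closure C2) = n2"
    using face_normal_eq C by auto
  have edge: "closed_segment H b \<in> edges P"
    unfolding edges_def mem_Collect_eq
    by (intro exI[of _ H] exI[of _ b] conjI refl)
      (use vertex k(2,3) bH in \<open>simp_all add: b_def[symmetric]\<close>)
  have ne: "closure C1 \<noteq> closure C2" using fn C(7) by auto
  have adj: "adjacent_faces_at P H (closure C1) (closure C2)" "adjacent_faces_at P H (closure C2) (closure C1)"
    unfolding adjacent_faces_at_def faces_def using C(1,2) ne edge sub
    by (auto intro!: bexI[of _ "closed_segment H b"])
  have perp: "norm n = 1 \<and> n \<bullet> v = 0"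
    if CC: "C \<in> components (face_points P)" "\<And>y. y \<in> C \<Longrightarrow> outward_normal_at P y n" "closed_segment H b \<subseteq> closure C" for C n
  proof -
    obtain n' \<beta> where nb: "norm n' = 1" "\<And>x. x \<in> C \<Longrightarrow> outward_normal_at P x n'" "\<And>x. x \<in> C \<Longrightarrow> n' \<bullet> x = \<beta>"
      by (rule face_component_normal[OF CC(1)]) (rule that)
    obtain y where "y \<in> C" using in_components_nonempty[OF CC(1)] by blast
    then have "n' = n" using outward_normal_at_unique nb(2) CC(2) by blast
    moreover have "n' \<bullet> H = \<beta>" "n' \<bullet> b = \<beta>"
      using face_component_closure_plane[OF nb(3)] CC(3) by auto
    ultimately show ?thesis using nb(1) k(1) unfolding b_def by (simp add: inner_add_right)
  qed
  have gc: "face_normal P F \<in> gauss_curve P H" if "adjacent_faces_at P H F G" "norm (face_normal P F) = 1" for F G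
  proof -
    have "face_normal P F = sgn (face_normal P F)" using that(2) by (simp add: sgn_div_norm)
    then have "face_normal P F \<in> geodesic_arc (face_normal P F) (face_normal P G)"
      unfolding geodesic_arc_def by (metis ends_in_segment(1) imageI)
    then show ?thesis unfolding gauss_curve_def using that(1) by blast
  qed
  have p1: "norm n1 = 1 \<and> n1 \<bullet> v = 0" by (rule perp[OF C(1,5) sub(1)])
  have p2: "norm n2 = 1 \<and> n2 \<bullet> v = 0" by (rule perp[OF C(2,6) sub(2)])
  have "n1 \<in> gauss_curve P H" using gc[OF adj(1)] fn p1 by simp
  moreover have "n2 \<in> gauss_curve P H" using gc[OF adj(2)] fn p2 by simp
  ultimately show ?thesis using that p1 p2 C(7,8) by blast
qed

text \<open>
  The two normals along an extreme ray leave only the direction of that ray orthogonal to the Gauss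
  curve; two different rays leave nothing.
\<close>

lemma span_gauss_curve: "span (gauss_curve P H) = UNIV"
proof (rule ccontr)
  assume "span (gauss_curve P H) \<noteq> UNIV"
  then have "dim (gauss_curve P H) < DIM(real^3)"
    using dim_eq_full[of "gauss_curve P H"] dim_subset_UNIV[of "gauss_curve P H"] by linarith
  then obtain u where u: "u \<noteq> 0" "\<And>y. y \<in> span (gauss_curve P H) \<Longrightarrow> orthogonal u y"
    by (rule orthogonal_to_subspace_exists) (rule that)
  have par: "\<exists>\<kappa>. v = \<kappa> *\<^sub>R u" if v: "extreme_direction v" for v
  proof -
    obtain n1 n2 where n: "n1 \<in> gauss_curve P H" "n2 \<in> gauss_curve P H" "norm n1 = 1" "norm n2 = 1"
      "n1 \<noteq> n2" "n1 \<noteq> - n2" "n1 \<bullet> v = 0" "n2 \<bullet> v = 0"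
      by (rule extreme_direction_normals[OF v]) (rule that)
    have un: "n1 \<bullet> u = 0" "n2 \<bullet> u = 0"
      using u(2)[of n1] u(2)[of n2] n by (auto simp: orthogonal_def inner_commute span_base)
    have n10: "n1 \<noteq> 0" using n by auto
    have n21: "n2 \<noteq> \<kappa> *\<^sub>R n1" for \<kappa>
    proof
      assume e: "n2 = \<kappa> *\<^sub>R n1"
      then have "\<bar>\<kappa>\<bar> = 1" using n by simp
      then have "\<kappa> = 1 \<or> \<kappa> = -1" by linarith
      then show False using e n(5,6) by auto
    qed
    obtain e1 e2 m \<alpha> \<beta> \<gamma> where e: "norm e1 = 1" "norm e2 = 1" "norm m = 1" "e1 \<bullet> e2 = 0" "e1 \<bullet> m = 0"
      "e2 \<bullet> m = 0" "e1 = \<alpha> *\<^sub>R n1" "e2 = \<beta> *\<^sub>R n1 + \<gamma> *\<^sub>R n2"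
      by (rule orthonormal_frame_of_independent[OF n10 n21]) (rule that)
    have line: "w = (w \<bullet> m) *\<^sub>R m" if "n1 \<bullet> w = 0" "n2 \<bullet> w = 0" for w
    proof -
      have "w \<bullet> e1 = 0" "w \<bullet> e2 = 0" unfolding e(7,8) using that by (auto simp: inner_add_right inner_commute)
      then show ?thesis using orthonormal_expansion[OF e(1-6), of w] by simp
    qed
    have um: "u = (u \<bullet> m) *\<^sub>R m" by (rule line[OF un])
    then have "u \<bullet> m \<noteq> 0" using u(1) by (metis scaleR_zero_left)
    have "((v \<bullet> m) / (u \<bullet> m)) *\<^sub>R u = ((v \<bullet> m) / (u \<bullet> m)) *\<^sub>R ((u \<bullet> m) *\<^sub>R m)" using um by simp
    also have "\<dots> = (v \<bullet> m) *\<^sub>R m" using \<open>u \<bullet> m \<noteq> 0\<close> by simp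
    also have "\<dots> = v" using line[OF n(7,8)] by simp
    finally show ?thesis by metis
  qed
  obtain v w where vw: "extreme_direction v" "extreme_direction w" "\<And>\<kappa>. w \<noteq> \<kappa> *\<^sub>R v"
    by (rule two_extreme_directions) (rule that)
  obtain a b where ab: "v = a *\<^sub>R u" "w = b *\<^sub>R u" using par vw by blast
  have "v \<noteq> 0" using vw(1) unfolding extreme_direction_def by blast
  then have "w = (b / a) *\<^sub>R v" using ab by auto
  then show False using vw(3) by blast
qed

end

section \<open>The inradius of the Gauss image\<close>

context convex_corner
begin

text \<open>
  The point of the disc at distance \<open>\<rho>\<close> from \<open>c\<close> in the direction of \<open>k\<close> is an outer normal of the
  tangent cone, so its inner product with \<open>k\<close> is at most \<open>0\<close>.
\<close>

lemma disc_in_gauss_image_direction: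
  assumes c: "norm c = 1" and \<rho>: "0 \<le> \<rho>" "\<rho> \<le> pi / 2"
    and disc: "spherical_disc c \<rho> \<subseteq> gauss_image P H" and k: "k \<in> tangent_cone"
  shows "c \<bullet> k \<le> - sin \<rho> * norm k"
proof (cases "k = 0")
  case False
  define u where "u = (1 / norm k) *\<^sub>R k"
  have uK: "u \<in> tangent_cone" unfolding u_def using tangent_cone_scale[OF k] by simp
  have "norm u = 1" using False unfolding u_def by simp
  then have un: "u \<bullet> u = 1" "norm u = 1" by (simp_all add: norm_eq_1)
  have cc: "c \<bullet> c = 1" using c by (simp add: norm_eq_1)
  define \<alpha> where "\<alpha> = c \<bullet> u"
  have in_disc: "x \<bullet> u \<le> 0" if "norm x = 1" "c \<bullet> x = cos \<rho>" for x
  proof -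
    have "arccos (c \<bullet> x) = \<rho>" using that(2) \<rho> by (simp add: arccos_cos)
    then have "x \<in> spherical_disc c \<rho>" unfolding spherical_disc_def using that by simp
    then show ?thesis using disc gauss_image_in_normal_cone uK by blast
  qed
  have "arccos (c \<bullet> c) \<le> \<rho>" using cc \<rho> by simp
  then have "c \<in> spherical_disc c \<rho>" unfolding spherical_disc_def using c by simp
  then have a0: "\<alpha> \<le> 0" unfolding \<alpha>_def using disc gauss_image_in_normal_cone uK by blast
  define h where "h = u - \<alpha> *\<^sub>R c"
  have hh: "h \<bullet> h = 1 - \<alpha>\<^sup>2" "h \<bullet> u = 1 - \<alpha>\<^sup>2" "c \<bullet> h = 0"
    unfolding h_def \<alpha>_def using un cc
    by (simp_all add: inner_diff_left inner_diff_right inner_commute power2_eq_square)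
  have s0: "sin \<rho> \<ge> 0" "cos \<rho> \<ge> 0" using \<rho> by (auto intro!: sin_ge_zero cos_ge_zero)
  have "\<alpha> \<le> - sin \<rho>"
  proof (cases "h = 0")
    case True
    then have "\<alpha>\<^sup>2 = 1" using hh by simp
    then have "\<alpha> = -1" using a0 by (auto simp: power2_eq_1_iff)
    then show ?thesis using sin_le_one[of \<rho>] by simp
  next
    case False
    define q where "q = sqrt (1 - \<alpha>\<^sup>2)"
    have "0 < h \<bullet> h" using False by simp
    then have q: "q > 0" "q\<^sup>2 = 1 - \<alpha>\<^sup>2" unfolding q_def using hh by auto
    define x where "x = cos \<rho> *\<^sub>R c + (sin \<rho> / q) *\<^sub>R h"
    have "x \<bullet> x = (cos \<rho>)\<^sup>2 + (sin \<rho> / q)\<^sup>2 * (h \<bullet> h)"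
      unfolding x_def using cc hh(3)
      by (simp add: inner_add_left inner_add_right inner_commute power2_eq_square)
    also have "\<dots> = (cos \<rho>)\<^sup>2 + (sin \<rho>)\<^sup>2"
      unfolding hh(1) q(2)[symmetric] power_divide using q(1) by simp
    finally have "norm x = 1" by (simp add: norm_eq_1)
    moreover have "c \<bullet> x = cos \<rho>" unfolding x_def using cc hh(3) by (simp add: inner_add_right)
    ultimately have "x \<bullet> u \<le> 0" by (rule in_disc)
    moreover have "x \<bullet> u = cos \<rho> * \<alpha> + (sin \<rho> / q) * q\<^sup>2"
      unfolding x_def using hh(2) q(2) by (simp add: inner_add_left \<alpha>_def)
    ultimately have "sin \<rho> * q \<le> cos \<rho> * (- \<alpha>)" using q(1) by (simp add: power2_eq_square)
    then have "(sin \<rho> * q)\<^sup>2 \<le> (cos \<rho> * (- \<alpha>))\<^sup>2"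
      using s0(1) q(1) by (intro power_mono) auto
    then have "(sin \<rho>)\<^sup>2 * (1 - \<alpha>\<^sup>2) \<le> (1 - (sin \<rho>)\<^sup>2) * \<alpha>\<^sup>2"
      unfolding power_mult_distrib q(2) by (simp add: cos_squared_eq)
    then have "(sin \<rho>)\<^sup>2 \<le> (- \<alpha>)\<^sup>2" by (simp add: algebra_simps)
    then have "sin \<rho> \<le> - \<alpha>" by (rule power2_le_imp_le) (use a0 in simp)
    then show ?thesis by simp
  qed
  then have "norm k * \<alpha> \<le> norm k * (- sin \<rho>)" by (intro mult_left_mono) auto
  moreover have "norm k * \<alpha> = c \<bullet> k" unfolding \<alpha>_def u_def using False by simp
  ultimately show ?thesis by (simp add: mult.commute)
qed simp

text \<open>
  A disc of radius \<open>pi / 2\<close> contains two antipodal points, and the tangent cone, which has interior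
  points, would lie in the plane orthogonal to them.
\<close>

lemma disc_in_gauss_image_radius:
  assumes c: "norm c = 1" and disc: "spherical_disc c \<rho> \<subseteq> gauss_image P H"
  shows "\<rho> < pi / 2"
proof (rule ccontr)
  assume "\<not> \<rho> < pi / 2"
  then have rho: "pi / 2 \<le> \<rho>" by simp
  obtain w0 :: "real^3" where w0: "w0 \<noteq> 0" "orthogonal c w0" using orthogonal_to_vector_exists[of c] by auto
  define w where "w = (1 / norm w0) *\<^sub>R w0"
  have w: "norm w = 1" "c \<bullet> w = 0" unfolding w_def using w0 by (auto simp: orthogonal_def)
  have "w \<in> spherical_disc c \<rho>" "- w \<in> spherical_disc c \<rho>"
    unfolding spherical_disc_def using w rho by auto
  then have "w \<in> gauss_image P H" "- w \<in> gauss_image P H" using disc by auto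
  then have z: "w \<bullet> k = 0" if "k \<in> tangent_cone" for k
    using gauss_image_in_normal_cone[of w k] gauss_image_in_normal_cone[of "-w" k] that by simp
  obtain k \<epsilon> where ke: "\<epsilon> > 0" "ball k \<epsilon> \<subseteq> tangent_cone" by (rule tangent_cone_interior) (rule that)
  have "k \<in> ball k \<epsilon>" "k + (\<epsilon>/2) *\<^sub>R w \<in> ball k \<epsilon>" using ke(1) w unfolding add_in_ball_iff by auto
  then have "w \<bullet> k = 0" "w \<bullet> (k + (\<epsilon>/2) *\<^sub>R w) = 0" using z ke(2) by blast+
  then have "w \<bullet> w = 0" using ke(1) by (simp add: inner_add_right)
  then show False using w(1) by simp
qed

text \<open>
  The cone over the Gauss image spans the space and so has an interior point.
\<close>

lemma disc_in_gauss_image_exists: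
  obtains c \<rho> where "norm c = 1" "\<rho> > 0" "spherical_disc c \<rho> \<subseteq> gauss_image P H"
proof -
  define Q where "Q = convex_cone hull (gauss_curve P H)"
  have Q: "convex_cone Q" unfolding Q_def by (rule convex_cone_convex_cone_hull)
  then have cQ: "convex Q" "conic Q" "Q \<noteq> {}" unfolding convex_cone_def by auto
  have Qs: "l *\<^sub>R x \<in> Q" if "x \<in> Q" "l \<ge> 0" for l x using cQ(2) that unfolding conic_def by blast
  have Q0: "0 \<in> Q" using cQ(3) Qs[of _ 0] by auto
  have "gauss_curve P H \<subseteq> Q" unfolding Q_def by (rule hull_subset)
  then have "span Q = UNIV" using span_mono span_gauss_curve by blast
  then have "affine hull Q = UNIV" using affine_hull_span_0[of Q] hull_inc[OF Q0] by simp
  then have "interior Q \<noteq> {}"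
    using rel_interior_interior[of Q] rel_interior_eq_empty[OF cQ(1)] cQ(3) by simp
  moreover have "interior Q \<noteq> {0}" using open_interior[of Q] not_open_singleton by metis
  ultimately obtain p where p: "p \<in> interior Q" "p \<noteq> 0" by blast
  then obtain e where e: "e > 0" "ball p e \<subseteq> Q" using mem_interior by blast
  define c where "c = (1 / norm p) *\<^sub>R p"
  define \<delta> where "\<delta> = e / norm p"
  have c: "norm c = 1" unfolding c_def using p by simp
  have d: "\<delta> > 0" unfolding \<delta>_def using e p by simp
  have ballc: "x \<in> Q" if x: "dist c x < \<delta>" for x
  proof -
    have "dist p (norm p *\<^sub>R x) = norm p * dist c x"
    proof -
      have "p - norm p *\<^sub>R x = norm p *\<^sub>R (c - x)" unfolding c_def using p by (simp add: scaleR_diff_right)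
      then show ?thesis by (simp add: dist_norm)
    qed
    also have "\<dots> < e" using x p unfolding \<delta>_def by (simp add: pos_less_divide_eq mult.commute)
    finally have "norm p *\<^sub>R x \<in> Q" using e by auto
    from Qs[OF this, of "1 / norm p"] show ?thesis using p by simp
  qed
  define \<delta>' where "\<delta>' = min \<delta> 1"
  have d': "0 < \<delta>'" "\<delta>' \<le> 1" "\<delta>' \<le> \<delta>" unfolding \<delta>'_def using d by auto
  define \<rho> where "\<rho> = arccos (1 - \<delta>'\<^sup>2 / 4)"
  have sq: "0 < \<delta>'\<^sup>2" "\<delta>'\<^sup>2 \<le> 1" using d' by (auto simp: power_le_one)
  have "\<rho> > 0" unfolding \<rho>_def using arccos_less_arccos[of "1 - \<delta>'\<^sup>2 / 4" 1] sq by simp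
  moreover have "spherical_disc c \<rho> \<subseteq> gauss_image P H"
  proof
    fix x assume x: "x \<in> spherical_disc c \<rho>"
    then have xn: "norm x = 1" "arccos (c \<bullet> x) \<le> \<rho>" unfolding spherical_disc_def by auto
    have "\<bar>c \<bullet> x\<bar> \<le> 1" using Cauchy_Schwarz_ineq2[of c x] c xn by simp
    then have "c \<bullet> x \<ge> 1 - \<delta>'\<^sup>2 / 4" using xn(2) sq unfolding \<rho>_def by (simp add: arccos_le_mono)
    moreover have "(dist c x)\<^sup>2 = 2 - 2 * (c \<bullet> x)"
      unfolding dist_norm power2_norm_eq_inner using c xn(1)
      by (simp add: inner_diff_left inner_diff_right inner_commute norm_eq_1)
    ultimately have "(dist c x)\<^sup>2 < \<delta>'\<^sup>2" using sq by linarith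
    then have "dist c x < \<delta>'" by (rule power2_less_imp_less) (use d' in simp)
    then have "x \<in> Q" using ballc d' by simp
    then show "x \<in> gauss_image P H" unfolding gauss_image_def Q_def using xn by simp
  qed
  ultimately show ?thesis using that c by blast
qed

text \<open>
  The inequality is strict, so it persists for radii slightly below the supremum. Positivity of the
  inradius is essential: \<open>2 * pi / tan 0\<close> evaluates to \<open>0\<close>, so that for inradius \<open>0\<close> the degree would only be
  assumed to be positive.
\<close>

lemma inradius_direction:
  assumes d: "d > 2 * pi / tan (spherical_inradius (gauss_image P H))"
  obtains c \<rho> where "norm c = 1" "0 < \<rho>" "\<rho> < pi / 2"
    "\<And>k. k \<in> tangent_cone \<Longrightarrow> c \<bullet> k \<le> - sin \<rho> * norm k" "d > 2 * pi * (cos \<rho> / sin \<rho>)"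
proof -
  define R where "R = {\<rho>. \<rho> \<ge> 0 \<and> (\<exists>c \<in> sphere 0 1. spherical_disc c \<rho> \<subseteq> gauss_image P H)}"
  define \<theta> where "\<theta> = Sup R"
  have \<theta>: "spherical_inradius (gauss_image P H) = \<theta>"
    unfolding spherical_inradius_def \<theta>_def R_def ..
  have ub: "\<rho> < pi / 2" if "\<rho> \<in> R" for \<rho>
    using that disc_in_gauss_image_radius unfolding R_def by auto
  then have bdd: "bdd_above R" by (meson bdd_aboveI less_imp_le)
  obtain c0 \<rho>0 where c0: "norm c0 = 1" "\<rho>0 > 0" "spherical_disc c0 \<rho>0 \<subseteq> gauss_image P H"
    by (rule disc_in_gauss_image_exists) (rule that)
  have r0: "\<rho>0 \<in> R" unfolding R_def using c0 by auto
  have t0: "\<theta> > 0" using cSup_upper[OF r0 bdd] c0(2) unfolding \<theta>_def by simp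
  have t1: "\<theta> \<le> pi / 2" unfolding \<theta>_def by (rule cSup_least) (use r0 ub in \<open>auto intro: less_imp_le\<close>)
  have "sin \<theta> > 0" using t0 t1 by (intro sin_gt_zero) auto
  then have cont: "isCont (\<lambda>x. 2 * pi * (cos x / sin x)) \<theta>" by (intro continuous_intros) auto
  \<comment> \<open>This holds for \<open>\<theta> = pi / 2\<close> as well, where division by \<open>cos \<theta> = 0\<close> makes both sides \<open>0\<close>.\<close>
  have "2 * pi / tan \<theta> = 2 * pi * (cos \<theta> / sin \<theta>)" by (simp add: tan_def)
  then have "2 * pi * (cos \<theta> / sin \<theta>) < d" using d unfolding \<theta> by simp
  then have "\<forall>\<^sub>F x in at \<theta>. 2 * pi * (cos x / sin x) < d"
    using cont unfolding isCont_def by (rule order_tendstoD(2)[rotated])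
  then obtain \<delta> where dl: "\<delta> > 0" "\<And>x. x \<noteq> \<theta> \<Longrightarrow> dist x \<theta> < \<delta> \<Longrightarrow> 2 * pi * (cos x / sin x) < d"
    unfolding eventually_at by auto
  have "max 0 (\<theta> - \<delta>) < \<theta>" using t0 dl by simp
  then obtain \<rho> where rho: "\<rho> \<in> R" "max 0 (\<theta> - \<delta>) < \<rho>"
    using less_cSup_iff[of R "max 0 (\<theta> - \<delta>)"] r0 bdd unfolding \<theta>_def by blast
  have "\<rho> \<le> \<theta>" unfolding \<theta>_def by (rule cSup_upper[OF rho(1) bdd])
  then have "2 * pi * (cos \<rho> / sin \<rho>) < d"
    using dl(2)[of \<rho>] rho(2) \<open>2 * pi * (cos \<theta> / sin \<theta>) < d\<close> by (cases "\<rho> = \<theta>") (auto simp: dist_real_def)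
  moreover obtain c where c: "norm c = 1" "spherical_disc c \<rho> \<subseteq> gauss_image P H"
    using rho(1) unfolding R_def by auto
  moreover have "c \<bullet> k \<le> - sin \<rho> * norm k" if "k \<in> tangent_cone" for k
    using disc_in_gauss_image_direction[OF c(1) _ _ c(2) that] rho(2) ub[OF rho(1)] by simp
  moreover have "0 < \<rho>" using rho(2) by simp
  ultimately show ?thesis using that[of c \<rho>] ub[OF rho(1)] by blast
qed

end

section \<open>Perimeter of a convex polygon in a disc\<close>

text \<open>
  The interval is split at the two zeros of the cosine, \<open>\<alpha> + pi / 2\<close> and \<open>\<alpha> + 3 * pi / 2\<close>.
\<close>

lemma has_integral_abs_cos_shift:
  fixes \<alpha> :: real
  assumes "- (pi / 2) \<le> \<alpha>" "\<alpha> \<le> pi / 2"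
  shows "((\<lambda>\<phi>. \<bar>cos (\<phi> - \<alpha>)\<bar>) has_integral 4) {0..2*pi}"
proof -
  have der: "((\<lambda>\<phi>. sin (\<phi> - \<alpha>)) has_vector_derivative cos (x - \<alpha>)) (at x within S)" for x S
    by (auto intro!: derivative_eq_intros simp: has_real_derivative_iff_has_vector_derivative[symmetric])
  have i: "((\<lambda>\<phi>. cos (\<phi> - \<alpha>)) has_integral (sin (b - \<alpha>) - sin (a - \<alpha>))) {a..b}" if "a \<le> b" for a b
    by (rule fundamental_theorem_of_calculus[OF that der])
  define p q where "p = \<alpha> + pi / 2" and "q = \<alpha> + 3 * (pi / 2)"
  have pq: "0 \<le> p" "p \<le> q" "q \<le> 2 * pi" unfolding p_def q_def using assms by auto
  have s32: "sin (3 * (pi / 2)) = -1"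
    using sin_3over2_pi by simp
  have v: "sin (p - \<alpha>) - sin (0 - \<alpha>) = 1 + sin \<alpha>" "- (sin (q - \<alpha>) - sin (p - \<alpha>)) = 2"
    "sin (2 * pi - \<alpha>) - sin (q - \<alpha>) = 1 - sin \<alpha>"
    unfolding p_def q_def using s32 by (simp_all add: sin_diff)
  have sg: "cos (\<phi> - \<alpha>) = \<bar>cos (\<phi> - \<alpha>)\<bar>" if "\<phi> \<in> {0..p}" for \<phi>
    using that assms cos_ge_zero[of "\<phi> - \<alpha>"] unfolding p_def by simp
  have 1: "((\<lambda>\<phi>. \<bar>cos (\<phi> - \<alpha>)\<bar>) has_integral (1 + sin \<alpha>)) {0..p}"
    using i[OF pq(1)] unfolding v by (rule has_integral_eq[rotated]) (rule sg)
  have sg: "- cos (\<phi> - \<alpha>) = \<bar>cos (\<phi> - \<alpha>)\<bar>" if "\<phi> \<in> {p..q}" for \<phi>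
    using that cos_ge_zero[of "\<phi> - \<alpha> - pi"] unfolding p_def q_def by (simp add: cos_diff)
  have 2: "((\<lambda>\<phi>. \<bar>cos (\<phi> - \<alpha>)\<bar>) has_integral 2) {p..q}"
    using has_integral_neg[OF i[OF pq(2)]] unfolding v by (rule has_integral_eq[rotated]) (rule sg)
  have sg: "cos (\<phi> - \<alpha>) = \<bar>cos (\<phi> - \<alpha>)\<bar>" if "\<phi> \<in> {q..2*pi}" for \<phi>
    using that assms cos_ge_zero[of "\<phi> - \<alpha> - 2 * pi"] unfolding q_def by (simp add: cos_diff)
  have 3: "((\<lambda>\<phi>. \<bar>cos (\<phi> - \<alpha>)\<bar>) has_integral (1 - sin \<alpha>)) {q..2*pi}"
    using i[OF pq(3)] unfolding v by (rule has_integral_eq[rotated]) (rule sg)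
  have 12: "((\<lambda>\<phi>. \<bar>cos (\<phi> - \<alpha>)\<bar>) has_integral ((1 + sin \<alpha>) + 2)) {0..q}"
    by (rule has_integral_combine[OF pq(1,2) 1 2])
  have "((\<lambda>\<phi>. \<bar>cos (\<phi> - \<alpha>)\<bar>) has_integral (((1 + sin \<alpha>) + 2) + (1 - sin \<alpha>))) {0..2*pi}"
    by (rule has_integral_combine[OF _ pq(3) 12 3]) (use pq in auto)
  then show ?thesis by simp
qed

lemma has_integral_abs_cos_sin:
  fixes p q :: real
  shows "((\<lambda>\<phi>. \<bar>cos \<phi> * p + sin \<phi> * q\<bar>) has_integral 4 * sqrt (p\<^sup>2 + q\<^sup>2)) {0..2*pi}"
proof -
  obtain \<alpha> \<rho> where a: "- (pi / 2) \<le> \<alpha>" "\<alpha> \<le> pi / 2" "p = \<rho> * cos \<alpha>" "q = \<rho> * sin \<alpha>"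
  proof (cases "p = 0")
    case True
    then show ?thesis using that[of "pi / 2" q] by simp
  next
    case False
    define \<alpha> where "\<alpha> = arctan (q / p)"
    have c: "cos \<alpha> > 0" unfolding \<alpha>_def by (simp add: cos_arctan add_pos_nonneg)
    have "tan \<alpha> = q / p" unfolding \<alpha>_def by (simp add: tan_arctan)
    then have "sin \<alpha> = cos \<alpha> * (q / p)" using c by (simp add: tan_def field_simps)
    then have "p = (p / cos \<alpha>) * cos \<alpha>" "q = (p / cos \<alpha>) * sin \<alpha>" using c False by auto
    moreover have "- (pi / 2) \<le> \<alpha>" "\<alpha> \<le> pi / 2"
      unfolding \<alpha>_def using arctan_lbound arctan_ubound by (auto intro: less_imp_le)
    ultimately show ?thesis using that by blast
  qed
  have "p\<^sup>2 + q\<^sup>2 = \<rho>\<^sup>2 * ((cos \<alpha>)\<^sup>2 + (sin \<alpha>)\<^sup>2)" unfolding a power_mult_distrib distrib_left ..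
  then have "p\<^sup>2 + q\<^sup>2 = \<rho>\<^sup>2" by (simp only: sin_cos_squared_add2 mult_1_right)
  then have "sqrt (p\<^sup>2 + q\<^sup>2) = \<bar>\<rho>\<bar>" by simp
  moreover have "\<bar>cos \<phi> * p + sin \<phi> * q\<bar> = \<bar>\<rho>\<bar> * \<bar>cos (\<phi> - \<alpha>)\<bar>" for \<phi>
    unfolding a abs_mult[symmetric] cos_diff by (simp add: algebra_simps)
  moreover have "((\<lambda>\<phi>. \<bar>\<rho>\<bar> * \<bar>cos (\<phi> - \<alpha>)\<bar>) has_integral \<bar>\<rho>\<bar> * 4) {0..2*pi}"
    by (intro has_integral_mult_right has_integral_abs_cos_shift a)
  ultimately show ?thesis by (simp add: mult.commute)
qed

text \<open>
  The two integrations behind Crofton's formula: over the levels \<open>s\<close>, the segments hit at level \<open>s\<close>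
  contribute the length of the projections; then, over all directions in the plane, the projections
  contribute four times the length of the segments.
\<close>

lemma sum_projections_le:
  fixes f g :: "'i \<Rightarrow> real"
  assumes fin: "finite I" and R: "R \<ge> 0"
    and count: "\<And>s. card {i \<in> I. min (f i) (g i) < s \<and> s < max (f i) (g i)} \<le> 2"
    and bnd: "\<And>i. i \<in> I \<Longrightarrow> \<bar>f i - m\<bar> \<le> R" "\<And>i. i \<in> I \<Longrightarrow> \<bar>g i - m\<bar> \<le> R"
  shows "(\<Sum>i\<in>I. \<bar>g i - f i\<bar>) \<le> 4 * R"
proof -
  define A where "A i = {min (f i) (g i)<..<max (f i) (g i)}" for i
  have m: "\<bar>g i - f i\<bar> = measure lborel (A i)" for i unfolding A_def by (auto simp: min_def max_def)
  have int: "integrable lborel (indicator (A i) :: real \<Rightarrow> real)" for i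
    unfolding A_def by (intro integrable_real_indicator) (auto simp: emeasure_lborel_box_finite)
  have "(\<Sum>i\<in>I. \<bar>g i - f i\<bar>) = (\<Sum>i\<in>I. (LINT x|lborel. indicator (A i) x))"
    unfolding m by simp
  also have "\<dots> = (LINT x|lborel. (\<Sum>i\<in>I. indicator (A i) x))"
    by (rule Bochner_Integration.integral_sum[symmetric]) (rule int)
  also have "\<dots> \<le> (LINT x|lborel. 2 * indicator {m - R..m + R} x)"
  proof (rule integral_mono)
    show "integrable lborel (\<lambda>x. \<Sum>i\<in>I. indicator (A i) x :: real)" by (intro Bochner_Integration.integrable_sum int)
    show "integrable lborel (\<lambda>x. 2 * indicator {m - R..m + R} x :: real)"
      by (intro integrable_mult_right integrable_real_indicator) (auto simp: emeasure_lborel_Icc_eq)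
    fix x :: real
    have e: "(\<Sum>i\<in>I. indicator (A i) x :: real) = real (card {i \<in> I. x \<in> A i})"
      using fin by (simp add: indicator_def sum.If_cases Int_def)
    show "(\<Sum>i\<in>I. indicator (A i) x) \<le> (2 * indicator {m - R..m + R} x :: real)"
    proof (cases "x \<in> {m - R..m + R}")
      case True
      then show ?thesis unfolding e using count[of x] by (simp add: A_def)
    next
      case False
      have "{i \<in> I. x \<in> A i} = {}"
      proof (rule ccontr)
        assume "{i \<in> I. x \<in> A i} \<noteq> {}"
        then obtain i where "i \<in> I" "x \<in> A i" by blast
        then show False using bnd[of i] False unfolding A_def by (auto simp: min_def max_def split: if_splits)
      qed
      then show ?thesis unfolding e by (simp only: card.empty) simp
    qed
  qed
  also have "\<dots> = 4 * R" using R by simp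
  finally show ?thesis .
qed

lemma crofton_bound:
  fixes a b :: "'i \<Rightarrow> real^3" and e1 e2 n z :: "real^3"
  assumes e: "norm e1 = 1" "norm e2 = 1" "norm n = 1" "e1 \<bullet> e2 = 0" "e1 \<bullet> n = 0" "e2 \<bullet> n = 0"
    and fin: "finite I" and R: "R \<ge> 0"
    and plane: "\<And>i. i \<in> I \<Longrightarrow> n \<bullet> (b i - a i) = 0"
    and count: "\<And>u s. norm u = 1 \<Longrightarrow> n \<bullet> u = 0 \<Longrightarrow>
        card {i \<in> I. min (u \<bullet> a i) (u \<bullet> b i) < s \<and> s < max (u \<bullet> a i) (u \<bullet> b i)} \<le> 2"
    and disc: "\<And>i. i \<in> I \<Longrightarrow> dist (a i) z \<le> R" "\<And>i. i \<in> I \<Longrightarrow> dist (b i) z \<le> R"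
  shows "(\<Sum>i\<in>I. dist (a i) (b i)) \<le> 2 * pi * R"
proof -
  define u where "u \<phi> = cos \<phi> *\<^sub>R e1 + sin \<phi> *\<^sub>R e2" for \<phi>
  have u: "norm (u \<phi>) = 1" "n \<bullet> u \<phi> = 0" for \<phi>
  proof -
    show "norm (u \<phi>) = 1" unfolding u_def using orthonormal_norm[OF e, of "cos \<phi>" "sin \<phi>" 0] by simp
    show "n \<bullet> u \<phi> = 0" unfolding u_def using e by (simp add: inner_add_right inner_commute)
  qed
  have pos: "(\<Sum>i\<in>I. \<bar>u \<phi> \<bullet> b i - u \<phi> \<bullet> a i\<bar>) \<le> 4 * R" for \<phi>
  proof (rule sum_projections_le[OF fin R count[OF u]])
    have cs: "\<bar>u \<phi> \<bullet> y - u \<phi> \<bullet> z\<bar> \<le> R" if "dist y z \<le> R" for y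
    proof -
      have "\<bar>u \<phi> \<bullet> (y - z)\<bar> \<le> norm (u \<phi>) * norm (y - z)" by (rule Cauchy_Schwarz_ineq2)
      then show ?thesis using that u(1) by (simp add: dist_norm inner_diff_right)
    qed
    show "\<bar>u \<phi> \<bullet> a i - u \<phi> \<bullet> z\<bar> \<le> R" "\<bar>u \<phi> \<bullet> b i - u \<phi> \<bullet> z\<bar> \<le> R" if "i \<in> I" for i
      using cs disc that by auto
  qed
  have len: "((\<lambda>\<phi>. \<bar>u \<phi> \<bullet> b i - u \<phi> \<bullet> a i\<bar>) has_integral 4 * dist (a i) (b i)) {0..2*pi}" if i: "i \<in> I" for i
  proof -
    define w where "w = b i - a i"
    have "w = (w \<bullet> e1) *\<^sub>R e1 + (w \<bullet> e2) *\<^sub>R e2 + (w \<bullet> n) *\<^sub>R n" by (rule orthonormal_expansion[OF e])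
    moreover have wn: "w \<bullet> n = 0" using plane[OF i] unfolding w_def by (simp add: inner_commute)
    ultimately have "norm w = norm ((w \<bullet> e1) *\<^sub>R e1 + (w \<bullet> e2) *\<^sub>R e2 + 0 *\<^sub>R n)" by metis
    also have "\<dots> = sqrt ((w \<bullet> e1)\<^sup>2 + (w \<bullet> e2)\<^sup>2)" unfolding orthonormal_norm[OF e] by simp
    finally have "dist (a i) (b i) = sqrt ((w \<bullet> e1)\<^sup>2 + (w \<bullet> e2)\<^sup>2)"
      unfolding w_def by (simp add: dist_norm norm_minus_commute)
    moreover have "u \<phi> \<bullet> b i - u \<phi> \<bullet> a i = cos \<phi> * (w \<bullet> e1) + sin \<phi> * (w \<bullet> e2)" for \<phi>
      unfolding u_def w_def by (simp add: inner_add_left inner_diff_left inner_commute algebra_simps)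
    ultimately show ?thesis using has_integral_abs_cos_sin[of "w \<bullet> e1" "w \<bullet> e2"] by simp
  qed
  have "((\<lambda>\<phi>. \<Sum>i\<in>I. \<bar>u \<phi> \<bullet> b i - u \<phi> \<bullet> a i\<bar>) has_integral (\<Sum>i\<in>I. 4 * dist (a i) (b i))) {0..2*pi}"
    by (rule has_integral_sum[OF fin len])
  moreover have "((\<lambda>\<phi>::real. 4 * R) has_integral (2 * pi) *\<^sub>R (4 * R)) {0..2*pi}"
    using has_integral_const_real[of "4 * R" 0 "2 * pi"] by simp
  ultimately have "(\<Sum>i\<in>I. 4 * dist (a i) (b i)) \<le> (2 * pi) *\<^sub>R (4 * R)"
    by (rule has_integral_le) (use pos in auto)
  then have "4 * (\<Sum>i\<in>I. dist (a i) (b i)) \<le> 4 * (2 * pi * R)"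
    by (simp add: sum_distrib_left mult_ac)
  then show ?thesis by (simp only: mult_le_cancel_left_pos zero_less_numeral)
qed

text \<open>
  A line in the plane that contains a point of \<open>interior S\<close> leaves \<open>interior S\<close> only once on either
  side of that point.
\<close>

lemma line_meets_boundary_segments_at_most_twice:
  fixes S :: "(real^3) set" and a b :: "'i \<Rightarrow> real^3"
  assumes S: "convex S" and n: "norm n = 1" and u: "norm u = 1" "n \<bullet> u = 0"
    and p: "p \<in> interior S" "n \<bullet> p = \<beta>"
    and seg: "\<And>i x. i \<in> I \<Longrightarrow> x \<in> open_segment (a i) (b i) \<Longrightarrow> x \<in> S \<and> x \<notin> interior S \<and> n \<bullet> x = \<beta>"
    and disj: "\<And>i j. i \<in> I \<Longrightarrow> j \<in> I \<Longrightarrow> i \<noteq> j \<Longrightarrow> open_segment (a i) (b i) \<inter> open_segment (a j) (b j) = {}"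
  shows "card {i \<in> I. min (u \<bullet> a i) (u \<bullet> b i) < s \<and> s < max (u \<bullet> a i) (u \<bullet> b i)} \<le> 2"
proof -
  define J where "J = {i \<in> I. min (u \<bullet> a i) (u \<bullet> b i) < s \<and> s < max (u \<bullet> a i) (u \<bullet> b i)}"
  have level: "\<exists>x\<in>open_segment (a i) (b i). u \<bullet> x = t"
    if t: "min (u \<bullet> a i) (u \<bullet> b i) < t" "t < max (u \<bullet> a i) (u \<bullet> b i)" for i t
  proof -
    define l where "l = (t - u \<bullet> a i) / (u \<bullet> b i - u \<bullet> a i)"
    have ne: "u \<bullet> a i \<noteq> u \<bullet> b i" using t by auto
    then have ab: "a i \<noteq> b i" by auto
    have l: "0 < l" "l < 1"
      unfolding l_def using t by (auto simp: min_def max_def divide_simps split: if_splits)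
    have "l * (u \<bullet> b i - u \<bullet> a i) = t - u \<bullet> a i" unfolding l_def using ne by simp
    then have "u \<bullet> ((1 - l) *\<^sub>R a i + l *\<^sub>R b i) = t" by (simp add: inner_add_right algebra_simps)
    moreover have "(1 - l) *\<^sub>R a i + l *\<^sub>R b i \<in> open_segment (a i) (b i)"
      unfolding in_segment using ab l by blast
    ultimately show ?thesis by blast
  qed
  show ?thesis
  proof (cases "J = {}")
    case False
    then obtain i0 where i0: "i0 \<in> J" by blast
    \<comment> \<open>The segment \<open>i0\<close> has points on both sides of the line, so the line meets \<open>interior S\<close>.\<close>
    have "\<exists>y1. y1 \<in> S \<and> n \<bullet> y1 = \<beta> \<and> u \<bullet> y1 < s"
    proof -
      define t where "t = (min (u \<bullet> a i0) (u \<bullet> b i0) + s) / 2"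
      have "min (u \<bullet> a i0) (u \<bullet> b i0) < t" "t < s" "t < max (u \<bullet> a i0) (u \<bullet> b i0)"
        using i0 unfolding J_def t_def by auto
      then show ?thesis using level[of i0 t] seg[of i0] i0 unfolding J_def by auto
    qed
    then obtain y1 where y1: "y1 \<in> S" "n \<bullet> y1 = \<beta>" "u \<bullet> y1 < s" by blast
    have "\<exists>y2. y2 \<in> S \<and> n \<bullet> y2 = \<beta> \<and> u \<bullet> y2 > s"
    proof -
      define t where "t = (max (u \<bullet> a i0) (u \<bullet> b i0) + s) / 2"
      have "min (u \<bullet> a i0) (u \<bullet> b i0) < t" "s < t" "t < max (u \<bullet> a i0) (u \<bullet> b i0)"
        using i0 unfolding J_def t_def by auto
      then show ?thesis using level[of i0 t] seg[of i0] i0 unfolding J_def by auto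
    qed
    then obtain y2 where y2: "y2 \<in> S" "n \<bullet> y2 = \<beta>" "u \<bullet> y2 > s" by blast
    have cross: "\<exists>q\<in>interior S. n \<bullet> q = \<beta> \<and> u \<bullet> q = s"
      if y: "y \<in> S" "n \<bullet> y = \<beta>" "(u \<bullet> p - s) * (u \<bullet> y - s) < 0" for y
    proof -
      define l where "l = (s - u \<bullet> p) / (u \<bullet> y - u \<bullet> p)"
      have l: "0 < l" "l < 1" "l * (u \<bullet> y - u \<bullet> p) = s - u \<bullet> p"
        using y(3) unfolding l_def by (auto simp: mult_less_0_iff divide_simps)
      define q where "q = (1 - l) *\<^sub>R p + l *\<^sub>R y"
      have "y \<noteq> p" using y(3) by (auto simp: not_square_less_zero)
      then have "q \<in> open_segment p y" unfolding in_segment q_def using l by blast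
      moreover have "y \<in> closure S" using y(1) closure_subset by blast
      ultimately have "q \<in> interior S" using in_interior_closure_convex_segment[OF S p(1)] by blast
      moreover have "n \<bullet> q = \<beta>" unfolding q_def using p y by (simp add: inner_add_right algebra_simps)
      moreover have "u \<bullet> q = s" unfolding q_def using l(3) by (simp add: inner_add_right algebra_simps)
      ultimately show ?thesis by blast
    qed
    have "\<exists>q\<in>interior S. n \<bullet> q = \<beta> \<and> u \<bullet> q = s"
    proof -
      consider "u \<bullet> p = s" | "u \<bullet> p < s" | "u \<bullet> p > s" by linarith
      then show ?thesis
      proof cases
        case 1
        then show ?thesis using p by blast
      next
        case 2
        then show ?thesis using cross[OF y2(1,2)] y2(3) by (simp add: mult_neg_pos)
      next
        case 3
        then show ?thesis using cross[OF y1(1,2)] y1(3) by (simp add: mult_pos_neg)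
      qed
    qed
    then obtain q where q: "q \<in> interior S" "n \<bullet> q = \<beta>" "u \<bullet> q = s" by blast
    define w where "w = cross3 n u"
    have "(norm w)\<^sup>2 = 1" unfolding w_def using norm_cross[of n u] n u by simp
    then have w: "norm w = 1" by (simp add: power2_eq_1_iff) (smt (verit) norm_ge_zero)
    have wo: "u \<bullet> w = 0" "u \<bullet> n = 0" "w \<bullet> n = 0"
      unfolding w_def using u by (simp_all add: dot_cross_self inner_commute)
    define \<tau> where "\<tau> x = (x - q) \<bullet> w" for x
    have line: "x = q + \<tau> x *\<^sub>R w" if "n \<bullet> x = \<beta>" "u \<bullet> x = s" for x
    proof -
      have "(x - q) \<bullet> u = 0" "(x - q) \<bullet> n = 0"
        using that q by (simp_all add: inner_diff_right inner_commute[of _ u] inner_commute[of _ n])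
      then show ?thesis
        using orthonormal_expansion[OF u(1) w n wo, of "x - q"] unfolding \<tau>_def by (simp add: algebra_simps)
    qed
    have inside: "q + t *\<^sub>R w \<in> interior S"
      if t: "q + t' *\<^sub>R w \<in> S" "0 < t / t'" "t / t' < 1" for t t'
    proof -
      have t'0: "t' \<noteq> 0" using t(2) by auto
      have "w \<noteq> 0" using w by auto
      have "q + t *\<^sub>R w = (1 - t / t') *\<^sub>R q + (t / t') *\<^sub>R (q + t' *\<^sub>R w)" using t'0 by (simp add: algebra_simps)
      moreover have "q \<noteq> q + t' *\<^sub>R w" using t'0 \<open>w \<noteq> 0\<close> by simp
      ultimately have "q + t *\<^sub>R w \<in> open_segment q (q + t' *\<^sub>R w)" unfolding in_segment using t by blast
      moreover have "q + t' *\<^sub>R w \<in> closure S" using t(1) closure_subset by blast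
      ultimately show ?thesis using in_interior_closure_convex_segment[OF S q(1)] by blast
    qed
    have "\<forall>i\<in>J. \<exists>x\<in>open_segment (a i) (b i). u \<bullet> x = s" using level unfolding J_def by blast
    then obtain X where X: "\<And>i. i \<in> J \<Longrightarrow> X i \<in> open_segment (a i) (b i)" "\<And>i. i \<in> J \<Longrightarrow> u \<bullet> X i = s" by metis
    have JI: "i \<in> I" if "i \<in> J" for i using that unfolding J_def by blast
    have XS: "X i \<in> S" "X i \<notin> interior S" "n \<bullet> X i = \<beta>" if "i \<in> J" for i
      using seg[OF JI[OF that] X(1)[OF that]] by auto
    have Xl: "X i = q + \<tau> (X i) *\<^sub>R w" if "i \<in> J" for i using line[OF XS(3)[OF that] X(2)[OF that]] .
    have t0: "\<tau> (X i) \<noteq> 0" if "i \<in> J" for i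
      using Xl[OF that] XS(2)[OF that] q(1) by (metis add.right_neutral scaleR_zero_left)
    have same: "i = j" if ij: "i \<in> J" "j \<in> J" "sgn (\<tau> (X i)) = sgn (\<tau> (X j))" for i j
    proof (rule ccontr)
      assume "i \<noteq> j"
      then have "X i \<noteq> X j" using disj[OF JI[OF ij(1)] JI[OF ij(2)]] X(1)[OF ij(1)] X(1)[OF ij(2)] by auto
      then have ne: "\<tau> (X i) \<noteq> \<tau> (X j)" using Xl[OF ij(1)] Xl[OF ij(2)] by metis
      have r: "0 < \<tau> (X i) / \<tau> (X j)" "0 < \<tau> (X j) / \<tau> (X i)"
        using ij(3) t0[OF ij(1)] t0[OF ij(2)] by (auto simp: sgn_if zero_less_divide_iff split: if_splits)
      have "\<tau> (X i) / \<tau> (X j) < 1 \<or> \<tau> (X j) / \<tau> (X i) < 1"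
      proof -
        define m where "m = \<tau> (X i) / \<tau> (X j)"
        have "m \<noteq> 1" unfolding m_def using ne t0[OF ij(2)] by simp
        moreover have "m > 0" unfolding m_def by (rule r(1))
        moreover have "\<tau> (X j) / \<tau> (X i) = 1 / m" unfolding m_def by simp
        ultimately show ?thesis unfolding m_def[symmetric] by (cases "m < 1") auto
      qed
      then show False
      proof
        assume "\<tau> (X i) / \<tau> (X j) < 1"
        then have "q + \<tau> (X i) *\<^sub>R w \<in> interior S"
          using inside[of "\<tau> (X j)" "\<tau> (X i)"] r XS(1)[OF ij(2)] Xl[OF ij(2)] by simp
        then show False using XS(2)[OF ij(1)] Xl[OF ij(1)] by simp
      next
        assume "\<tau> (X j) / \<tau> (X i) < 1"
        then have "q + \<tau> (X j) *\<^sub>R w \<in> interior S"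
          using inside[of "\<tau> (X i)" "\<tau> (X j)"] r XS(1)[OF ij(1)] Xl[OF ij(1)] by simp
        then show False using XS(2)[OF ij(2)] Xl[OF ij(2)] by simp
      qed
    qed
    have "inj_on (\<lambda>i. sgn (\<tau> (X i))) J" by (rule inj_onI) (rule same)
    moreover have "(\<lambda>i. sgn (\<tau> (X i))) ` J \<subseteq> {-1, 1}" using t0 by (auto simp: sgn_if)
    ultimately have "card J \<le> card {-1, 1 :: real}" by (intro card_inj_on_le) auto
    then show ?thesis unfolding J_def by simp
  next
    case True
    then show ?thesis by (simp only: J_def[symmetric] card.empty)
  qed
qed

lemma boundary_segments_length:
  fixes S :: "(real^3) set" and a b :: "'i \<Rightarrow> real^3"
  assumes S: "convex S" and n: "norm n = 1" and p: "p \<in> interior S" "n \<bullet> p = \<beta>"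
    and seg: "\<And>i x. i \<in> I \<Longrightarrow> x \<in> open_segment (a i) (b i) \<Longrightarrow> x \<in> S \<and> x \<notin> interior S \<and> n \<bullet> x = \<beta>"
    and disj: "\<And>i j. i \<in> I \<Longrightarrow> j \<in> I \<Longrightarrow> i \<noteq> j \<Longrightarrow> open_segment (a i) (b i) \<inter> open_segment (a j) (b j) = {}"
    and fin: "finite I" and R: "R \<ge> 0"
    and ends: "\<And>i. i \<in> I \<Longrightarrow> n \<bullet> a i = \<beta> \<and> n \<bullet> b i = \<beta> \<and> dist (a i) z \<le> R \<and> dist (b i) z \<le> R"
  shows "(\<Sum>i\<in>I. dist (a i) (b i)) \<le> 2 * pi * R"
proof -
  obtain w0 :: "real^3" where w0: "w0 \<noteq> 0" "orthogonal n w0" using orthogonal_to_vector_exists[of n] by auto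
  define e1 where "e1 = (1 / norm w0) *\<^sub>R w0"
  have e1: "norm e1 = 1" "e1 \<bullet> n = 0" unfolding e1_def using w0 by (auto simp: orthogonal_def inner_commute)
  define e2 where "e2 = cross3 n e1"
  have "(norm e2)\<^sup>2 = 1" unfolding e2_def using norm_cross[of n e1] n e1 by (simp add: inner_commute)
  then have e2: "norm e2 = 1" by (simp add: power2_eq_1_iff) (smt (verit) norm_ge_zero)
  have o: "e1 \<bullet> e2 = 0" "e2 \<bullet> n = 0" unfolding e2_def by (simp_all add: dot_cross_self inner_commute)
  show ?thesis
  proof (rule crofton_bound[OF e1(1) e2 n o(1) e1(2) o(2) fin R])
    show "n \<bullet> (b i - a i) = 0" if "i \<in> I" for i using ends[OF that] by (simp add: inner_diff_right)
    show "dist (a i) z \<le> R" "dist (b i) z \<le> R" if "i \<in> I" for i using ends[OF that] by auto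
    show "card {i \<in> I. min (u \<bullet> a i) (u \<bullet> b i) < s \<and> s < max (u \<bullet> a i) (u \<bullet> b i)} \<le> 2"
      if "norm u = 1" "n \<bullet> u = 0" for u s
      by (rule line_meets_boundary_segments_at_most_twice[OF S n that p seg disj])
  qed
qed

section \<open>Cutting off the vertex\<close>

locale corner_cut = convex_corner P H r for P :: "(real^3) set" and H :: "real^3" and r :: real +
  fixes c :: "real^3" and \<sigma> t :: real
  assumes direction: "norm c = 1"
    and slope_pos: "\<sigma> > 0"
    and slope: "\<And>k. k \<in> tangent_cone \<Longrightarrow> c \<bullet> k \<le> - \<sigma> * norm k"
    and depth: "t > 0" "2 * t < \<sigma> * r"
begin

text \<open>
  What is removed is relatively open in \<open>P\<close>, and \<open>cap\<close> is its closed counterpart. By \<open>slope\<close> and \<open>depth\<close>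
  the cap stays within distance \<open>r / 2\<close> of \<open>H\<close>, so that restricting to the ball has no effect near its
  boundary.
\<close>

definition truncated :: "(real^3) set" where
  "truncated = P - {y \<in> ball H r. c \<bullet> (y - H) > - t}"

definition cap :: "(real^3) set" where
  "cap = {y \<in> P \<inter> ball H r. c \<bullet> (y - H) \<ge> - t}"

definition cross_section :: "(real^3) set" where
  "cross_section = {y \<in> P \<inter> ball H r. c \<bullet> (y - H) = - t}"

lemma depth_over_slope: "t / \<sigma> < r / 2"
  using depth slope_pos by (simp add: field_simps)

lemma depth_over_slope_less_radius: "t / \<sigma> < r"
  using depth_over_slope radius by linarith

lemma norm_in_cap:
  assumes "y \<in> cap"
  shows "norm (y - H) \<le> t / \<sigma>"
proof -
  have "y - H \<in> tangent_cone" using assms in_P_iff_tangent_cone[of y] unfolding cap_def by simp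
  then have "c \<bullet> (y - H) \<le> - \<sigma> * norm (y - H)" by (rule slope)
  moreover have "c \<bullet> (y - H) \<ge> - t" using assms unfolding cap_def by simp
  ultimately have "\<sigma> * norm (y - H) \<le> t" by linarith
  then show ?thesis using slope_pos by (simp add: field_simps)
qed

lemma P_eq: "P = truncated \<union> cap" and truncated_Int_cap: "truncated \<inter> cap = cross_section"
  unfolding truncated_def cap_def cross_section_def by auto

lemma truncated_subset: "truncated \<subseteq> P"
  unfolding truncated_def by blast

lemma H_notin_truncated: "H \<notin> truncated"
  using radius depth unfolding truncated_def by simp

lemma truncated_level: "y \<in> truncated \<Longrightarrow> y \<in> ball H r \<Longrightarrow> c \<bullet> (y - H) \<le> - t"
  unfolding truncated_def by auto

lemma in_truncated_iff: "y \<in> ball H r \<Longrightarrow> y \<in> truncated \<longleftrightarrow> y \<in> P \<and> c \<bullet> (y - H) \<le> - t"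
  unfolding truncated_def by auto

lemma compact_truncated: "compact truncated"
proof -
  have e: "{y \<in> ball H r. c \<bullet> (y - H) > - t} = ball H r \<inter> {y. c \<bullet> y > c \<bullet> H - t}"
    by (auto simp: inner_diff_right)
  show ?thesis unfolding truncated_def e
    by (intro compact_diff plane_boundedD(1)[OF plane_bounded] open_Int open_ball open_halfspace_gt)
qed

lemma closed_cap: "closed cap"
proof -
  have "cap = P \<inter> cball H (t / \<sigma>) \<inter> {y. c \<bullet> y \<ge> c \<bullet> H - t}"
  proof (intro equalityI subsetI)
    fix y assume y: "y \<in> cap"
    then show "y \<in> P \<inter> cball H (t / \<sigma>) \<inter> {y. c \<bullet> y \<ge> c \<bullet> H - t}"
      using norm_in_cap[OF y] unfolding cap_def by (auto simp: dist_norm norm_minus_commute inner_diff_right)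
  next
    fix y assume y: "y \<in> P \<inter> cball H (t / \<sigma>) \<inter> {y. c \<bullet> y \<ge> c \<bullet> H - t}"
    then show "y \<in> cap" using depth_over_slope_less_radius unfolding cap_def by (auto simp: inner_diff_right)
  qed
  then show ?thesis
    using plane_boundedD(2)[OF plane_bounded] by (simp add: closed_Int closed_halfspace_ge)
qed

lemma cross_section_eq_Int: "cross_section = cap \<inter> {y. c \<bullet> y = c \<bullet> H - t}"
  unfolding cross_section_def cap_def by (auto simp: inner_diff_right)

lemma closed_cross_section: "closed cross_section"
  unfolding cross_section_eq_Int by (intro closed_Int closed_cap closed_hyperplane)

lemma convex_cross_section: "convex cross_section"
proof -
  have "cross_section = (P \<inter> ball H r) \<inter> {y. c \<bullet> y = c \<bullet> H - t}"
    unfolding cross_section_def by (auto simp: inner_diff_right)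
  then show ?thesis using convex_near by (simp add: convex_Int convex_hyperplane)
qed

lemma truncated_germ:
  assumes "x \<in> P" "x \<notin> cap"
  obtains \<delta> where "\<delta> > 0" "truncated \<inter> ball x \<delta> = P \<inter> ball x \<delta>" "ball x \<delta> \<inter> cap = {}"
proof -
  have "open (- cap)" using closed_cap by auto
  then obtain \<delta> where d: "\<delta> > 0" "ball x \<delta> \<subseteq> - cap" using assms by (meson ComplI openE)
  have "truncated \<inter> ball x \<delta> = P \<inter> ball x \<delta>" using d(2) P_eq by blast
  then show ?thesis using that d by blast
qed

lemma invariant_along_ray:
  assumes "x \<in> ball H r" "x \<noteq> H"
  shows "translation_invariant_near P x (x - H)"
proof -
  obtain r' where "r' > 0" "conical_near P x r'" using plane_bounded_conical[OF plane_bounded] by blast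
  then show ?thesis using translation_invariant_near_if_conical[OF conical] assms by blast
qed

lemma cross_sectionD:
  assumes "x \<in> cross_section"
  shows "x \<in> P" "x \<in> ball H r" "c \<bullet> (x - H) = - t" "x \<noteq> H" "x \<in> truncated" "x \<in> cap" "norm (x - H) \<le> t / \<sigma>"
  using assms depth norm_in_cap unfolding cross_section_def truncated_def cap_def by auto

lemma scaled_beyond_cross_section:
  assumes "x \<in> P" "x \<in> ball H r" "H + \<mu> *\<^sub>R (x - H) \<in> ball H r" "\<mu> * (c \<bullet> (x - H)) < - t" "\<mu> > 0"
  shows "H + \<mu> *\<^sub>R (x - H) \<in> P \<and> H + \<mu> *\<^sub>R (x - H) \<notin> cap"
  using conical_near_iff[OF conical assms(5,2,3)] assms unfolding cap_def by simp

lemma interior_cross_section_exists: "\<exists>p\<in>cross_section. p \<in> interior P"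
proof -
  have "H \<in> closure (interior P)" using H_in_P plane_boundedD(3)[OF plane_bounded] by simp
  then obtain y where y: "y \<in> interior P" "dist y H < r" using radius closure_approachable by blast
  have yb: "y \<in> ball H r" "y \<in> P" using y interior_subset by (auto simp: dist_commute)
  have "y \<noteq> H" using y H_not_interior by blast
  have "y - H \<in> tangent_cone" using in_P_iff_tangent_cone yb by blast
  then have s: "c \<bullet> (y - H) \<le> - \<sigma> * norm (y - H)" by (rule slope)
  moreover have "\<sigma> * norm (y - H) > 0" using slope_pos \<open>y \<noteq> H\<close> by simp
  ultimately have neg: "c \<bullet> (y - H) < 0" by linarith
  define \<mu> where "\<mu> = t / - (c \<bullet> (y - H))"
  have mu: "\<mu> > 0" unfolding \<mu>_def using neg depth by (intro divide_pos_pos) auto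
  have lev: "\<mu> * (c \<bullet> (y - H)) = - t" unfolding \<mu>_def using neg by simp
  have "\<sigma> * (\<mu> * norm (y - H)) \<le> t"
  proof -
    have "\<mu> * (c \<bullet> (y - H)) \<le> \<mu> * (- \<sigma> * norm (y - H))" using s mu by (intro mult_left_mono) auto
    then show ?thesis unfolding lev by (simp add: mult_ac)
  qed
  then have "\<mu> * norm (y - H) \<le> t / \<sigma>" using slope_pos by (simp add: field_simps)
  then have "\<mu> * norm (y - H) < r" using depth_over_slope_less_radius by (rule le_less_trans)
  then have "norm (\<mu> *\<^sub>R (y - H)) < r" using mu by simp
  then have b: "H + \<mu> *\<^sub>R (y - H) \<in> ball H r" unfolding add_in_ball_iff .
  have "H + \<mu> *\<^sub>R (y - H) \<in> interior P" by (rule interior_homothety[OF conical mu yb(1) b y(1)])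
  moreover have "H + \<mu> *\<^sub>R (y - H) \<in> cross_section"
    unfolding cross_section_def using b calculation interior_subset[of P] lev by auto
  ultimately show ?thesis by blast
qed

lemma closure_interior_truncated: "closure (interior truncated) = truncated"
proof
  show "closure (interior truncated) \<subseteq> truncated"
    using closure_minimal[OF interior_subset compact_imp_closed[OF compact_truncated]] .
  have off: "x \<in> closure (interior truncated)" if x: "x \<in> P" "x \<notin> cap" for x
  proof -
    obtain \<delta> where d: "\<delta> > 0" "truncated \<inter> ball x \<delta> = P \<inter> ball x \<delta>" "ball x \<delta> \<inter> cap = {}"
      by (rule truncated_germ[OF x]) (rule that)
    show ?thesis unfolding closure_approachable
    proof (intro allI impI)
      fix e :: real assume "e > 0"
      then have "min e \<delta> > 0" using d by simp
      moreover have "x \<in> closure (interior P)" using x plane_boundedD(3)[OF plane_bounded] by simp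
      ultimately obtain z where z: "z \<in> interior P" "dist z x < min e \<delta>" using closure_approachable by blast
      have "z \<in> interior (P \<inter> ball x \<delta>)" using z by (simp add: dist_commute)
      then have "z \<in> interior truncated" unfolding d(2)[symmetric] by simp
      then show "\<exists>z\<in>interior truncated. dist z x < e" using z by auto
    qed
  qed
  show "truncated \<subseteq> closure (interior truncated)"
  proof
    fix x assume x: "x \<in> truncated"
    show "x \<in> closure (interior truncated)"
    proof (cases "x \<in> cross_section")
      case False
      then show ?thesis using off x truncated_Int_cap truncated_subset by blast
    next
      case True
      note D = cross_sectionD[OF True]
      have "x \<in> closure (closure (interior truncated))" unfolding closure_approachable[of x "closure (interior truncated)"]
      proof (intro allI impI)
        fix e :: real assume e: "e > 0"
        define m where "m = min e (r - norm (x - H))"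
        have "norm (x - H) < r" using D(2) by (simp add: dist_norm norm_minus_commute)
        then have m: "m > 0" "m \<le> e" "m \<le> r - norm (x - H)" unfolding m_def using e by auto
        define \<eta> where "\<eta> = m / (1 + norm (x - H))"
        have pos: "1 + norm (x - H) > 0" by (simp add: add_pos_nonneg)
        have eta: "\<eta> > 0" "\<eta> * (1 + norm (x - H)) = m" unfolding \<eta>_def using m pos by auto
        then have small: "\<eta> * norm (x - H) < m" by (simp add: distrib_left)
        define y where "y = H + (1 + \<eta>) *\<^sub>R (x - H)"
        have "norm ((1 + \<eta>) *\<^sub>R (x - H)) < r" using small m eta by (simp add: distrib_right)
        then have yb: "y \<in> ball H r" unfolding y_def add_in_ball_iff .
        have "(1 + \<eta>) * (c \<bullet> (x - H)) < - t" unfolding D(3) using eta depth by simp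
        then have "y \<in> P \<and> y \<notin> cap"
          unfolding y_def using scaled_beyond_cross_section[OF D(1,2), of "1 + \<eta>"] yb eta unfolding y_def by simp
        then have "y \<in> closure (interior truncated)" using off by blast
        moreover have "y - x = \<eta> *\<^sub>R (x - H)" unfolding y_def by (simp add: algebra_simps)
        then have "dist y x < e" using small m eta by (simp add: dist_norm)
        ultimately show "\<exists>y\<in>closure (interior truncated). dist y x < e" by blast
      qed
      then show ?thesis by simp
    qed
  qed
qed

lemma frontier_truncated: "x \<in> frontier truncated \<Longrightarrow> x \<in> cross_section \<or> (x \<in> frontier P \<and> x \<notin> cap)"
proof -
  assume x: "x \<in> frontier truncated"
  then have xt: "x \<in> truncated" using compact_imp_closed[OF compact_truncated] by (auto simp: frontier_def)
  show ?thesis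
  proof (cases "x \<in> cap")
    case True
    then show ?thesis using xt truncated_Int_cap by blast
  next
    case False
    obtain \<delta> where d: "\<delta> > 0" "truncated \<inter> ball x \<delta> = P \<inter> ball x \<delta>" "ball x \<delta> \<inter> cap = {}"
      by (rule truncated_germ[OF _ False]) (use xt truncated_subset in blast, rule that)
    then show ?thesis using frontier_germ[OF d(2,1)] x False by blast
  qed
qed

lemma plane_bounded_truncated: "plane_bounded truncated"
proof -
  obtain \<H> where H: "finite \<H>" "\<forall>h\<in>\<H>. is_plane h" "frontier P \<subseteq> \<Union>\<H>"
    using plane_bounded unfolding plane_bounded_def by blast
  define p where "p = {y. c \<bullet> y = c \<bullet> H - t}"
  have "c \<noteq> 0" using direction by auto
  then have "is_plane p" unfolding is_plane_def p_def by blast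
  moreover have "frontier truncated \<subseteq> \<Union>(insert p \<H>)"
  proof
    fix x assume "x \<in> frontier truncated"
    then consider "x \<in> cross_section" | "x \<in> frontier P" using frontier_truncated by blast
    then show "x \<in> \<Union>(insert p \<H>)"
    proof cases
      case 1
      then have "x \<in> p" using cross_sectionD(3)[OF 1] unfolding p_def by (simp add: inner_diff_right)
      then show ?thesis by blast
    qed (use H(3) in blast)
  qed
  ultimately show ?thesis
    unfolding plane_bounded_def using compact_truncated closure_interior_truncated H
    by (intro conjI exI[of _ "insert p \<H>"]) auto
qed

text \<open>Projecting the cap to the cross section retracts the solid onto the truncated one.\<close>

lemma connected_truncated:
  assumes "connected P"
  shows "connected truncated"
proof -
  have ne: "cross_section \<noteq> {}" using interior_cross_section_exists by blast
  define f where "f x = (if x \<in> cap then closest_point cross_section x else x)" for x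
  have "continuous_on (cap \<union> truncated) f"
    unfolding f_def
  proof (rule continuous_on_cases[OF closed_cap compact_imp_closed[OF compact_truncated]])
    show "continuous_on cap (closest_point cross_section)"
      by (rule continuous_on_closest_point[OF convex_cross_section closed_cross_section ne])
    show "\<forall>x. x \<in> cap \<and> x \<notin> cap \<or> x \<in> truncated \<and> x \<in> cap \<longrightarrow> closest_point cross_section x = x"
      using truncated_Int_cap closest_point_self by blast
  qed simp
  then have "continuous_on P f" using P_eq by (simp add: Un_commute)
  then have "connected (f ` P)" using assms by (rule connected_continuous_image)
  moreover have "f ` P = truncated"
  proof (intro equalityI subsetI)
    fix y assume "y \<in> f ` P"
    then obtain x where x: "x \<in> P" "y = f x" by blast
    show "y \<in> truncated"
    proof (cases "x \<in> cap")
      case True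
      then have "y \<in> cross_section" using x closest_point_in_set[OF closed_cross_section ne] unfolding f_def by simp
      then show ?thesis using cross_sectionD by blast
    next
      case False
      then show ?thesis using x P_eq unfolding f_def by auto
    qed
  next
    fix y assume y: "y \<in> truncated"
    have "f y = y"
    proof (cases "y \<in> cap")
      case True
      then have "y \<in> cross_section" using y truncated_Int_cap by blast
      then show ?thesis unfolding f_def using closest_point_self by auto
    qed (simp add: f_def)
    then show "y \<in> f ` P" using y truncated_subset by force
  qed
  ultimately show ?thesis by simp
qed

lemma solid_polyhedron_truncated:
  assumes "connected P"
  shows "solid_polyhedron truncated"
proof (rule solid_polyhedron_if_plane_bounded[OF plane_bounded_truncated connected_truncated[OF assms]])
  have "truncated \<noteq> {}" using interior_cross_section_exists cross_sectionD(5) by blast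
  then show "interior truncated \<noteq> {}" using closure_interior_truncated by auto
qed

subsection \<open>Faces of the truncated solid\<close>

lemma outward_normal_on_cross_section:
  assumes "x \<in> cross_section" "x \<in> interior P"
  shows "outward_normal_at truncated x c"
proof -
  note D = cross_sectionD[OF assms(1)]
  have "x \<in> interior P \<inter> ball H r" using assms D by blast
  moreover have "open (interior P \<inter> ball H r)" by auto
  ultimately obtain \<delta> where d: "\<delta> > 0" "ball x \<delta> \<subseteq> interior P \<inter> ball H r" by (meson openE)
  show ?thesis
  proof (rule outward_normal_atI[OF direction d(1)])
    fix y assume "y \<in> ball x \<delta>"
    then have "y \<in> P" "y \<in> ball H r" using d(2) interior_subset by blast+
    then have "y \<in> truncated \<longleftrightarrow> c \<bullet> (y - H) \<le> - t" using in_truncated_iff by blast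
    moreover have "c \<bullet> (y - x) = c \<bullet> (y - H) + t" using D(3) by (simp add: inner_diff_right)
    ultimately show "y \<in> truncated \<longleftrightarrow> c \<bullet> (y - x) \<le> 0" by auto
  qed
qed

text \<open>
  At a boundary point of \<open>P\<close> in the cutting plane, the truncated solid is no half-space: the half-space
  would be the one below the plane, and by invariance along the ray from the vertex, which crosses the
  plane, \<open>P\<close> would contain a full neighbourhood.
\<close>

lemma no_face_point_on_cross_section_boundary:
  assumes "x \<in> cross_section" "x \<in> frontier P"
  shows "x \<notin> face_points truncated"
proof
  assume "x \<in> face_points truncated"
  then obtain m where "outward_normal_at truncated x m" unfolding face_points_def by blast
  then obtain r1 where r1: "norm m = 1" "r1 > 0" "\<And>y. y \<in> ball x r1 \<Longrightarrow> y \<in> truncated \<longleftrightarrow> m \<bullet> (y - x) \<le> 0"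
    by (rule outward_normal_atE) (rule that)
  note D = cross_sectionD[OF assms(1)]
  obtain r2 where r2: "r2 > 0" "\<And>y s. y \<in> ball x r2 \<Longrightarrow> y + s *\<^sub>R (x - H) \<in> ball x r2 \<Longrightarrow>
      (y + s *\<^sub>R (x - H) \<in> P \<longleftrightarrow> y \<in> P)"
    by (rule translation_invariant_nearE[OF invariant_along_ray[OF D(2,4)]]) (rule that)
  define \<delta> where "\<delta> = min (min r1 r2) (r - dist H x)"
  have d: "\<delta> > 0" "\<delta> \<le> r1" "\<delta> \<le> r2" "\<delta> \<le> r - dist H x" unfolding \<delta>_def using r1 r2 D(2) by auto
  have inH: "y \<in> ball H r" if "y \<in> ball x \<delta>" for y
    using that d dist_triangle[of H y x] by simp
  have "m = c"
  proof (rule half_ball_normal_unique[OF r1(1) direction d(1)])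
    fix y assume y: "y \<in> ball x \<delta>" "m \<bullet> (y - x) \<le> 0"
    then have "y \<in> truncated" using r1(3)[of y] d(2) by simp
    then have "c \<bullet> (y - H) \<le> - t" using truncated_level inH[OF y(1)] by blast
    then show "c \<bullet> (y - x) \<le> 0" using D(3) by (simp add: inner_diff_right)
  qed
  then have below: "y \<in> P" if "y \<in> ball x \<delta>" "c \<bullet> (y - x) \<le> 0" for y
    using r1(3)[of y] that d(2) truncated_subset by auto
  define K where "K = 1 + norm (x - H) / t"
  have K: "K \<ge> 1" unfolding K_def using depth by simp
  have "ball x (\<delta> / K) \<subseteq> P"
  proof
    fix y assume y: "y \<in> ball x (\<delta> / K)"
    have yK: "norm (y - x) * K < \<delta>" using y K by (simp add: dist_norm norm_minus_commute pos_less_divide_eq)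
    then have ylt: "norm (y - x) < \<delta>" using K mult_left_mono[OF K norm_ge_zero[of "y - x"]] by simp
    then have yb: "y \<in> ball x \<delta>" by (simp add: dist_norm norm_minus_commute)
    show "y \<in> P"
    proof (cases "c \<bullet> (y - x) \<le> 0")
      case True
      then show ?thesis using below yb by blast
    next
      case False
      define s where "s = c \<bullet> (y - x) / t"
      have s: "s > 0" unfolding s_def using False depth by simp
      have "c \<bullet> (y - x) \<le> norm (y - x)" using Cauchy_Schwarz_ineq2[of c "y - x"] direction by simp
      then have "s \<le> norm (y - x) / t" unfolding s_def using depth by (simp add: divide_right_mono)
      then have "s * norm (x - H) \<le> (norm (y - x) / t) * norm (x - H)"
        by (intro mult_right_mono) auto
      then have "norm (s *\<^sub>R (x - H)) \<le> (norm (y - x) / t) * norm (x - H)" using s by simp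
      moreover have "norm (y - x) + (norm (y - x) / t) * norm (x - H) = norm (y - x) * K"
        unfolding K_def by (simp add: distrib_left)
      moreover have "norm ((y - x) + s *\<^sub>R (x - H)) \<le> norm (y - x) + norm (s *\<^sub>R (x - H))"
        by (rule norm_triangle_ineq)
      ultimately have "norm ((y - x) + s *\<^sub>R (x - H)) < \<delta>" using yK by linarith
      moreover have e: "y + s *\<^sub>R (x - H) = x + ((y - x) + s *\<^sub>R (x - H))" by simp
      ultimately have b: "y + s *\<^sub>R (x - H) \<in> ball x \<delta>" unfolding e add_in_ball_iff by simp
      have "c \<bullet> (y + s *\<^sub>R (x - H) - x) = c \<bullet> (y - x) + s * (c \<bullet> (x - H))"
        by (simp add: inner_diff_right inner_add_right)
      also have "\<dots> = 0" unfolding D(3) s_def using depth by simp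
      finally have "y + s *\<^sub>R (x - H) \<in> P" using below[OF b] by simp
      then show ?thesis using r2(2)[of y s] yb b d(3) by simp
    qed
  qed
  moreover have "\<delta> / K > 0" using d K by simp
  ultimately have "x \<in> interior P" using mem_interior by blast
  then show False using assms(2) by (simp add: frontier_def)
qed

definition new_face :: "(real^3) set" where
  "new_face = cross_section \<inter> interior P"

text \<open>
  Outside the cap the germs of \<open>P\<close> and of the truncated solid coincide, and in the cutting plane the
  boundary points of \<open>P\<close> are excluded.
\<close>

lemma face_points_truncated: "face_points truncated = (face_points P - cap) \<union> new_face"
proof (intro equalityI subsetI)
  fix x assume x: "x \<in> face_points truncated"
  then have xf: "x \<in> frontier truncated" using face_points_subset_frontier by blast
  show "x \<in> (face_points P - cap) \<union> new_face"
  proof (cases "x \<in> cross_section")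
    case True
    have "x \<notin> frontier P" using no_face_point_on_cross_section_boundary[OF True] x by blast
    then have "x \<in> interior P" using cross_sectionD(1)[OF True] closure_subset by (auto simp: frontier_def)
    then show ?thesis using True unfolding new_face_def by blast
  next
    case False
    then have xP: "x \<in> P" "x \<notin> cap"
      using frontier_truncated[OF xf] frontier_subset_P by auto
    obtain \<delta> where d: "\<delta> > 0" "truncated \<inter> ball x \<delta> = P \<inter> ball x \<delta>" "ball x \<delta> \<inter> cap = {}"
      by (rule truncated_germ[OF xP]) (rule that)
    then show ?thesis using face_points_germ[OF d(2,1)] x xP by blast
  qed
next
  fix x assume "x \<in> (face_points P - cap) \<union> new_face"
  then show "x \<in> face_points truncated"
  proof
    assume x: "x \<in> face_points P - cap"
    then have xP: "x \<in> P" "x \<notin> cap"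
      using face_points_subset_frontier frontier_subset_P by auto
    obtain \<delta> where d: "\<delta> > 0" "truncated \<inter> ball x \<delta> = P \<inter> ball x \<delta>" "ball x \<delta> \<inter> cap = {}"
      by (rule truncated_germ[OF xP]) (rule that)
    then show ?thesis using face_points_germ[OF d(2,1)] x by blast
  next
    assume "x \<in> new_face"
    then show ?thesis using outward_normal_on_cross_section unfolding new_face_def face_points_def by blast
  qed
qed

lemma components_eq_clopen_partition:
  assumes "\<And>C. C \<in> \<C> \<Longrightarrow> connected C \<and> C \<noteq> {} \<and> openin (top_of_set (\<Union>\<C>)) C"
    and "\<And>C D. C \<in> \<C> \<Longrightarrow> D \<in> \<C> \<Longrightarrow> C \<noteq> D \<Longrightarrow> C \<inter> D = {}"
  shows "components (\<Union>\<C>) = \<C>"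
proof -
  have comp: "C \<in> components (\<Union>\<C>)" if C: "C \<in> \<C>" for C
  proof -
    obtain x where x: "x \<in> C" using assms(1)[OF C] by blast
    have sub: "T = C" if T: "connected T" "C \<subseteq> T" "T \<subseteq> \<Union>\<C>" for T
    proof -
      have "openin (top_of_set (\<Union>\<C>)) (\<Union>(\<C> - {C}))" using assms(1) by (intro openin_Union) auto
      moreover have "\<Union>(\<C> - {C}) = \<Union>\<C> - C" using assms(2) C by blast
      ultimately obtain V where V: "open V" "\<Union>\<C> - C = \<Union>\<C> \<inter> V" unfolding openin_open by auto
      obtain W where W: "open W" "C = \<Union>\<C> \<inter> W" using assms(1)[OF C] unfolding openin_open by auto
      have "W \<inter> V \<inter> T = {}" "T \<subseteq> W \<union> V" using W(2) V(2) T(3) by blast+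
      then have "W \<inter> T = {} \<or> V \<inter> T = {}" using connectedD[OF T(1) W(1) V(1)] by blast
      then have "T \<inter> C = {} \<or> T \<inter> C = T" using W(2) V(2) T(3) by blast
      then show ?thesis using x T(2) by blast
    qed
    have "C \<subseteq> \<Union>\<C>" using C by blast
    then show ?thesis unfolding in_components_maximal using assms(1)[OF C] sub by blast
  qed
  show ?thesis
  proof
    show "\<C> \<subseteq> components (\<Union>\<C>)" using comp by blast
    show "components (\<Union>\<C>) \<subseteq> \<C>"
    proof
      fix D assume D: "D \<in> components (\<Union>\<C>)"
      obtain x where x: "x \<in> D" using in_components_nonempty[OF D] by blast
      then obtain C where C: "C \<in> \<C>" "x \<in> C" using in_components_subset[OF D] by blast
      then have "C = D" using components_eq[OF comp[OF C(1)] D] x by blast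
      then show "D \<in> \<C>" using C by blast
    qed
  qed
qed

lemma face_component_scale:
  assumes C: "C \<in> components (face_points P)" "x \<in> C" "x \<in> ball H r" "\<mu> > 0" "H + \<mu> *\<^sub>R (x - H) \<in> ball H r"
  shows "H + \<mu> *\<^sub>R (x - H) \<in> C"
proof -
  define S where "S = closed_segment x (H + \<mu> *\<^sub>R (x - H))"
  have "S \<subseteq> face_points P"
  proof
    fix y assume y: "y \<in> S"
    then obtain u where u: "0 \<le> u" "u \<le> 1" "y = (1 - u) *\<^sub>R x + u *\<^sub>R (H + \<mu> *\<^sub>R (x - H))"
      unfolding S_def in_segment by blast
    have e: "y = H + ((1 - u) + u * \<mu>) *\<^sub>R (x - H)" unfolding u(3) by (simp add: algebra_simps)
    have "S \<subseteq> ball H r" unfolding S_def using C by (intro closed_segment_subset) auto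
    then have yb: "y \<in> ball H r" using y by blast
    have "(1 - u) + u * \<mu> > 0" using u C(4) by (cases "u = 1") (auto intro: add_pos_nonneg)
    moreover have "x \<in> face_points P" using C in_components_subset by blast
    ultimately show "y \<in> face_points P"
      using face_points_homothety[OF conical, of "(1 - u) + u * \<mu>" x] C(3) yb unfolding e by blast
  qed
  moreover have "connected S" "x \<in> S" unfolding S_def by auto
  ultimately have "S \<subseteq> C" using components_maximal[OF C(1), of S] C(2) by blast
  then show ?thesis unfolding S_def by auto
qed

text \<open>
  Pushing points radially away from \<open>H\<close> to distance at least \<open>r / 2\<close> shows that the part of a face
  far from \<open>H\<close> is connected; every remaining point of the face that survives the cut is joined
  to it along its ray.
\<close>

lemma face_component_minus_cap:
  assumes C: "C \<in> components (face_points P)"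
  shows "connected (C - cap) \<and> C - cap \<noteq> {}"
proof -
  have HC: "H \<notin> C"
  proof
    assume "H \<in> C"
    then have "H \<in> face_points P" using in_components_subset[OF C] by blast
    then show False using vertex unfolding vertices_def by blast
  qed
  have CP: "C \<subseteq> P"
    using in_components_subset[OF C] face_points_subset_frontier
      frontier_subset_P by blast
  define g where "g x = max 1 (r / (2 * norm (x - H)))" for x
  define \<kappa> where "\<kappa> x = H + g x *\<^sub>R (x - H)" for x
  have g1: "g x \<ge> 1" for x unfolding g_def by simp
  have far: "\<kappa> x = x" if "norm (x - H) \<ge> r / 2" for x
  proof -
    have "norm (x - H) > 0" using that radius by linarith
    then have "r / (2 * norm (x - H)) \<le> 1" using that by (simp add: divide_le_eq)
    then show ?thesis unfolding \<kappa>_def g_def by (simp add: max_absorb1)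
  qed
  have near: "norm (\<kappa> x - H) = r / 2" if "norm (x - H) < r / 2" "x \<noteq> H" for x
  proof -
    have p: "norm (x - H) > 0" using that by simp
    then have "r / (2 * norm (x - H)) \<ge> 1" using that by (simp add: le_divide_eq)
    then have "g x = r / (2 * norm (x - H))" unfolding g_def by simp
    then show ?thesis unfolding \<kappa>_def using p radius by simp
  qed
  have notcap: "y \<notin> cap" if "norm (y - H) \<ge> r / 2" for y
    using norm_in_cap[of y] depth_over_slope that by auto
  have "continuous_on C \<kappa>"
    unfolding \<kappa>_def g_def using HC by (intro continuous_intros) auto
  then have c0: "connected (\<kappa> ` C)" using in_components_connected[OF C] by (rule connected_continuous_image)
  have kC: "\<kappa> x \<in> C - cap" if x: "x \<in> C" for x
  proof (cases "norm (x - H) \<ge> r / 2")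
    case True
    then show ?thesis using far[OF True] notcap[OF True] x by simp
  next
    case False
    have xH: "x \<noteq> H" using x HC by blast
    have n: "norm (\<kappa> x - H) = r / 2" using near False xH by simp
    then have kb: "\<kappa> x \<in> ball H r" using radius by (simp add: dist_norm norm_minus_commute)
    have xb: "x \<in> ball H r" using False radius by (simp add: dist_norm norm_minus_commute)
    have "\<kappa> x \<in> C" unfolding \<kappa>_def
      by (rule face_component_scale[OF C x xb]) (use g1[of x] kb in \<open>auto simp: \<kappa>_def\<close>)
    then show ?thesis using notcap n by simp
  qed
  have seg: "closed_segment x (\<kappa> x) \<subseteq> C - cap" if x: "x \<in> C" "x \<notin> cap" for x
  proof (cases "norm (x - H) \<ge> r / 2")
    case True
    then show ?thesis using far[OF True] x by simp
  next
    case False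
    have xH: "x \<noteq> H" using x HC by blast
    have n: "norm (\<kappa> x - H) = r / 2" using near False xH by simp
    then have kb: "\<kappa> x \<in> ball H r" using radius by (simp add: dist_norm norm_minus_commute)
    have xb: "x \<in> ball H r" using False radius by (simp add: dist_norm norm_minus_commute)
    have sb: "closed_segment x (\<kappa> x) \<subseteq> ball H r" using xb kb by (intro closed_segment_subset) auto
    have lev: "c \<bullet> (x - H) < - t" using x(2) xb CP x(1) unfolding cap_def by auto
    show ?thesis
    proof
      fix y assume y: "y \<in> closed_segment x (\<kappa> x)"
      then obtain u where u: "0 \<le> u" "u \<le> 1" "y = (1 - u) *\<^sub>R x + u *\<^sub>R \<kappa> x" unfolding in_segment by blast
      define \<nu> where "\<nu> = 1 + u * (g x - 1)"
      have nu: "\<nu> \<ge> 1" unfolding \<nu>_def using u g1[of x] by simp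
      have e: "y = H + \<nu> *\<^sub>R (x - H)" unfolding u(3) \<kappa>_def \<nu>_def by (simp add: algebra_simps)
      have yb: "H + \<nu> *\<^sub>R (x - H) \<in> ball H r" using sb y e by blast
      have "y \<in> C" unfolding e by (rule face_component_scale[OF C x(1) xb _ yb]) (use nu in simp)
      moreover have "\<nu> * (c \<bullet> (x - H)) \<le> 1 * (c \<bullet> (x - H))"
        using nu lev depth by (intro mult_right_mono_neg) auto
      then have "\<nu> * (c \<bullet> (x - H)) < - t" using lev by simp
      then have "y \<notin> cap" unfolding cap_def e by simp
      ultimately show "y \<in> C - cap" by blast
    qed
  qed
  obtain x0 where x0: "x0 \<in> C" using in_components_nonempty[OF C] by blast
  have "connected (\<Union>((\<lambda>x. \<kappa> ` C \<union> closed_segment x (\<kappa> x)) ` (C - cap)))"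
  proof (rule connected_Union)
    fix S assume "S \<in> (\<lambda>x. \<kappa> ` C \<union> closed_segment x (\<kappa> x)) ` (C - cap)"
    then obtain x where x: "x \<in> C" "S = \<kappa> ` C \<union> closed_segment x (\<kappa> x)" by blast
    have "\<kappa> x \<in> \<kappa> ` C \<inter> closed_segment x (\<kappa> x)" using x by simp
    then show "connected S" unfolding x(2) using c0 by (intro connected_Un) auto
  next
    have "\<kappa> x0 \<in> \<Inter>((\<lambda>x. \<kappa> ` C \<union> closed_segment x (\<kappa> x)) ` (C - cap))" using x0 by blast
    then show "\<Inter>((\<lambda>x. \<kappa> ` C \<union> closed_segment x (\<kappa> x)) ` (C - cap)) \<noteq> {}" by blast
  qed
  moreover have "\<Union>((\<lambda>x. \<kappa> ` C \<union> closed_segment x (\<kappa> x)) ` (C - cap)) = C - cap"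
  proof
    show "\<Union>((\<lambda>x. \<kappa> ` C \<union> closed_segment x (\<kappa> x)) ` (C - cap)) \<subseteq> C - cap" using kC seg by blast
    show "C - cap \<subseteq> \<Union>((\<lambda>x. \<kappa> ` C \<union> closed_segment x (\<kappa> x)) ` (C - cap))" by auto
  qed
  ultimately show ?thesis using kC[OF x0] by auto
qed

lemma new_face_props: "convex new_face" "new_face \<noteq> {}"
proof -
  have "new_face = interior (P \<inter> ball H r) \<inter> {y. c \<bullet> y = c \<bullet> H - t}"
    unfolding new_face_def cross_section_def using interior_subset by (auto simp: inner_diff_right)
  then show "convex new_face" using convex_near by (simp only: convex_Int convex_interior convex_hyperplane)
  show "new_face \<noteq> {}" using interior_cross_section_exists unfolding new_face_def by blast
qed

text \<open>
  Each component of face points of \<open>P\<close> survives, diminished by the cap, and the new face is added. All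
  these sets are open among the face points, so they are the components.
\<close>

lemma card_faces_truncated: "card (faces truncated) = card (faces P) + 1"
proof -
  define \<F> where "\<F> = components (face_points P)"
  define \<C> where "\<C> = insert new_face ((\<lambda>C. C - cap) ` \<F>)"
  have fin: "finite \<F>" unfolding \<F>_def by (rule plane_bounded_cells(1)[OF plane_bounded])
  have U: "\<Union>\<C> = face_points truncated"
  proof -
    have "\<Union>((\<lambda>C. C - cap) ` \<F>) = \<Union>\<F> - cap" by blast
    then show ?thesis unfolding \<C>_def face_points_truncated \<F>_def by (auto simp: Union_components)
  qed
  have Fsub: "C \<subseteq> frontier P" if "C \<in> \<F>" for C
    using that in_components_subset face_points_subset_frontier unfolding \<F>_def by blast
  have nf: "new_face \<inter> frontier P = {}" unfolding new_face_def by (auto simp: frontier_def)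
  have dis: "C = D" if "C \<in> \<F>" "D \<in> \<F>" "x \<in> C" "x \<in> D" for C D x
    using that components_eq[of C _ D] unfolding \<F>_def by blast
  have "components (\<Union>\<C>) = \<C>"
  proof (rule components_eq_clopen_partition)
    fix A assume "A \<in> \<C>"
    then consider "A = new_face" | C where "C \<in> \<F>" "A = C - cap" unfolding \<C>_def by blast
    then show "connected A \<and> A \<noteq> {} \<and> openin (top_of_set (\<Union>\<C>)) A"
    proof cases
      case 1
      have "openin (top_of_set (\<Union>\<C>)) (\<Union>\<C> \<inter> interior P)" by auto
      moreover have "\<Union>\<C> \<inter> interior P = new_face"
        unfolding U face_points_truncated using face_points_subset_frontier[of P]
        by (auto simp: new_face_def frontier_def)
      ultimately show ?thesis using 1 new_face_props convex_connected by auto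
    next
      case 2
      have "openin (top_of_set (\<Union>\<C>)) (C - cap)"
        unfolding openin_contains_ball
      proof (intro conjI ballI)
        show "C - cap \<subseteq> \<Union>\<C>" using 2 unfolding \<C>_def by blast
        fix x assume x: "x \<in> C - cap"
        have xC: "x \<in> C" and xcap: "x \<notin> cap" using x by auto
        have xf: "x \<in> face_points P" using xC in_components_subset[OF 2(1)[unfolded \<F>_def]] by blast
        then obtain n where n: "outward_normal_at P x n" unfolding face_points_def by blast
        obtain r1 where r1: "r1 > 0" "\<And>y. y \<in> ball x r1 \<Longrightarrow> y \<in> frontier P \<Longrightarrow> y \<in> C"
          by (rule face_component_contains_disc[OF 2(1)[unfolded \<F>_def] xC n]) (rule that)
        have xP: "x \<in> P" using xf face_points_subset_frontier
            frontier_subset_P by blast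
        obtain r2 where r2: "r2 > 0" "truncated \<inter> ball x r2 = P \<inter> ball x r2" "ball x r2 \<inter> cap = {}"
          by (rule truncated_germ[OF xP xcap]) (rule that)
        have "y \<in> C - cap" if y: "y \<in> ball x (min r1 r2)" "y \<in> \<Union>\<C>" for y
        proof -
          have "y \<in> ball x r1" "y \<in> ball x r2" using y(1) by auto
          then have "y \<notin> cap" using r2(3) by blast
          then have "y \<in> face_points P"
            using y(2) cross_sectionD(6) unfolding U face_points_truncated new_face_def by blast
          then have "y \<in> C" using r1(2) \<open>y \<in> ball x r1\<close> face_points_subset_frontier by blast
          then show ?thesis using \<open>y \<notin> cap\<close> by blast
        qed
        then have "ball x (min r1 r2) \<inter> \<Union>\<C> \<subseteq> C - cap" by blast
        moreover have "min r1 r2 > 0" using r1 r2 by simp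
        ultimately show "\<exists>e>0. ball x e \<inter> \<Union>\<C> \<subseteq> C - cap" by blast
      qed
      then show ?thesis using face_component_minus_cap 2 unfolding \<F>_def by blast
    qed
  next
    fix A B assume AB: "A \<in> \<C>" "B \<in> \<C>" "A \<noteq> B"
    show "A \<inter> B = {}"
    proof (rule ccontr)
      assume "A \<inter> B \<noteq> {}"
      then obtain x where x: "x \<in> A" "x \<in> B" by blast
      have old: "x \<notin> new_face" if "C \<in> \<F>" "x \<in> C" for C using that Fsub nf by blast
      show False using AB x old dis unfolding \<C>_def by auto
    qed
  qed
  then have comps: "components (face_points truncated) = \<C>" unfolding U .
  have "inj_on (\<lambda>C. C - cap) \<F>"
  proof (rule inj_onI)
    fix C D assume CD: "C \<in> \<F>" "D \<in> \<F>" "C - cap = D - cap"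
    then obtain x where "x \<in> C - cap" using face_component_minus_cap unfolding \<F>_def by blast
    then show "C = D" using dis CD by blast
  qed
  then have "card ((\<lambda>C. C - cap) ` \<F>) = card \<F>" by (rule card_image)
  moreover have "new_face \<notin> (\<lambda>C. C - cap) ` \<F>"
    using Fsub nf new_face_props(2) by blast
  ultimately have "card \<C> = card \<F> + 1" unfolding \<C>_def using fin by simp
  then show ?thesis unfolding card_faces comps \<F>_def .
qed

end

section \<open>Edges of the truncated solid\<close>

context corner_cut
begin

definition edge_ends :: "(real^3) set" where
  "edge_ends = {b \<in> vertices P. b \<noteq> H \<and> open_segment H b \<subseteq> edge_points P}"

definition truncated_edge :: "real^3 \<Rightarrow> (real^3) set" where
  "truncated_edge b = closed_segment (H + (t / - (c \<bullet> (b - H))) *\<^sub>R (b - H)) b"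

lemma finite_edge_ends: "finite edge_ends"
  by (rule finite_subset[OF _ finite_vertices[OF plane_bounded]]) (auto simp: edge_ends_def)

lemma edges_at_H: "{E \<in> edges P. H \<in> E} = closed_segment H ` edge_ends"
proof (intro equalityI subsetI)
  fix E assume "E \<in> {E \<in> edges P. H \<in> E}"
  then have E: "E \<in> edges P" "H \<in> E" by auto
  obtain b where "E = closed_segment H b" "b \<in> vertices P" "b \<noteq> H" "open_segment H b \<subseteq> edge_points P"
    by (rule edges_at_vertexE[OF E(1) vertex E(2)]) (rule that)
  then show "E \<in> closed_segment H ` edge_ends" unfolding edge_ends_def by blast
next
  fix E assume "E \<in> closed_segment H ` edge_ends"
  then obtain b where b: "E = closed_segment H b" "b \<in> vertices P" "b \<noteq> H" "open_segment H b \<subseteq> edge_points P"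
    unfolding edge_ends_def by blast
  have "E \<in> edges P"
    unfolding edges_def mem_Collect_eq by (intro exI[of _ H] exI[of _ b] conjI) (use b vertex in auto)
  then show "E \<in> {E \<in> edges P. H \<in> E}" using b(1) by simp
qed

lemma inj_on_closed_segment_H: "inj_on (closed_segment H) edge_ends"
  by (rule inj_onI) (auto simp: closed_segment_eq doubleton_eq_iff edge_ends_def)

lemma edge_end_slope:
  assumes "b \<in> edge_ends"
  shows "r \<le> norm (b - H)" "c \<bullet> (b - H) \<le> - \<sigma> * norm (b - H)"
proof -
  have b: "b \<in> vertices P" "b \<noteq> H" "open_segment H b \<subseteq> edge_points P" using assms unfolding edge_ends_def by auto
  have "b \<notin> ball H r" using no_vertex_near_apex[OF plane_bounded conical] b(1,2) by blast
  then show rb: "r \<le> norm (b - H)" by (simp add: dist_norm norm_minus_commute)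
  define s where "s = r / (2 * norm (b - H))"
  have pos: "norm (b - H) > 0" using b(2) by simp
  have s: "0 < s" "s < 1" unfolding s_def using rb radius pos by (auto simp: divide_less_eq)
  have "H + s *\<^sub>R (b - H) = (1 - s) *\<^sub>R H + s *\<^sub>R b" by (simp add: algebra_simps)
  then have "H + s *\<^sub>R (b - H) \<in> open_segment H b" unfolding in_segment using s b(2) by metis
  then have xP: "H + s *\<^sub>R (b - H) \<in> P"
    using b(3) edge_points_subset_frontier frontier_subset_P by blast
  have "s * norm (b - H) = r / 2" unfolding s_def using pos by simp
  then have "s * norm (b - H) < r" using radius by simp
  then have "b - H \<in> tangent_cone" using tangent_cone_iff[OF s(1)] xP by blast
  then show "c \<bullet> (b - H) \<le> - \<sigma> * norm (b - H)" by (rule slope)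
qed

text \<open>The removed piece of an edge is at least as long as the cut is deep.\<close>

lemma truncated_edge_length:
  assumes "b \<in> edge_ends"
  shows "diameter (truncated_edge b) \<le> diameter (closed_segment H b) - t"
proof -
  define l q where "l = norm (b - H)" and "q = - (c \<bullet> (b - H))"
  have lr: "l \<ge> r" "q \<ge> \<sigma> * l" using edge_end_slope[OF assms] unfolding l_def q_def by auto
  have l0: "l > 0" using lr radius by simp
  have ql: "q \<le> l"
    using Cauchy_Schwarz_ineq2[of c "b - H"] direction unfolding q_def l_def by simp
  have q0: "q > 0" using lr(2) slope_pos l0 mult_pos_pos[of \<sigma> l] by linarith
  have "\<sigma> * r \<le> \<sigma> * l" using lr(1) slope_pos by simp
  then have "t < q" using depth lr(2) by linarith
  then have s: "0 < t / q" "t / q < 1" using depth(1) q0 by auto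
  have "b - (H + (t / q) *\<^sub>R (b - H)) = (1 - t / q) *\<^sub>R (b - H)" by (simp add: algebra_simps)
  then have "dist b (H + (t / q) *\<^sub>R (b - H)) = (1 - t / q) * l"
    unfolding dist_norm l_def using s by simp
  then have "dist (H + (t / q) *\<^sub>R (b - H)) b = (1 - t / q) * l" by (simp only: dist_commute)
  also have "\<dots> = l - t * (l / q)" by (simp add: algebra_simps)
  also have "t * 1 \<le> t * (l / q)" using ql q0 depth(1) by (intro mult_left_mono) auto
  then have "l - t * (l / q) \<le> l - t" by simp
  finally show ?thesis
    unfolding truncated_edge_def diameter_closed_segment q_def[symmetric]
    by (simp add: l_def dist_norm norm_minus_commute)
qed

lemma edge_point_on_cross_section_frontier:
  assumes "x \<in> cross_section" "x \<in> edge_points truncated"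
  shows "x \<in> frontier P"
proof (rule ccontr)
  assume "x \<notin> frontier P"
  then have "x \<in> interior P" using cross_sectionD(1)[OF assms(1)] closure_subset by (auto simp: frontier_def)
  then have "x \<in> face_points truncated"
    using outward_normal_on_cross_section[OF assms(1)] unfolding face_points_def by blast
  then show False using assms(2) unfolding edge_points_iff by blast
qed

lemma edge_points_off_cross_section:
  assumes "x \<in> edge_points truncated" "x \<notin> cross_section"
  shows "x \<in> edge_points P" "x \<notin> cap"
proof -
  have "x \<in> frontier truncated" using assms(1) edge_points_subset_frontier by blast
  then have x: "x \<in> P" "x \<notin> cap"
    using frontier_truncated[of x] assms(2) frontier_subset_P by auto
  obtain \<delta> where d: "\<delta> > 0" "truncated \<inter> ball x \<delta> = P \<inter> ball x \<delta>" "ball x \<delta> \<inter> cap = {}"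
    by (rule truncated_germ[OF x]) (rule that)
  show "x \<in> edge_points P" "x \<notin> cap" using edge_points_germ[OF d(2,1)] assms x by auto
qed

lemma vertices_off_cross_section:
  assumes "x \<in> vertices truncated" "x \<notin> cross_section"
  shows "x \<in> vertices P"
proof -
  have "x \<in> frontier truncated" using assms(1) vertices_subset_frontier by blast
  then have x: "x \<in> P" "x \<notin> cap"
    using frontier_truncated[of x] assms(2) frontier_subset_P by auto
  obtain \<delta> where d: "\<delta> > 0" "truncated \<inter> ball x \<delta> = P \<inter> ball x \<delta>" "ball x \<delta> \<inter> cap = {}"
    by (rule truncated_germ[OF x]) (rule that)
  show ?thesis using vertices_germ[OF d(2,1)] assms by auto
qed

lemma frontier_truncated_subset: "frontier truncated \<subseteq> truncated"
  using frontier_subset_closed[OF compact_imp_closed[OF compact_truncated]] .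

text \<open>
  An edge that touches the cutting plane at an inner point stays in it, and then it runs along the
  boundary of \<open>P\<close>.
\<close>

lemma edge_of_truncated_in_cross_section:
  assumes E: "open_segment a b \<subseteq> edge_points truncated" "open_segment a b \<inter> cross_section \<noteq> {}"
  shows "closed_segment a b \<subseteq> cross_section" "open_segment a b \<subseteq> frontier P"
proof -
  have ab: "a \<noteq> b" using E(2) by auto
  have "open_segment a b \<inter> cross_section = {} \<or> open_segment a b \<inter> cross_section = open_segment a b"
  proof (rule connected_clopen[THEN iffD1, rule_format])
    show "connected (open_segment a b)" by (rule convex_connected[OF convex_open_segment])
    show "openin (top_of_set (open_segment a b)) (open_segment a b \<inter> cross_section) \<and>
          closedin (top_of_set (open_segment a b)) (open_segment a b \<inter> cross_section)"
    proof
      show "closedin (top_of_set (open_segment a b)) (open_segment a b \<inter> cross_section)"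
        by (intro closedin_closed_Int closed_cross_section)
      show "openin (top_of_set (open_segment a b)) (open_segment a b \<inter> cross_section)"
        unfolding openin_contains_ball
      proof (intro conjI ballI)
        fix x assume "x \<in> open_segment a b \<inter> cross_section"
        then have x: "x \<in> open_segment a b" "x \<in> cross_section" by auto
        note D = cross_sectionD[OF x(2)]
        have "translation_invariant_near truncated x (b - a)"
          by (rule edge_points_direction[OF plane_bounded_truncated E(1) x(1)])
        then obtain r1 where r1: "r1 > 0" "\<And>y s. y \<in> ball x r1 \<Longrightarrow> y + s *\<^sub>R (b - a) \<in> ball x r1 \<Longrightarrow>
            (y + s *\<^sub>R (b - a) \<in> truncated \<longleftrightarrow> y \<in> truncated)"
          by (rule translation_invariant_nearE) (rule that)
        define \<delta> where "\<delta> = min r1 (r - dist H x)"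
        have d: "\<delta> > 0" "\<delta> \<le> r1" "\<delta> \<le> r - dist H x" unfolding \<delta>_def using r1 D(2) by auto
        have inH: "y \<in> ball H r" if "y \<in> ball x \<delta>" for y
          using that d dist_triangle[of H y x] by simp
        have along: "x + s *\<^sub>R (b - a) \<in> truncated" if "x + s *\<^sub>R (b - a) \<in> ball x \<delta>" for s
          using r1(2)[of x s] r1(1) that d(2) D(5) by simp
        \<comment> \<open>The edge runs both ways through \<open>x\<close> without rising above the cutting plane.\<close>
        have flat: "c \<bullet> (b - a) = 0"
        proof -
          define s where "s = \<delta> / (2 * norm (b - a))"
          have s: "s > 0" "norm (s *\<^sub>R (b - a)) < \<delta>" unfolding s_def using d(1) ab by auto
          have "x + s *\<^sub>R (b - a) \<in> ball x \<delta>" "x + (- s) *\<^sub>R (b - a) \<in> ball x \<delta>"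
            unfolding add_in_ball_iff using s(2) by auto
          then have "c \<bullet> (x + s *\<^sub>R (b - a) - H) \<le> - t" "c \<bullet> (x + (- s) *\<^sub>R (b - a) - H) \<le> - t"
            using truncated_level along inH by blast+
          then have "s * (c \<bullet> (b - a)) \<le> 0" "s * (c \<bullet> (b - a)) \<ge> 0"
            using D(3) by (simp_all add: inner_add_right inner_diff_right)
          then have "s * (c \<bullet> (b - a)) = 0" by (rule antisym)
          then show ?thesis using s(1) by simp
        qed
        have "y \<in> cross_section" if y: "y \<in> ball x \<delta>" "y \<in> open_segment a b" for y
        proof -
          obtain u where u: "x = (1 - u) *\<^sub>R a + u *\<^sub>R b" using x(1) unfolding in_segment by blast
          obtain u' where u': "y = (1 - u') *\<^sub>R a + u' *\<^sub>R b" using y(2) unfolding in_segment by blast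
          have ye: "y = x + (u' - u) *\<^sub>R (b - a)" unfolding u u' by (simp add: algebra_simps)
          have "y \<in> truncated" using along[of "u' - u"] y(1) unfolding ye[symmetric] by simp
          moreover have "c \<bullet> (y - H) = c \<bullet> (x - H) + (u' - u) * (c \<bullet> (b - a))"
            unfolding ye by (simp add: inner_add_right inner_diff_right)
          ultimately show ?thesis
            unfolding cross_section_def using inH[OF y(1)] truncated_subset D(3) flat by auto
        qed
        then have "ball x \<delta> \<inter> open_segment a b \<subseteq> open_segment a b \<inter> cross_section" by blast
        then show "\<exists>e>0. ball x e \<inter> open_segment a b \<subseteq> open_segment a b \<inter> cross_section" using d(1) by blast
      qed blast
    qed
  qed
  then have sub: "open_segment a b \<subseteq> cross_section" using E(2) by blast
  then have "closure (open_segment a b) \<subseteq> cross_section" by (rule closure_minimal[OF _ closed_cross_section])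
  then show "closed_segment a b \<subseteq> cross_section" using ab by (simp add: closure_open_segment)
  show "open_segment a b \<subseteq> frontier P" using sub E(1) edge_point_on_cross_section_frontier by blast
qed

text \<open>
  At the end \<open>a\<close> in the cutting plane, \<open>P\<close> is invariant along the ray from \<open>H\<close>, so the edge has the
  direction of this ray. Prolonging it down to \<open>H\<close> gives an edge of \<open>P\<close>.
\<close>

lemma edge_of_truncated_from_cross_section:
  assumes a: "a \<in> cross_section" and b: "b \<in> vertices truncated" "a \<noteq> b"
    and E: "open_segment a b \<subseteq> edge_points P" "open_segment a b \<inter> cap = {}"
  shows "b \<in> edge_ends" "closed_segment a b = truncated_edge b"
proof -
  note D = cross_sectionD[OF a]
  define v where "v = a - H"
  have v: "v \<noteq> 0" "norm v < r" "c \<bullet> v = - t" "a = H + v"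
    unfolding v_def using D by (auto simp: dist_norm norm_minus_commute)
  have seg: "a + s *\<^sub>R (b - a) \<in> open_segment a b" if "0 < s" "s < 1" for s
  proof -
    have "a + s *\<^sub>R (b - a) = (1 - s) *\<^sub>R a + s *\<^sub>R b" by (simp add: algebra_simps)
    then show ?thesis unfolding in_segment using that b(2) by metis
  qed
  have "\<exists>k. b - a = k *\<^sub>R v"
  proof (rule parallel_if_approached_by_edge_points[OF plane_bounded])
    show "translation_invariant_near P a v" unfolding v_def by (rule invariant_along_ray[OF D(2,4)])
    fix \<epsilon> :: real assume "\<epsilon> > 0"
    then have "0 < min \<epsilon> 1 / 2" "min \<epsilon> 1 / 2 < \<epsilon>" "min \<epsilon> 1 / 2 < 1" by auto
    then show "\<exists>s>0. s < \<epsilon> \<and> a + s *\<^sub>R (b - a) \<in> edge_points P" using seg E(1) by blast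
  qed (use v b(2) in auto)
  then obtain k where k: "b - a = k *\<^sub>R v" by blast
  have pt: "a + s *\<^sub>R (b - a) = H + (1 + s * k) *\<^sub>R v" for s
    unfolding k by (simp add: v(4) scaleR_add_left)
  have EP: "open_segment a b \<subseteq> P"
    using E(1) edge_points_subset_frontier frontier_subset_P by blast
  have k0: "k > 0"
  proof (rule ccontr)
    assume "\<not> k > 0"
    then have kn: "k < 0" using k b(2) by (cases "k = 0") auto
    define s where "s = min (1/2) (1 / (2 * - k))"
    have s: "0 < s" "s < 1" unfolding s_def using kn by auto
    have "s * - k \<le> (1 / (2 * - k)) * - k" unfolding s_def using kn by (intro mult_right_mono) auto
    then have "s * - k \<le> 1 / 2" using kn by simp
    then have m: "0 < 1 + s * k" "1 + s * k < 1" using s kn by (auto simp: mult_pos_neg)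
    have "norm ((1 + s * k) *\<^sub>R v) < r" using m v(2) mult_right_mono[of "1 + s * k" 1 "norm v"] by simp
    then have "a + s *\<^sub>R (b - a) \<in> ball H r" unfolding pt add_in_ball_iff .
    moreover have "(1 + s * k) * t < 1 * t" using m depth by (intro mult_strict_right_mono) auto
    then have "c \<bullet> (a + s *\<^sub>R (b - a) - H) \<ge> - t" unfolding pt using v(3) by simp
    ultimately have "a + s *\<^sub>R (b - a) \<in> cap" unfolding cap_def using seg[OF s] EP by blast
    then show False using seg[OF s] E(2) by blast
  qed
  have bv: "b = H + (1 + k) *\<^sub>R v" using pt[of 1] by simp
  have lev: "c \<bullet> (b - H) = - ((1 + k) * t)" unfolding bv using v(3) by simp
  have bH: "b \<noteq> H" using lev k0 depth by auto
  have "(1 + k) * t \<noteq> t" using k0 depth by simp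
  then have "b \<notin> cross_section" using cross_sectionD(3)[of b] lev by auto
  then have bP: "b \<in> vertices P" by (rule vertices_off_cross_section[OF b(1)])
  have "open_segment H b \<subseteq> edge_points P"
  proof
    fix x assume "x \<in> open_segment H b"
    then obtain u where u: "0 < u" "u < 1" "x = (1 - u) *\<^sub>R H + u *\<^sub>R b" unfolding in_segment by blast
    define \<nu> where "\<nu> = u * (1 + k)"
    have nu: "0 < \<nu>" "\<nu> < 1 + k" unfolding \<nu>_def using u k0 by auto
    have xe: "x = H + \<nu> *\<^sub>R v" unfolding u(3) bv \<nu>_def by (simp add: algebra_simps)
    have beyond: "H + \<mu> *\<^sub>R v \<in> edge_points P" if "1 < \<mu>" "\<mu> < 1 + k" for \<mu>
    proof -
      have "(\<mu> - 1) / k * k = \<mu> - 1" using k0 by simp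
      then have "H + \<mu> *\<^sub>R v = a + ((\<mu> - 1) / k) *\<^sub>R (b - a)" unfolding pt by simp
      moreover have "0 < (\<mu> - 1) / k" "(\<mu> - 1) / k < 1" using that k0 by auto
      ultimately show ?thesis using seg E(1) by auto
    qed
    show "x \<in> edge_points P"
    proof (cases "\<nu> > 1")
      case True
      then show ?thesis using beyond nu xe by simp
    next
      case False
      \<comment> \<open>Inside the ball, slide a point of the edge beyond \<open>a\<close> down the ray.\<close>
      define m where "m = r / norm v"
      define \<mu> where "\<mu> = min (1 + k / 2) ((1 + m) / 2)"
      have "m > 1" unfolding m_def using v by simp
      then have mu: "1 < \<mu>" "\<mu> < 1 + k" "\<mu> < m"
        using k0 unfolding \<mu>_def by (auto simp: min_less_iff_disj)
      have "\<mu> * norm v < r" using mu(3) v(1) unfolding m_def by (simp add: pos_less_divide_eq)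
      then have zb: "H + \<mu> *\<^sub>R v \<in> ball H r" unfolding add_in_ball_iff using mu by simp
      have ze: "H + \<mu> *\<^sub>R v \<in> edge_points P" by (rule beyond[OF mu(1,2)])
      have "\<nu> * norm v \<le> 1 * norm v" using False by (intro mult_right_mono) auto
      then have xb: "H + \<nu> *\<^sub>R v \<in> ball H r" unfolding add_in_ball_iff using v(2) nu by simp
      have q: "H + (\<nu> / \<mu>) *\<^sub>R (H + \<mu> *\<^sub>R v - H) = H + \<nu> *\<^sub>R v" using mu(1) by simp
      have pos: "\<nu> / \<mu> > 0" using nu mu by simp
      have "H + (\<nu> / \<mu>) *\<^sub>R (H + \<mu> *\<^sub>R v - H) \<in> frontier P"
        by (rule frontier_homothety[OF conical pos zb _ _ plane_boundedD(2)[OF plane_bounded]])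
          (use xb q ze edge_points_iff in auto)
      moreover have "H + (\<nu> / \<mu>) *\<^sub>R (H + \<mu> *\<^sub>R v - H) \<notin> face_points P"
        using face_points_homothety[OF conical pos zb] xb ze unfolding q edge_points_iff by blast
      ultimately have fx: "x \<in> frontier P" "x \<notin> face_points P" unfolding q xe by auto
      have "x \<noteq> H" unfolding xe using nu v by simp
      then have "translation_invariant_near P x (x - H)" using invariant_along_ray xb unfolding xe by blast
      then show ?thesis unfolding edge_points_iff using fx \<open>x \<noteq> H\<close> by (metis right_minus_eq)
    qed
  qed
  then show be: "b \<in> edge_ends" unfolding edge_ends_def using bP bH by blast
  have bHv: "b - H = (1 + k) *\<^sub>R v" unfolding bv by simp
  have "(t / - (c \<bullet> (b - H))) *\<^sub>R (b - H) = (t / ((1 + k) * t)) *\<^sub>R (b - H)"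
    by (simp only: lev minus_minus)
  also have "\<dots> = (t / ((1 + k) * t) * (1 + k)) *\<^sub>R v" by (simp only: bHv scaleR_scaleR)
  also have "t / ((1 + k) * t) * (1 + k) = 1" using k0 depth by simp
  finally have "H + (t / - (c \<bullet> (b - H))) *\<^sub>R (b - H) = a" unfolding v(4) by simp
  then show "closed_segment a b = truncated_edge b" unfolding truncated_edge_def by simp
qed

definition new_edges :: "(real^3) set set" where
  "new_edges = {E \<in> edges truncated. E \<subseteq> cross_section}"

text \<open>
  An edge of the truncated solid lies in the cutting plane, or it has an end there, or it avoids the plane
  altogether and is an old edge.
\<close>

lemma edges_truncated_subset:
  "edges truncated \<subseteq> {E \<in> edges P. H \<notin> E} \<union> truncated_edge ` edge_ends \<union> new_edges"
proof
  fix E assume E: "E \<in> edges truncated"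
  obtain a b where ab: "E = closed_segment a b" "a \<in> vertices truncated" "b \<in> vertices truncated" "a \<noteq> b"
    "open_segment a b \<subseteq> edge_points truncated"
    by (rule edgesE[OF E]) (rule that)
  show "E \<in> {E \<in> edges P. H \<notin> E} \<union> truncated_edge ` edge_ends \<union> new_edges"
  proof (cases "open_segment a b \<inter> cross_section = {}")
    case False
    then have "E \<subseteq> cross_section" using edge_of_truncated_in_cross_section(1)[OF ab(5)] ab(1) by blast
    then show ?thesis using E unfolding new_edges_def by blast
  next
    case True
    then have sub: "open_segment a b \<subseteq> edge_points P" "open_segment a b \<inter> cap = {}"
      using edge_points_off_cross_section ab(5) by blast+
    consider "a \<in> cross_section" | "b \<in> cross_section" | "a \<notin> cross_section" "b \<notin> cross_section" by blast
    then show ?thesis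
    proof cases
      case 1
      then show ?thesis
        using edge_of_truncated_from_cross_section[OF 1 ab(3,4) sub] ab(1) by blast
    next
      case 2
      have "open_segment b a \<subseteq> edge_points P" "open_segment b a \<inter> cap = {}"
        using sub unfolding open_segment_commute[of b a] by auto
      then show ?thesis
        using edge_of_truncated_from_cross_section[OF 2 ab(2) ab(4)[symmetric]] ab(1)
          closed_segment_commute[of a b] by blast
    next
      case 3
      have V: "a \<in> vertices P" "b \<in> vertices P" using vertices_off_cross_section ab 3 by auto
      have "E \<in> edges P"
        unfolding edges_def mem_Collect_eq by (intro exI[of _ a] exI[of _ b] conjI) (use ab sub V in auto)
      moreover have "H \<notin> E"
      proof
        assume "H \<in> E"
        then have "H \<in> open_segment a b \<or> H = a \<or> H = b" unfolding ab(1) open_segment_def by blast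
        then have "H \<in> truncated"
          using ab(2,3,5) vertices_subset_frontier[of truncated] edge_points_subset_frontier[of truncated]
            frontier_truncated_subset by blast
        then show False using H_notin_truncated by blast
      qed
      ultimately show ?thesis by blast
    qed
  qed
qed

text \<open>The cross section lies in the disc cut out of the plane by the circular cone of slope \<open>\<sigma>\<close>.\<close>

lemma dist_cross_section_centre:
  assumes "x \<in> cross_section"
  shows "dist x (H - t *\<^sub>R c) \<le> t * sqrt (1 / \<sigma>\<^sup>2 - 1)"
proof -
  note D = cross_sectionD[OF assms]
  define v where "v = x - H"
  have cc: "c \<bullet> c = 1" using direction by (simp add: norm_eq_1)
  have "(dist x (H - t *\<^sub>R c))\<^sup>2 = (v + t *\<^sub>R c) \<bullet> (v + t *\<^sub>R c)"
    unfolding dist_norm power2_norm_eq_inner v_def by (simp add: algebra_simps)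
  also have "\<dots> = (norm v)\<^sup>2 + 2 * t * (c \<bullet> v) + t\<^sup>2"
    unfolding power2_norm_eq_inner using cc
    by (simp add: inner_add_left inner_add_right inner_commute power2_eq_square)
  also have "\<dots> = (norm v)\<^sup>2 - t\<^sup>2" using D(3) unfolding v_def by (simp add: power2_eq_square)
  also have "\<dots> \<le> (t / \<sigma>)\<^sup>2 - t\<^sup>2"
    using power_mono[OF D(7) norm_ge_zero, of 2] unfolding v_def by simp
  also have "\<dots> = t\<^sup>2 * (1 / \<sigma>\<^sup>2 - 1)" by (simp add: power_divide algebra_simps)
  finally have "sqrt ((dist x (H - t *\<^sub>R c))\<^sup>2) \<le> sqrt (t\<^sup>2 * (1 / \<sigma>\<^sup>2 - 1))" by (rule real_sqrt_le_mono)
  then show ?thesis using depth by (simp add: real_sqrt_mult)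
qed

lemma finite_new_edges: "finite new_edges"
  unfolding new_edges_def using finite_edges[OF plane_bounded_truncated] by simp

text \<open>
  Up to their ends, the new edges are disjoint boundary segments of a planar convex set inside a disc.
\<close>

lemma new_edges_length: "(\<Sum>E\<in>new_edges. diameter E) \<le> 2 * pi * (t * sqrt (1 / \<sigma>\<^sup>2 - 1))"
proof -
  have "\<forall>E\<in>new_edges. \<exists>ab. E = closed_segment (fst ab) (snd ab) \<and> fst ab \<in> vertices truncated \<and>
      snd ab \<in> vertices truncated \<and> fst ab \<noteq> snd ab \<and> open_segment (fst ab) (snd ab) \<subseteq> edge_points truncated"
  proof
    fix E assume "E \<in> new_edges"
    then have "E \<in> edges truncated" unfolding new_edges_def by blast
    then show "\<exists>ab. E = closed_segment (fst ab) (snd ab) \<and> fst ab \<in> vertices truncated \<and>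
      snd ab \<in> vertices truncated \<and> fst ab \<noteq> snd ab \<and> open_segment (fst ab) (snd ab) \<subseteq> edge_points truncated"
      unfolding edges_def by auto
  qed
  then obtain f where f: "\<forall>E\<in>new_edges. E = closed_segment (fst (f E)) (snd (f E)) \<and>
      fst (f E) \<in> vertices truncated \<and> snd (f E) \<in> vertices truncated \<and> fst (f E) \<noteq> snd (f E) \<and>
      open_segment (fst (f E)) (snd (f E)) \<subseteq> edge_points truncated"
    by (elim bchoice[THEN exE]) (rule that)
  define a b where "a E = fst (f E)" and "b E = snd (f E)" for E
  have ab: "E = closed_segment (a E) (b E)" "a E \<in> vertices truncated" "b E \<in> vertices truncated" "a E \<noteq> b E"
    "open_segment (a E) (b E) \<subseteq> edge_points truncated" if "E \<in> new_edges" for E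
    using bspec[OF f that] unfolding a_def b_def by auto
  have cs: "closed_segment (a E) (b E) \<subseteq> cross_section" if "E \<in> new_edges" for E
    using ab(1)[OF that] that unfolding new_edges_def by blast
  obtain p where p: "p \<in> cross_section" "p \<in> interior P" using interior_cross_section_exists by blast
  have pI: "p \<in> interior (P \<inter> ball H r)" using p cross_sectionD(2) by simp
  have plane: "c \<bullet> x = c \<bullet> H - t" if "x \<in> cross_section" for x
    using cross_sectionD(3)[OF that] by (simp add: inner_diff_right)
  have "(\<Sum>E\<in>new_edges. dist (a E) (b E)) \<le> 2 * pi * (t * sqrt (1 / \<sigma>\<^sup>2 - 1))"
  proof (rule boundary_segments_length[OF convex_near direction pI plane[OF p(1)]])
    fix E x assume E: "E \<in> new_edges" "x \<in> open_segment (a E) (b E)"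
    have ne: "open_segment (a E) (b E) \<inter> cross_section \<noteq> {}"
      using E cs[OF E(1)] segment_open_subset_closed by blast
    have "x \<in> frontier P" using edge_of_truncated_in_cross_section(2)[OF ab(5)[OF E(1)] ne] E(2) by blast
    moreover have "x \<in> cross_section" using cs[OF E(1)] E(2) segment_open_subset_closed by blast
    ultimately show "x \<in> P \<inter> ball H r \<and> x \<notin> interior (P \<inter> ball H r) \<and> c \<bullet> x = c \<bullet> H - t"
      using cross_sectionD(1,2) plane by (auto simp: frontier_def)
  next
    fix E F assume EF: "E \<in> new_edges" "F \<in> new_edges" "E \<noteq> F"
    show "open_segment (a E) (b E) \<inter> open_segment (a F) (b F) = {}"
      using edges_eq_if_meet[OF plane_bounded_truncated ab(1,2,3,5)[OF EF(1)] ab(1,2,3,5)[OF EF(2)]] EF(3) by blast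
  next
    show "finite new_edges" by (rule finite_new_edges)
    have "dist p (H - t *\<^sub>R c) \<le> t * sqrt (1 / \<sigma>\<^sup>2 - 1)" by (rule dist_cross_section_centre[OF p(1)])
    then show "0 \<le> t * sqrt (1 / \<sigma>\<^sup>2 - 1)" using zero_le_dist order_trans by blast
  next
    fix E assume E: "E \<in> new_edges"
    have "a E \<in> cross_section" "b E \<in> cross_section" using cs[OF E] by auto
    then show "c \<bullet> a E = c \<bullet> H - t \<and> c \<bullet> b E = c \<bullet> H - t \<and>
      dist (a E) (H - t *\<^sub>R c) \<le> t * sqrt (1 / \<sigma>\<^sup>2 - 1) \<and> dist (b E) (H - t *\<^sub>R c) \<le> t * sqrt (1 / \<sigma>\<^sup>2 - 1)"
      using plane dist_cross_section_centre by blast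
  qed
  moreover have "diameter E = dist (a E) (b E)" if "E \<in> new_edges" for E
    using ab(1)[OF that] diameter_closed_segment by metis
  ultimately show ?thesis by simp
qed

lemma sum_Un_le_sum_nonneg:
  fixes f :: "'i \<Rightarrow> real"
  assumes "finite A" "finite B" "\<And>x. x \<in> A \<inter> B \<Longrightarrow> f x \<ge> 0"
  shows "sum f (A \<union> B) \<le> sum f A + sum f B"
proof -
  have "sum f (A \<inter> B) \<ge> 0" by (rule sum_nonneg) (rule assms(3))
  then show ?thesis using sum.union_inter[OF assms(1,2), of f] by linarith
qed

lemma total_edge_length_truncated:
  "total_edge_length truncated \<le>
     total_edge_length P - real (vertex_degree P H) * t + 2 * pi * (t * sqrt (1 / \<sigma>\<^sup>2 - 1))"
proof -
  define E0 where "E0 = {E \<in> edges P. H \<notin> E}"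
  define T where "T = truncated_edge ` edge_ends"
  have finP: "finite (edges P)" by (rule finite_edges[OF plane_bounded])
  have fin: "finite E0" "finite T" unfolding E0_def T_def using finP finite_edge_ends by auto
  have dT: "diameter E \<ge> 0" if "E \<in> T" for E
    using that unfolding T_def truncated_edge_def by (auto simp: diameter_closed_segment)
  have dE: "diameter E \<ge> 0" if "E \<in> edges S" for E S
    using that by (elim edgesE) (simp add: diameter_closed_segment)
  have d0: "diameter E \<ge> 0" if "E \<in> E0 \<union> T \<union> new_edges" for E
    using that dT dE unfolding E0_def new_edges_def by blast
  have "total_edge_length truncated \<le> sum diameter (E0 \<union> T \<union> new_edges)"
    unfolding total_edge_length_def
  proof (rule sum_mono2)
    show "edges truncated \<subseteq> E0 \<union> T \<union> new_edges" using edges_truncated_subset unfolding E0_def T_def .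
  qed (use fin finite_new_edges d0 in auto)
  also have "\<dots> \<le> sum diameter (E0 \<union> T) + sum diameter new_edges"
    by (rule sum_Un_le_sum_nonneg) (use fin finite_new_edges d0 in auto)
  also have "sum diameter (E0 \<union> T) \<le> sum diameter E0 + sum diameter T"
    by (rule sum_Un_le_sum_nonneg) (use fin d0 in auto)
  also have "sum diameter T \<le> (\<Sum>b\<in>edge_ends. diameter (truncated_edge b))"
    unfolding T_def using sum_image_le[OF finite_edge_ends, of diameter truncated_edge] dT
    by (simp add: T_def o_def)
  also have "\<dots> \<le> (\<Sum>b\<in>edge_ends. diameter (closed_segment H b) - t)"
    by (rule sum_mono) (rule truncated_edge_length)
  also have "\<dots> = sum diameter {E \<in> edges P. H \<in> E} - real (vertex_degree P H) * t"
  proof -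
    have "card {E \<in> edges P. H \<in> E} = card edge_ends"
      unfolding edges_at_H by (rule card_image[OF inj_on_closed_segment_H])
    moreover have "sum diameter {E \<in> edges P. H \<in> E} = (\<Sum>b\<in>edge_ends. diameter (closed_segment H b))"
      unfolding edges_at_H by (simp add: sum.reindex[OF inj_on_closed_segment_H])
    ultimately show ?thesis unfolding vertex_degree_def by (simp add: sum_subtractf)
  qed
  also have "sum diameter new_edges \<le> 2 * pi * (t * sqrt (1 / \<sigma>\<^sup>2 - 1))" by (rule new_edges_length)
  finally have "total_edge_length truncated \<le> sum diameter E0 +
      (sum diameter {E \<in> edges P. H \<in> E} - real (vertex_degree P H) * t) + 2 * pi * (t * sqrt (1 / \<sigma>\<^sup>2 - 1))"
    by simp
  moreover have "total_edge_length P = sum diameter E0 + sum diameter {E \<in> edges P. H \<in> E}"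
  proof -
    have "edges P = E0 \<union> {E \<in> edges P. H \<in> E}" "E0 \<inter> {E \<in> edges P. H \<in> E} = {}" unfolding E0_def by auto
    then show ?thesis unfolding total_edge_length_def
      using sum.union_disjoint[of E0 "{E \<in> edges P. H \<in> E}" diameter] fin finP by simp
  qed
  ultimately show ?thesis by simp
qed

section \<open>Volume and Hausdorff distance of the truncated solid\<close>

lemma cap_subset_cball: "cap \<subseteq> cball H (t / \<sigma>)"
  using norm_in_cap by (auto simp: dist_norm norm_minus_commute)

lemma measure_truncated:
  "measure lebesgue truncated \<ge> measure lebesgue P - unit_ball_vol 3 / \<sigma> ^ 3 * t ^ 3"
proof -
  have "compact cap"
    using closed_cap bounded_subset[OF bounded_cball cap_subset_cball] by (simp add: compact_eq_bounded_closed)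
  then have m: "truncated \<in> lmeasurable" "cap \<in> lmeasurable" using compact_truncated lmeasurable_compact by auto
  have "measure lebesgue P \<le> measure lebesgue truncated + measure lebesgue cap"
    using measure_Un_le[of truncated lebesgue cap] m by (simp add: P_eq[symmetric] fmeasurableD)
  also have "measure lebesgue cap \<le> measure lebesgue (cball H (t / \<sigma>))"
    by (rule measure_mono_fmeasurable[OF cap_subset_cball]) (use m lmeasurable_cball in auto)
  also have "measure lebesgue (cball H (t / \<sigma>)) = unit_ball_vol 3 * (t / \<sigma>) ^ 3"
    using content_cball[of "t / \<sigma>" H] depth slope_pos by simp
  finally show ?thesis by (simp add: power_divide)
qed

lemma hausdorff_distance_truncated:
  "0 \<le> hausdorff_distance truncated P \<and> hausdorff_distance truncated P \<le> 2 * (t / \<sigma>)"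
proof -
  obtain p where p: "p \<in> cross_section" using interior_cross_section_exists by blast
  note D = cross_sectionD[OF p]
  have "infdist x P = 0" if "x \<in> truncated" for x using that truncated_subset by auto
  then have "(\<lambda>x. infdist x P) ` truncated = {0}" using D(5) by auto
  then have 1: "(SUP x\<in>truncated. infdist x P) = 0" by simp
  have 2: "(SUP y\<in>P. infdist y truncated) \<le> 2 * (t / \<sigma>)"
  proof (rule cSUP_least)
    show "P \<noteq> {}" using D(1) by blast
    fix y assume y: "y \<in> P"
    have pos: "t / \<sigma> > 0" using depth slope_pos by simp
    show "infdist y truncated \<le> 2 * (t / \<sigma>)"
    proof (cases "y \<in> cap")
      case True
      have "infdist y truncated \<le> dist y p" by (rule infdist_le[OF D(5)])
      also have "\<dots> \<le> norm (y - H) + norm (p - H)"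
        using dist_triangle[of y p H] by (simp add: dist_norm norm_minus_commute)
      also have "\<dots> \<le> 2 * (t / \<sigma>)" using norm_in_cap[OF True] D(7) by simp
      finally show ?thesis .
    next
      case False
      then have "y \<in> truncated" using y P_eq by blast
      then show ?thesis using pos by simp
    qed
  qed
  show ?thesis unfolding hausdorff_distance_def 1 using 2 depth slope_pos by simp
qed

end

section \<open>The Melzak ratio\<close>

text \<open>A first-order gain in edge length outweighs a third-order loss of volume.\<close>

lemma cube_ratio_decreases:
  fixes e V \<kappa> C :: real
  assumes "e \<ge> 0" "V > 0" "\<kappa> > 0" "C \<ge> 0"
  obtains b where "b > 0" "\<And>t e' v'. 0 < t \<Longrightarrow> t < b \<Longrightarrow> 0 \<le> e' \<Longrightarrow> e' \<le> e - \<kappa> * t \<Longrightarrow>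
    v' \<ge> V - C * t ^ 3 \<Longrightarrow> e' ^ 3 / v' < e ^ 3 / V"
proof -
  define b where "b = min 1 (min (V / (C + 1)) (\<kappa> * V / ((e + 1) * (C + 1))))"
  have b: "b > 0" unfolding b_def using assms by simp
  have "e' ^ 3 / v' < e ^ 3 / V"
    if t: "0 < t" "t < b" and e': "0 \<le> e'" "e' \<le> e - \<kappa> * t" and v': "v' \<ge> V - C * t ^ 3" for t e' v'
  proof -
    have t1: "t < 1" "t < V / (C + 1)" "t < \<kappa> * V / ((e + 1) * (C + 1))" using t(2) unfolding b_def by auto
    have tV: "(C + 1) * t < V" using t1(2) assms(4) by (simp add: pos_less_divide_eq mult.commute)
    have tk: "(e + 1) * (C + 1) * t < \<kappa> * V"
      using t1(3) assms(1,4) by (simp add: pos_less_divide_eq mult.commute)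
    have p: "t ^ 2 \<le> t" "t ^ 3 \<le> t"
      using t(1) t1(1) power_decreasing[of 1 2 t] power_decreasing[of 1 3 t] by auto
    have "C * t ^ 3 \<le> C * t" using p assms(4) by (intro mult_left_mono) auto
    also have "\<dots> < V" using tV t(1) by (simp add: distrib_right)
    finally have v0: "v' > 0" using v' by linarith
    have kt: "\<kappa> * t > 0" using assms(3) t(1) by simp
    have e0: "e > 0" using e' kt by linarith
    have "e * C * t ^ 2 \<le> (e + 1) * (C + 1) * t"
      using p(1) assms t(1) by (intro mult_mono) auto
    then have main: "e * C * t ^ 2 < \<kappa> * V" using tk by linarith
    have "e' ^ 3 = e' ^ 2 * e'" by (simp add: power3_eq_cube power2_eq_square)
    also have "\<dots> \<le> e ^ 2 * (e - \<kappa> * t)"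
      using e' kt by (intro mult_mono power_mono) auto
    finally have "e' ^ 3 * V \<le> e ^ 2 * (e - \<kappa> * t) * V" using assms(2) by (intro mult_right_mono) auto
    also have "\<dots> = e ^ 3 * V - e ^ 2 * t * (\<kappa> * V)"
      by (simp add: algebra_simps power3_eq_cube power2_eq_square)
    also have "\<dots> < e ^ 3 * V - e ^ 2 * t * (e * C * t ^ 2)"
      using mult_strict_left_mono[OF main, of "e ^ 2 * t"] e0 t(1) by simp
    also have "\<dots> = e ^ 3 * (V - C * t ^ 3)"
      by (simp add: algebra_simps power3_eq_cube power2_eq_square)
    also have "\<dots> \<le> e ^ 3 * v'" using v' e0 by (intro mult_left_mono) auto
    finally show ?thesis using v0 assms(2) by (simp add: divide_less_eq less_divide_eq mult.commute pos_divide_less_eq)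
  qed
  then show ?thesis using that[OF b] by blast
qed

lemma total_edge_length_nonneg: "total_edge_length P \<ge> 0"
  unfolding total_edge_length_def
  by (intro sum_nonneg) (auto simp: edges_def diameter_closed_segment)

lemma measure_pos_if_interior:
  fixes P :: "(real^3) set"
  assumes "compact P" "interior P \<noteq> {}"
  shows "measure lebesgue P > 0"
proof -
  obtain y where "y \<in> interior P" using assms(2) by blast
  then obtain e where e: "e > 0" "ball y e \<subseteq> P" using mem_interior by blast
  have "measure lebesgue (ball y e) \<le> measure lebesgue P"
    by (rule measure_mono_fmeasurable[OF e(2)]) (use lmeasurable_compact[OF assms(1)] in auto)
  moreover have "measure lebesgue (ball y e) > 0" using content_ball_pos[OF e(1)] by simp
  ultimately show ?thesis by linarith
qed

theorem theorem2p8: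
  fixes P :: "(real^3) set" and H :: "real^3" and \<theta> :: real
  assumes "solid_polyhedron P"
    and "exposed_vertex P H"
    and "\<theta> = spherical_inradius (gauss_image P H)"
    and "real (vertex_degree P H) > 2 * pi / tan \<theta>"
  shows "\<exists>\<epsilon> Q. perturbation P \<epsilon> Q \<and>
    (\<forall>\<^sub>F t in at_right 0. melzak_ratio (Q t) < melzak_ratio P \<and>
                          card (faces (Q t)) = card (faces P) + 1)"
proof -
  have pb: "plane_bounded P" by (rule solid_polyhedron_plane_bounded[OF assms(1)])
  have P: "compact P" "connected P" "interior P \<noteq> {}" using assms(1) unfolding solid_polyhedron_def by auto
  obtain U where H: "H \<in> vertices P" and U: "open U" "H \<in> U" "convex (U \<inter> P)"
    using assms(2) unfolding exposed_vertex_def by blast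
  obtain r1 where r1: "r1 > 0" "conical_near P H r1" by (rule plane_bounded_conical[OF pb]) (rule that)
  obtain r2 where r2: "r2 > 0" "ball H r2 \<subseteq> U" using U openE by blast
  define r where "r = min r1 r2"
  have r: "r > 0" "r \<le> r1" "r \<le> r2" unfolding r_def using r1 r2 by auto
  interpret convex_corner P H r
  proof
    show "conical_near P H r" using conical_near_mono[OF r1(2) r(2)] .
    have "P \<inter> ball H r = (U \<inter> P) \<inter> ball H r" using r2(2) r(3) by auto
    then show "convex (P \<inter> ball H r)" using U(3) by (simp only: convex_Int convex_ball)
  qed (use pb H r in auto)
  obtain c \<rho> where c: "norm c = 1" "0 < \<rho>" "\<rho> < pi / 2"
    "\<And>k. k \<in> tangent_cone \<Longrightarrow> c \<bullet> k \<le> - sin \<rho> * norm k"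
    "real (vertex_degree P H) > 2 * pi * (cos \<rho> / sin \<rho>)"
    by (rule inradius_direction[OF assms(4)[unfolded assms(3)]]) (rule that)
  define \<sigma> where "\<sigma> = sin \<rho>"
  have \<sigma>: "\<sigma> > 0" unfolding \<sigma>_def using c by (intro sin_gt_zero) auto
  have cot: "sqrt (1 / \<sigma>\<^sup>2 - 1) = cos \<rho> / sin \<rho>"
  proof -
    have "1 / \<sigma>\<^sup>2 - 1 = (1 - \<sigma>\<^sup>2) / \<sigma>\<^sup>2" using \<sigma> by (simp add: diff_divide_distrib)
    also have "\<dots> = (cos \<rho> / sin \<rho>)\<^sup>2" unfolding \<sigma>_def by (simp add: cos_squared_eq power_divide)
    finally have "sqrt (1 / \<sigma>\<^sup>2 - 1) = \<bar>cos \<rho> / sin \<rho>\<bar>" by simp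
    moreover have "cos \<rho> > 0" using c by (intro cos_gt_zero) auto
    ultimately show ?thesis using \<sigma> unfolding \<sigma>_def by simp
  qed
  define Q where "Q t = P - {y \<in> ball H r. c \<bullet> (y - H) > - t}" for t
  define \<epsilon> where "\<epsilon> = \<sigma> * r / 4"
  have eps: "\<epsilon> > 0" unfolding \<epsilon>_def using \<sigma> r by simp
  have cut: "corner_cut P H r c \<sigma> t" if "0 < t" "t \<le> \<epsilon>" for t
  proof (intro corner_cut.intro corner_cut_axioms.intro)
    show "convex_corner P H r" by (rule convex_corner_axioms)
    have "\<sigma> * r > 0" using \<sigma> r by simp
    then show "2 * t < \<sigma> * r" using that unfolding \<epsilon>_def by linarith
    show "c \<bullet> k \<le> - \<sigma> * norm k" if "k \<in> tangent_cone" for k using c(4)[OF that] unfolding \<sigma>_def .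
  qed (use c \<sigma> that in auto)
  have Qt: "Q t = corner_cut.truncated P H r c t" if "0 < t" "t \<le> \<epsilon>" for t
    unfolding Q_def corner_cut.truncated_def[OF cut[OF that]] ..
  have Q0: "Q 0 = P"
  proof -
    have "c \<bullet> (y - H) \<le> 0" if "y \<in> P" "y \<in> ball H r" for y
    proof -
      have "c \<bullet> (y - H) \<le> - sin \<rho> * norm (y - H)" using c(4) in_P_iff_tangent_cone that by blast
      moreover have "sin \<rho> * norm (y - H) \<ge> 0" using \<sigma> unfolding \<sigma>_def by simp
      ultimately show ?thesis by linarith
    qed
    then show ?thesis unfolding Q_def by fastforce
  qed
  define e V \<kappa> C where "e = total_edge_length P" and "V = measure lebesgue P"
    and "\<kappa> = real (vertex_degree P H) - 2 * pi * (cos \<rho> / sin \<rho>)" and "C = unit_ball_vol 3 / \<sigma> ^ 3"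
  have pos: "e \<ge> 0" "V > 0" "\<kappa> > 0" "C \<ge> 0"
    unfolding e_def V_def \<kappa>_def C_def
    using total_edge_length_nonneg measure_pos_if_interior[OF P(1,3)] c(5) \<sigma> by auto
  obtain b where b: "b > 0" "\<And>t e' v'. 0 < t \<Longrightarrow> t < b \<Longrightarrow> 0 \<le> e' \<Longrightarrow> e' \<le> e - \<kappa> * t \<Longrightarrow>
    v' \<ge> V - C * t ^ 3 \<Longrightarrow> e' ^ 3 / v' < e ^ 3 / V"
    by (rule cube_ratio_decreases[OF pos]) (rule that)
  have ratio: "melzak_ratio (Q t) < melzak_ratio P \<and> card (faces (Q t)) = card (faces P) + 1"
    if t: "0 < t" "t < min \<epsilon> b" for t
  proof -
    have t': "t \<le> \<epsilon>" "t < b" using t by auto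
    note cc = cut[OF t(1) t'(1)]
    have "total_edge_length (Q t) \<le> e - real (vertex_degree P H) * t + 2 * pi * (t * (cos \<rho> / sin \<rho>))"
      unfolding Qt[OF t(1) t'(1)] e_def cot[symmetric] by (rule corner_cut.total_edge_length_truncated[OF cc])
    also have "\<dots> = e - \<kappa> * t" unfolding \<kappa>_def by (simp add: algebra_simps)
    finally have "total_edge_length (Q t) \<le> e - \<kappa> * t" .
    moreover have "measure lebesgue (Q t) \<ge> V - C * t ^ 3"
      unfolding Qt[OF t(1) t'(1)] V_def C_def by (rule corner_cut.measure_truncated[OF cc])
    ultimately have "melzak_ratio (Q t) < melzak_ratio P"
      unfolding melzak_ratio_def e_def[symmetric] V_def[symmetric]
      using b(2)[OF t(1) t'(2) total_edge_length_nonneg] by blast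
    moreover have "card (faces (Q t)) = card (faces P) + 1"
      unfolding Qt[OF t(1) t'(1)] by (rule corner_cut.card_faces_truncated[OF cc])
    ultimately show ?thesis ..
  qed
  have "perturbation P \<epsilon> Q"
    unfolding perturbation_def
  proof (intro conjI ballI)
    fix t assume t: "t \<in> {0..\<epsilon>}"
    show "solid_polyhedron (Q t)"
    proof (cases "t = 0")
      case True
      then show ?thesis using Q0 assms(1) by simp
    next
      case False
      then have t0: "0 < t" "t \<le> \<epsilon>" using t by auto
      show ?thesis unfolding Qt[OF t0] by (rule corner_cut.solid_polyhedron_truncated[OF cut[OF t0] P(2)])
    qed
  next
    have ev: "\<forall>\<^sub>F t in at_right 0. 0 \<le> hausdorff_distance (Q t) P \<and> hausdorff_distance (Q t) P \<le> 2 * (t / \<sigma>)"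
      unfolding eventually_at_right_field
    proof (intro exI[of _ \<epsilon>] conjI allI impI)
      fix t :: real assume "0 < t" "t < \<epsilon>"
      then have t0: "0 < t" "t \<le> \<epsilon>" by auto
      show "0 \<le> hausdorff_distance (Q t) P" "hausdorff_distance (Q t) P \<le> 2 * (t / \<sigma>)"
        unfolding Qt[OF t0] using corner_cut.hausdorff_distance_truncated[OF cut[OF t0]] by auto
    qed (rule eps)
    have "((\<lambda>t::real. 2 * (t / \<sigma>)) \<longlongrightarrow> 2 * (0 / \<sigma>)) (at_right 0)" using \<sigma> by (intro tendsto_intros) auto
    then have lim: "((\<lambda>t::real. 2 * (t / \<sigma>)) \<longlongrightarrow> 0) (at_right 0)" by simp
    show "((\<lambda>t. hausdorff_distance (Q t) P) \<longlongrightarrow> 0) (at_right 0)"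
      by (rule tendsto_sandwich[OF _ _ tendsto_const lim]) (use ev in \<open>auto elim: eventually_mono\<close>)
  qed (use eps Q0 in auto)
  moreover have "\<forall>\<^sub>F t in at_right 0. melzak_ratio (Q t) < melzak_ratio P \<and>
      card (faces (Q t)) = card (faces P) + 1"
    unfolding eventually_at_right_field using ratio eps b(1) by (intro exI[of _ "min \<epsilon> b"]) auto
  ultimately show ?thesis by blast
qed

end
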